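(* Let $\mathcal{G}=(V,E)$ be a directed graph on $V=[n]$ whose edge set contains all self-loops, with trek graph $\hat{\mathcal{G}}$. Then the Lyapunov model $\mathcal{M}_{\mathcal{G}}$ is Markov-perfect to $\hat{\mathcal{G}}$; that is, for all distinct $i,j\in V$ and all $K\subseteq V\setminus\{i,j\}$, the conditional independence $i\perp\!\!\!\perp j\mid K$ holds for all $\Sigma\in\mathcal{M}_{\mathcal{G}}$ if and only if $V\setminus(\{i,j\}\cup K)$ separates $i$ and $j$ in $\hat{\mathcal{G}}$.
   Context: $\mathbb{R}^E$ is the set of matrices $M=(m_{ij})\in\mathbb{R}^{n\times n}$ with $m_{ji}=0$ whenever $i\to j\notin E$. A real square matrix is stable if all its eigenvalues have negative real part. $\mathrm{PD}_n$ is the set of positive definite symmetric $n\times n$ matrices. The Lyapunov model of $\mathcal{G}$ is $$\mathcal{M}_{\mathcal{G}}=\{\Sigma\in\mathrm{PD}_n: M\Sigma+\Sigma M^T+2I_n=0\text{ for a stable matrix }M\in\mathbb{R}^E\}.$$ For $\Sigma\in\mathrm{PD}_n$, the statement $i\perp\!\!\!\perp j\mid K$ holds for $\Sigma$ if $X_i\perp\!\!\!\perp X_j\mid X_K$ for $X\sim\mathcal{N}(0,\Sigma)$; equivalently $\det(\Sigma_{\{i\}\cup K,\{j\}\cup K})=0$. Trek graph: $\hat{\mathcal{G}}$ is the symmetric (bidirected) graph on $V$ with an edge $i\leftrightarrow j$ if and only if $i$ and $j$ have a common ancestor in $\mathcal{G}$, where a node $a$ is an ancestor of $b$ if there is a directed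 path (possibly of length $0$) from $a$ to $b$. A set $S$ separates $i$ and $j$ in $\hat{\mathcal{G}}$ if every path in $\hat{\mathcal{G}}$ from $i$ to $j$ intersects $S$. *)

theory Defs
  imports "HOL-Probability.Probability"
begin

text \<open>The vertex set \<open>V = [n]\<close> is the finite index type \<open>'n\<close>; a directed graph on \<open>V\<close> is its
  edge set \<open>E\<close>, where \<open>(i, j) \<in> E\<close> stands for \<open>i \<rightarrow> j\<close>.\<close>

definition supported_matrices :: "('n::finite \<times> 'n) set \<Rightarrow> (real ^ 'n ^ 'n) set" where
  "supported_matrices E = {M. \<forall>i j. (i, j) \<notin> E \<longrightarrow> M $ j $ i = 0}"

definition eigenvalue :: "complex ^ 'n ^ 'n::finite \<Rightarrow> complex \<Rightarrow> bool" where
  "eigenvalue A z \<longleftrightarrow> (\<exists>v. v \<noteq> 0 \<and> A *v v = z *s v)"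

definition stable :: "real ^ 'n ^ 'n::finite \<Rightarrow> bool" where
  "stable M \<longleftrightarrow> (\<forall>z. eigenvalue (map_matrix complex_of_real M) z \<longrightarrow> Re z < 0)"

definition PD :: "(real ^ 'n ^ 'n::finite) set" where
  "PD = {S. transpose S = S \<and> (\<forall>x. x \<noteq> 0 \<longrightarrow> x \<bullet> (S *v x) > 0)}"

definition lyapunov_model :: "('n::finite \<times> 'n) set \<Rightarrow> (real ^ 'n ^ 'n) set" where
  "lyapunov_model E =
    {S \<in> PD. \<exists>M \<in> supported_matrices E. stable M \<and> M ** S + S ** transpose M + 2 *\<^sub>R mat 1 = 0}"

text \<open>The law \<open>N(0, S)\<close> on \<open>\<real>\<^sup>n\<close>, given by its density; meaningful for \<open>S \<in> PD\<close>.\<close>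

definition centered_normal :: "real ^ 'n ^ 'n::finite \<Rightarrow> (real ^ 'n) measure" where
  "centered_normal S = density lborel
    (\<lambda>x. ennreal (exp (- (x \<bullet> (matrix_inv S *v x)) / 2) / sqrt ((2 * pi) ^ CARD('n) * det S)))"

text \<open>Conditional independence of random variables \<open>X\<close> and \<open>Y\<close> given \<open>Z\<close> on a probability space:
  \<open>P(X \<in> A, Y \<in> B | Z) = P(X \<in> A | Z) P(Y \<in> B | Z)\<close> almost surely, for all measurable \<open>A\<close>, \<open>B\<close>.
  Conditioning on \<open>Z\<close> is conditioning on the \<open>\<sigma>\<close>-algebra \<open>\<sigma>(Z)\<close>.\<close>

definition cond_prob_given ::
    "'a measure \<Rightarrow> 'd measure \<Rightarrow> ('a \<Rightarrow> 'd) \<Rightarrow> 'a set \<Rightarrow> 'a \<Rightarrow> real" where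
  "cond_prob_given P N Z A = real_cond_exp P (vimage_algebra (space P) Z N) (indicator A)"

definition cond_indep_var ::
    "'a measure \<Rightarrow> 'b measure \<Rightarrow> ('a \<Rightarrow> 'b) \<Rightarrow> 'c measure \<Rightarrow> ('a \<Rightarrow> 'c)
      \<Rightarrow> 'd measure \<Rightarrow> ('a \<Rightarrow> 'd) \<Rightarrow> bool" where
  "cond_indep_var P Nx X Ny Y Nz Z \<longleftrightarrow>
    (\<forall>A \<in> sets Nx. \<forall>B \<in> sets Ny. AE w in P.
      cond_prob_given P Nz Z ((X -` A \<inter> space P) \<inter> (Y -` B \<inter> space P)) w =
      cond_prob_given P Nz Z (X -` A \<inter> space P) w * cond_prob_given P Nz Z (Y -` B \<inter> space P) w)"

text \<open>\<open>X\<^sub>i\<close> and \<open>X\<^sub>j\<close> are conditionally independent given \<open>X\<^sub>K\<close>, where \<open>X \<sim> N(0, S)\<close> is realised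
  as the identity on \<open>(\<real>\<^sup>n, N(0, S))\<close>. For empty \<open>K\<close> the conditioning \<open>\<sigma>\<close>-algebra is trivial.\<close>

definition gaussian_ci :: "real ^ 'n ^ 'n::finite \<Rightarrow> 'n \<Rightarrow> 'n \<Rightarrow> 'n set \<Rightarrow> bool" where
  "gaussian_ci S i j K \<longleftrightarrow>
    cond_indep_var (centered_normal S) borel (\<lambda>x. x $ i) borel (\<lambda>x. x $ j)
      (PiM K (\<lambda>_. borel)) (\<lambda>x. \<lambda>k\<in>K. x $ k)"

definition is_ancestor :: "('n \<times> 'n) set \<Rightarrow> 'n \<Rightarrow> 'n \<Rightarrow> bool" where
  "is_ancestor E a b \<longleftrightarrow> (a, b) \<in> E\<^sup>*"

definition trek_graph :: "('n \<times> 'n) set \<Rightarrow> ('n \<times> 'n) set" where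
  "trek_graph E = {(i, j). \<exists>a. is_ancestor E a i \<and> is_ancestor E a j}"

definition is_path :: "('n \<times> 'n) set \<Rightarrow> 'n \<Rightarrow> 'n list \<Rightarrow> 'n \<Rightarrow> bool" where
  "is_path H i p j \<longleftrightarrow>
    p \<noteq> [] \<and> hd p = i \<and> last p = j \<and> distinct p \<and> successively (\<lambda>u v. (u, v) \<in> H) p"

definition separates :: "('n \<times> 'n) set \<Rightarrow> 'n set \<Rightarrow> 'n \<Rightarrow> 'n \<Rightarrow> bool" where
  "separates H S i j \<longleftrightarrow> (\<forall>p. is_path H i p j \<longrightarrow> set p \<inter> S \<noteq> {})"

definition markov_perfect :: "(real ^ 'n ^ 'n::finite) set \<Rightarrow> ('n \<times> 'n) set \<Rightarrow> bool" where
  "markov_perfect \<M> H \<longleftrightarrow>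
    (\<forall>i j K. i \<noteq> j \<longrightarrow> K \<subseteq> UNIV - {i, j} \<longrightarrow>
      ((\<forall>S \<in> \<M>. gaussian_ci S i j K) \<longleftrightarrow> separates H (UNIV - ({i, j} \<union> K)) i j))"

end

theory Submission
  imports Defs
begin

text \<open>Two algebraic descriptions of \<open>i \<bottom> j | K\<close> suffice. If \<open>{i, j} \<union> K\<close> splits into uncorrelated blocks
  containing \<open>i\<close> and \<open>j\<close>, then conditional independence holds. Conversely, conditional independence
  forces the residual of the regression of \<open>X\<^sub>i\<close> on \<open>X\<^sub>K\<close> to be uncorrelated with \<open>X\<^sub>j\<close>.

  If \<open>u\<close> and \<open>v\<close> have no common ancestor, then \<open>\<Sigma>\<^sub>u\<^sub>v = 0\<close> on the model: the symmetric matrices supported on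
  the trek graph are invariant under the injective Lyapunov operator, hence contain the solution. The blocks are
  then the connected component of \<open>i\<close> in the trek graph on \<open>{i, j} \<union> K\<close> and its complement.

  If \<open>i\<close> and \<open>j\<close> are connected in \<open>{i, j} \<union> K\<close>, take a shortest path; it has no chords, so \<open>\<Sigma>\<close> is
  tridiagonal on it. Weak positive couplings make its off-diagonal entries positive, and letting the remaining
  nodes of \<open>K\<close> relax at a rate \<open>R \<rightarrow> \<infinity>\<close> makes them asymptotically uncorrelated with the path, without cutting
  the treks that pass through them. So for large \<open>R\<close> the residual is correlated with \<open>X\<^sub>j\<close>.\<close>

section \<open>Factorisation of positive definite matrices\<close>

text \<open>For the residual \<open>x\<close> of \<open>i\<close> on \<open>K\<close>, the number
  \<open>(S *v x) $ j\<close> is the partial covariance, up to sign the determinant of the block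
  with rows \<open>i\<close>, \<open>K\<close> and columns \<open>j\<close>, \<open>K\<close>,
  divided by that of the block on \<open>K\<close>. Working with the vector \<open>x\<close> avoids
  determinants and conditional densities altogether. The obstacle in the second direction is that
  the partial covariance also sees the nodes of \<open>K\<close> off the path, whose contributions
  could cancel that of the path, while deleting their edges could destroy the treks behind the edges
  of the path. A rate \<open>d p\<close> on column \<open>p\<close> of the drift resolves this: the
  variance of \<open>p\<close> shrinks like \<open>1 / d p\<close>, but \<open>d p\<close> times the
  variance, which is what \<open>p\<close> passes on to its children, stays of order one. A fast
  node therefore still carries treks although its covariances are negligible. For this reason the
  estimates concern \<open>max (d u) (d v) * \<Sigma> $ u $ v\<close>, uniformly in the rates. The
  fast nodes enter the kernel equations as an error of order \<open>1 / R\<close>, which back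
  substitution amplifies only by a factor fixed before \<open>R\<close>.\<close>

lemma matrix_vector_component: "(A *v x) $ u = (\<Sum>v\<in>UNIV. A $ u $ v * x $ v)"
  for A :: "real ^ 'n ^ 'm"
  by (simp add: matrix_vector_mult_def)

lemma symmetric_matrix_inner:
  fixes S :: "real ^ 'n ^ 'n"
  assumes "transpose S = S"
  shows "x \<bullet> (S *v y) = (S *v x) \<bullet> y"
  by (metis assms dot_lmul_matrix transpose_matrix_vector)

lemma PD_symmetric: "S \<in> PD \<Longrightarrow> transpose S = S"
  and PD_pos: "S \<in> PD \<Longrightarrow> x \<noteq> 0 \<Longrightarrow> x \<bullet> (S *v x) > 0"
  by (auto simp: PD_def)

lemma symmetric_component: "transpose S = S \<Longrightarrow> S $ u $ v = S $ v $ u"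
  by (metis transpose_def vec_lambda_beta)

text \<open>\<open>x \<bullet> z\<close> is the residual of \<open>z $ w\<close> after regression on
  the coordinates in \<open>I\<close>; the entries of \<open>x\<close> on \<open>I\<close> are minus
  the regression coefficients. They exist because the block of \<open>S\<close> on \<open>I\<close>
  is definite. The map \<open>f\<close> extends that block by the identity off \<open>I\<close>, so
  that injectivity on the whole space yields surjectivity.\<close>

lemma PD_regression:
  fixes S :: "real ^ 'n ^ 'n"
  assumes S: "S \<in> PD" and w: "w \<notin> I"
  obtains x where "x $ w = 1" "\<And>u. u \<notin> insert w I \<Longrightarrow> x $ u = 0" "\<And>u. u \<in> I \<Longrightarrow> (S *v x) $ u = 0"
proof -
  define r where "r x = (\<chi> u. if u \<in> I then x $ u else 0)" for x :: "real ^ 'n"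
  define f where "f x = (\<chi> u. if u \<in> I then (S *v r x) $ u else x $ u)" for x :: "real ^ 'n"
  have r: "linear r"
    by (rule linearI) (auto simp: r_def vec_eq_iff)
  have "linear f"
    by (rule linearI)
      (auto simp: f_def vec_eq_iff linear_add[OF r] linear_scale[OF r] matrix_vector_right_distrib
        matrix_vector_mult_scaleR)
  moreover have "inj f"
  proof (subst linear_injective_0[OF \<open>linear f\<close>], intro allI impI)
    fix x assume fx: "f x = 0"
    have out: "x $ u = 0" if "u \<notin> I" for u
      using fx that by (auto simp: f_def vec_eq_iff dest: spec[of _ u])
    then have rx: "r x = x"
      by (auto simp: r_def vec_eq_iff)
    have "(S *v x) $ u = 0" if "u \<in> I" for u
      using fx that by (auto simp: f_def vec_eq_iff rx dest: spec[of _ u])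
    with out have "x \<bullet> (S *v x) = 0"
      unfolding inner_vec_def by (intro sum.neutral) auto
    with PD_pos[OF S, of x] show "x = 0" by auto
  qed
  ultimately have "surj f"
    by (simp add: linear_injective_imp_surjective)
  then obtain a where a: "f a = (\<chi> u. if u \<in> I then - (S $ u $ w) else 0)"
    by (metis surjD)
  define x where "x = r a + axis w 1"
  have "x $ w = 1" "\<And>u. u \<notin> insert w I \<Longrightarrow> x $ u = 0"
    using w by (auto simp: x_def r_def axis_def)
  moreover have "(S *v x) $ u = 0" if u: "u \<in> I" for u
  proof -
    have "(S *v r a) $ u = - (S $ u $ w)"
      using a u by (auto simp: f_def vec_eq_iff dest: spec[of _ u])
    then show ?thesis
      by (simp add: x_def matrix_vector_right_distrib matrix_vector_mul_component[of S "axis w 1"] inner_axis)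
  qed
  ultimately show ?thesis using that by blast
qed

text \<open>Rows of a partial Cholesky factor. Extending the empty family separately over two uncorrelated blocks
  \<open>A\<close> and \<open>B\<close> and then over everything gives a factor that respects the blocks.\<close>

definition gram_family :: "real ^ 'n ^ 'n \<Rightarrow> 'n::finite set \<Rightarrow> ('n \<Rightarrow> real ^ 'n) \<Rightarrow> bool" where
  "gram_family S I p \<longleftrightarrow>
    (\<forall>u\<in>I. \<forall>v. v \<notin> I \<longrightarrow> p u $ v = 0) \<and> (\<forall>u\<in>I. \<forall>v\<in>I. p u \<bullet> p v = S $ u $ v)"

text \<open>One Cholesky step: \<open>y\<close> reproduces the covariances with \<open>I\<close>,
  and the coordinate \<open>w\<close>, on which all old rows vanish, receives the residual standard
  deviation.\<close>

lemma gram_family_extend_one: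
  fixes S :: "real ^ 'n ^ 'n"
  assumes S: "S \<in> PD" and p: "gram_family S I p" and w: "w \<notin> I"
  shows "\<exists>q. gram_family S (insert w I) q \<and> (\<forall>u\<in>I. q u = p u)"
proof -
  obtain x where x: "x $ w = 1" "\<And>u. u \<notin> insert w I \<Longrightarrow> x $ u = 0"
    "\<And>u. u \<in> I \<Longrightarrow> (S *v x) $ u = 0"
    using PD_regression[OF S w] by blast
  have Sx: "(S *v x) $ u = S $ u $ w + (\<Sum>v\<in>I. S $ u $ v * x $ v)" for u
  proof -
    have "(S *v x) $ u = (\<Sum>v\<in>insert w I. S $ u $ v * x $ v)"
      unfolding matrix_vector_component by (rule sum.mono_neutral_right) (auto simp: x(2))
    then show ?thesis using w by (simp add: x(1))
  qed
  have sym: "S $ u $ v = S $ v $ u" for u v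
    using symmetric_component[OF PD_symmetric[OF S]] .
  have "x \<bullet> (S *v x) = (\<Sum>u\<in>insert w I. x $ u * (S *v x) $ u)"
    unfolding inner_vec_def by (rule sum.mono_neutral_cong_right) (auto simp: x(2))
  also have "\<dots> = (S *v x) $ w"
    using w by (simp add: x(1,3))
  finally have pos: "(S *v x) $ w > 0"
    using PD_pos[OF S, of x] x(1) by force
  define y where "y = - (\<Sum>v\<in>I. x $ v *\<^sub>R p v)"
  have y_out: "y $ v = 0" if "v \<notin> I" for v
    using p that by (auto simp: y_def gram_family_def intro!: sum.neutral)
  have yp: "p u \<bullet> y = S $ u $ w" if u: "u \<in> I" for u
  proof -
    have "p u \<bullet> y = - (\<Sum>v\<in>I. S $ u $ v * x $ v)"
      using p u by (auto simp: y_def gram_family_def inner_sum_right intro!: sum.cong)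
    also have "\<dots> = S $ u $ w"
      using Sx[of u] x(3)[OF u] by simp
    finally show ?thesis .
  qed
  have "y \<bullet> y = - (\<Sum>v\<in>I. x $ v * (p v \<bullet> y))"
    by (subst (1) y_def) (simp add: inner_sum_left)
  also have "\<dots> = - (\<Sum>v\<in>I. S $ w $ v * x $ v)"
    by (simp add: yp sym[of w] mult.commute)
  finally have yy: "y \<bullet> y = S $ w $ w - (S *v x) $ w"
    using Sx[of w] by simp
  define q where "q = p(w := y + axis w (sqrt ((S *v x) $ w)))"
  have y_w: "y \<bullet> axis w c = 0" "axis w c \<bullet> y = 0" for c
    using y_out[OF w] by (auto simp: inner_axis inner_axis')
  have p_w: "p u \<bullet> axis w c = 0" if "u \<in> I" for u c
    using p that w by (auto simp: inner_axis gram_family_def)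
  have qq: "q w \<bullet> q w = S $ w $ w"
    using yy pos by (simp add: q_def inner_add_left inner_add_right y_w inner_axis y_out[OF w])
  have qp: "q u \<bullet> q w = S $ u $ w" if "u \<in> I" for u
    using that w yp[OF that] p_w[OF that] by (auto simp: q_def inner_add_right)
  have "gram_family S (insert w I) q"
    unfolding gram_family_def
  proof (intro conjI ballI allI impI)
    fix u v assume "u \<in> insert w I" "v \<notin> insert w I"
    then show "q u $ v = 0"
      using p y_out[of v] by (auto simp: q_def gram_family_def axis_def)
  next
    fix u v assume "u \<in> insert w I" "v \<in> insert w I"
    then consider "u = w" "v = w" | "u = w" "v \<in> I" | "u \<in> I" "v = w"
      | "u \<in> I" "v \<in> I" "u \<noteq> w" "v \<noteq> w" using w by auto
    then show "q u \<bullet> q v = S $ u $ v"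
    proof cases
      case 4 then show ?thesis using p by (simp add: q_def gram_family_def)
    qed (use qq qp sym in \<open>auto simp: inner_commute\<close>)
  qed
  moreover have "\<forall>u\<in>I. q u = p u"
    using w by (auto simp: q_def)
  ultimately show ?thesis by blast
qed

lemma gram_family_extend:
  fixes S :: "real ^ 'n ^ 'n"
  assumes S: "S \<in> PD" and p: "gram_family S I p"
  shows "\<exists>q. gram_family S (I \<union> J) q \<and> (\<forall>u\<in>I. q u = p u)"
proof -
  have "finite J" by simp
  then show ?thesis
  proof (induction J)
    case empty
    then show ?case using p by auto
  next
    case (insert w J)
    then obtain q where q: "gram_family S (I \<union> J) q" "\<forall>u\<in>I. q u = p u" by blast
    show ?case
    proof (cases "w \<in> I \<union> J")
      case True
      then have "I \<union> insert w J = I \<union> J" by auto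
      then show ?thesis using q by auto
    next
      case False
      from gram_family_extend_one[OF S q(1) False] q(2) show ?thesis by fastforce
    qed
  qed
qed

text \<open>The zero pattern of \<open>P\<close> makes the coordinates in \<open>A\<close> and those
  in \<open>B\<close> functions of disjoint sets of independent standard normals. Empty blocks give
  a factorisation without constraints.\<close>

lemma PD_factorization:
  fixes S :: "real ^ 'n ^ 'n"
  assumes S: "S \<in> PD" and AB: "A \<inter> B = {}" "\<And>a b. a \<in> A \<Longrightarrow> b \<in> B \<Longrightarrow> S $ a $ b = 0"
  obtains P where "S = P ** transpose P" "det P \<noteq> 0"
    "\<And>a u. a \<in> A \<Longrightarrow> u \<notin> A \<Longrightarrow> P $ a $ u = 0" "\<And>b u. b \<in> B \<Longrightarrow> u \<notin> B \<Longrightarrow> P $ b $ u = 0"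
proof -
  have "gram_family S {} p" for p by (simp add: gram_family_def)
  then obtain p q where p: "gram_family S A p" and q: "gram_family S B q"
    using gram_family_extend[OF S, of "{}"] by (metis Un_empty_left)
  define r where "r u = (if u \<in> A then p u else q u)" for u
  have orth: "p a \<bullet> q b = S $ a $ b" if "a \<in> A" "b \<in> B" for a b
  proof -
    have "p a $ v * q b $ v = 0" for v
      using p q that AB(1) by (cases "v \<in> A") (simp_all add: gram_family_def disjoint_iff)
    then have "p a \<bullet> q b = 0" unfolding inner_vec_def by (auto intro!: sum.neutral)
    then show ?thesis using AB(2)[OF that] by simp
  qed
  have "gram_family S (A \<union> B) r"
    using p q orth symmetric_component[OF PD_symmetric[OF S]] AB(1)
    by (auto simp: gram_family_def r_def inner_commute)
  then obtain t where t: "gram_family S (A \<union> B \<union> UNIV) t" "\<forall>u\<in>A \<union> B. t u = r u"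
    using gram_family_extend[OF S] by blast
  define P where "P = (\<chi> u. t u)"
  have SP: "S = P ** transpose P"
    using t(1) by (simp add: vec_eq_iff gram_family_def P_def matrix_matrix_mult_def transpose_def inner_vec_def)
  moreover have "det P \<noteq> 0"
  proof
    assume "det P = 0"
    then have "det (transpose P) = 0" by simp
    then have "\<not> invertible (transpose P)" by (simp add: invertible_det_nz)
    then obtain x where x: "x \<noteq> 0" "transpose P *v x = 0"
      using invertible_left_inverse matrix_left_invertible_ker by blast
    then have "S *v x = 0" unfolding SP by (simp flip: matrix_vector_mul_assoc)
    with PD_pos[OF S x(1)] show False by simp
  qed
  moreover have "P $ a $ u = 0" if "a \<in> A" "u \<notin> A" for a u
    using p t(2) that by (auto simp: P_def r_def gram_family_def)
  moreover have "P $ b $ u = 0" if "b \<in> B" "u \<notin> B" for b u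
    using q t(2) that AB(1) by (auto simp: P_def r_def gram_family_def)
  ultimately show ?thesis using that by blast
qed

section \<open>Gaussian measures under linear maps\<close>

lemma prod_Basis_vec: "(\<Prod>b\<in>Basis. f b) = (\<Prod>i\<in>UNIV. f (axis i (1::real)))"
  for f :: "real ^ 'n::finite \<Rightarrow> 'b::comm_monoid_mult"
proof -
  have "(Basis :: (real ^ 'n) set) = (\<lambda>i. axis i 1) ` UNIV" by (auto simp: Basis_vec_def)
  show ?thesis unfolding \<open>Basis = _\<close> by (subst prod.reindex) (auto simp: inj_on_def axis_eq_axis)
qed

lemma sum_Basis_vec: "(\<Sum>b\<in>Basis. f b) = (\<Sum>i\<in>UNIV. f (axis i (1::real)))"
  for f :: "real ^ 'n::finite \<Rightarrow> 'b::comm_monoid_add"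
proof -
  have "(Basis :: (real ^ 'n) set) = (\<lambda>i. axis i 1) ` UNIV" by (auto simp: Basis_vec_def)
  show ?thesis unfolding \<open>Basis = _\<close> by (subst sum.reindex) (auto simp: inj_on_def axis_eq_axis)
qed

lemma vec_lambda_borel_measurable [measurable]:
  "(\<lambda>z. \<chi> u. z u) \<in> borel_measurable (PiM UNIV (\<lambda>_::'n::finite. borel :: real measure))"
  by (rule borel_measurable_euclidean_space[THEN iffD2])
    (auto simp: Basis_vec_def inner_axis)

lemma lborel_vec:
  "(lborel :: (real ^ 'n::finite) measure) = distr (PiM UNIV (\<lambda>_. lborel)) borel (\<lambda>z. \<chi> u. z u)"
proof (rule lborel_eqI)
  interpret product_sigma_finite "\<lambda>_::'n. lborel :: real measure" ..
  fix l u :: "real ^ 'n"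
  assume le: "\<And>b. b \<in> Basis \<Longrightarrow> l \<bullet> b \<le> u \<bullet> b"
  have le': "l $ i \<le> u $ i" for i
    using le[of "axis i 1"] by (simp add: inner_axis axis_in_Basis_iff)
  have [measurable]: "(\<lambda>z. \<chi> u. z u) \<in> borel_measurable (PiM UNIV (\<lambda>_::'n. lborel :: real measure))"
    using vec_lambda_borel_measurable by (simp cong: measurable_cong_sets sets_PiM_cong)
  have "emeasure (distr (PiM UNIV (\<lambda>_. lborel)) borel (\<lambda>z. \<chi> u. z u)) (box l u)
     = emeasure (PiM UNIV (\<lambda>_. lborel)) (Pi\<^sub>E UNIV (\<lambda>i. {l $ i <..< u $ i}))"
    by (subst emeasure_distr) (auto simp: space_PiM mem_box_cart PiE_iff intro!: arg_cong[where f="emeasure _"])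
  also have "\<dots> = (\<Prod>i\<in>UNIV. ennreal (u $ i - l $ i))"
    by (subst emeasure_PiM) (auto simp: le')
  also have "\<dots> = ennreal (\<Prod>b\<in>Basis. (u - l) \<bullet> b)"
    by (simp add: prod_Basis_vec inner_axis prod_ennreal le')
  finally show "emeasure (distr (PiM UNIV (\<lambda>_. lborel)) borel (\<lambda>z. \<chi> u. z u)) (box l u)
    = ennreal (\<Prod>b\<in>Basis. (u - l) \<bullet> b)" .
qed simp

lemma density_PiM:
  fixes M :: "'i \<Rightarrow> 'a measure"
  assumes M: "product_sigma_finite M" and I: "finite I"
    and f: "\<And>i. i \<in> I \<Longrightarrow> f i \<in> borel_measurable (M i)"
    and sf: "product_sigma_finite (\<lambda>i. density (M i) (f i))"
  shows "density (PiM I M) (\<lambda>x. \<Prod>i\<in>I. f i (x i)) = PiM I (\<lambda>i. density (M i) (f i))"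
proof (rule product_sigma_finite.PiM_eqI[OF sf I])
  note f[measurable]
  show "sets (density (PiM I M) (\<lambda>x. \<Prod>i\<in>I. f i (x i))) = sets (PiM I (\<lambda>i. density (M i) (f i)))"
    by (simp cong: sets_PiM_cong)
  fix A assume A: "\<And>i. i \<in> I \<Longrightarrow> A i \<in> sets (density (M i) (f i))"
  then have A': "\<And>i. i \<in> I \<Longrightarrow> A i \<in> sets (M i)" by simp
  have [measurable]: "(\<lambda>x. \<Prod>i\<in>I. f i (x i)) \<in> borel_measurable (PiM I M)"
    using I by measurable
  have "emeasure (density (PiM I M) (\<lambda>x. \<Prod>i\<in>I. f i (x i))) (Pi\<^sub>E I A)
    = (\<integral>\<^sup>+x. (\<Prod>i\<in>I. f i (x i)) * indicator (Pi\<^sub>E I A) x \<partial>PiM I M)"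
    using A' I by (subst emeasure_density) (auto intro!: sets_PiM_I_finite)
  also have "\<dots> = (\<integral>\<^sup>+x. (\<Prod>i\<in>I. f i (x i) * indicator (A i) (x i)) \<partial>PiM I M)"
    using I by (intro nn_integral_cong)
      (auto simp: prod.distrib indicator_def space_PiM PiE_iff prod_zero_iff split: if_splits)
  also have "\<dots> = (\<Prod>i\<in>I. \<integral>\<^sup>+x. f i x * indicator (A i) x \<partial>M i)"
    using A' by (intro product_sigma_finite.product_nn_integral_prod[OF M I]) auto
  also have "\<dots> = (\<Prod>i\<in>I. emeasure (density (M i) (f i)) (A i))"
    using A' by (intro prod.cong) (auto simp: emeasure_density)
  finally show "emeasure (density (PiM I M) (\<lambda>x. \<Prod>i\<in>I. f i (x i))) (Pi\<^sub>E I A)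
    = (\<Prod>i\<in>I. emeasure (density (M i) (f i)) (A i))" .
qed

abbreviation std_normal :: "real measure" where
  "std_normal \<equiv> density lborel (\<lambda>x. ennreal (std_normal_density x))"

lemma matrix_inv_mat_1: "matrix_inv (mat 1 :: real ^ 'n ^ 'n) = mat 1"
proof -
  have "\<exists>B. mat 1 ** B = mat 1 \<and> B ** mat 1 = (mat 1 :: real ^ 'n ^ 'n)" by (rule exI[of _ "mat 1"]) simp
  from someI_ex[OF this] show ?thesis by (simp add: matrix_inv_def)
qed

lemma centered_normal_mat_1:
  "centered_normal (mat 1) = distr (PiM UNIV (\<lambda>_::'n::finite. std_normal)) borel (\<lambda>z. \<chi> u. z u)"
proof -
  have [measurable]: "(\<lambda>z. \<chi> u. z u) \<in> borel_measurable (PiM UNIV (\<lambda>_::'n. lborel :: real measure))"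
    using vec_lambda_borel_measurable by (simp cong: measurable_cong_sets sets_PiM_cong)
  interpret std: prob_space std_normal by (rule prob_space_normal_density) simp
  have psf: "product_sigma_finite (\<lambda>_::'n. std_normal)" ..
  have dens: "exp (- ((\<chi> u. z u) \<bullet> (\<chi> u. z u)) / 2) / sqrt ((2 * pi) ^ CARD('n))
      = (\<Prod>u\<in>UNIV. std_normal_density (z u))" for z :: "'n \<Rightarrow> real"
  proof -
    have "- ((\<chi> u. z u) \<bullet> (\<chi> u. z u)) / 2 = (\<Sum>u\<in>UNIV. - (z u)\<^sup>2 / 2)"
      by (simp add: inner_vec_def power2_eq_square sum_negf sum_divide_distrib)
    moreover have "(\<Prod>u\<in>UNIV. std_normal_density (z u))
        = (\<Prod>u\<in>UNIV. exp (- (z u)\<^sup>2 / 2)) / (\<Prod>u\<in>(UNIV :: 'n set). sqrt (2 * pi))"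
      unfolding std_normal_density_def by (simp only: prod_dividef[symmetric]) simp
    ultimately show ?thesis
      by (simp only: exp_sum[OF finite] prod_constant real_sqrt_power)
  qed
  have "centered_normal (mat 1) = density (distr (PiM UNIV (\<lambda>_::'n. lborel)) borel (\<lambda>z. \<chi> u. z u))
      (\<lambda>x. ennreal (exp (- (x \<bullet> x) / 2) / sqrt ((2 * pi) ^ CARD('n))))"
    by (simp add: centered_normal_def matrix_inv_mat_1 flip: lborel_vec)
  also have "\<dots> = distr (density (PiM UNIV (\<lambda>_::'n. lborel)) (\<lambda>z. \<Prod>u\<in>UNIV. ennreal (std_normal_density (z u))))
      borel (\<lambda>z. \<chi> u. z u)"
    by (subst density_distr) (simp_all only: dens prod_ennreal[OF normal_density_nonneg], measurable)
  also have "\<dots> = distr (PiM UNIV (\<lambda>_::'n. std_normal)) borel (\<lambda>z. \<chi> u. z u)"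
    by (subst density_PiM) (auto intro: psf lborel.sigma_finite_measure_axioms std.sigma_finite_measure_axioms simp: product_sigma_finite_def)
  finally show ?thesis .
qed

section \<open>Linear changes of variables for Lebesgue measure and the Gaussian law\<close>

lemma matrix_vector_mult_borel_measurable [measurable]:
  "(*v) P \<in> borel_measurable (borel :: (real ^ 'n) measure)" for P :: "real ^ 'n ^ 'm"
  by (intro borel_measurable_continuous_onI linear_continuous_on) simp

lemma distr_density_const:
  assumes "f \<in> M \<rightarrow>\<^sub>M N"
  shows "distr (density M (\<lambda>_. c)) N f = density (distr M N f) (\<lambda>_. c)"
  using assms by (subst density_distr) auto

text \<open>When coordinate \<open>m\<close> is integrated innermost, the shear is a translation by
  the constant \<open>x n\<close>, under which one-dimensional Lebesgue measure is
  invariant.\<close>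

lemma lborel_shear:
  fixes m n :: "'n::finite"
  assumes mn: "m \<noteq> n"
  shows "distr lborel borel ((*v) (\<chi> i j. of_bool (i = m \<and> j = n \<or> i = j))) = (lborel :: (real ^ 'n) measure)"
proof -
  define A :: "real ^ 'n ^ 'n" where "A = (\<chi> i j. of_bool (i = m \<and> j = n \<or> i = j))"
  interpret product_sigma_finite "\<lambda>_::'n. lborel :: real measure" ..
  have [measurable]: "(\<lambda>z. \<chi> u. z u) \<in> borel_measurable (PiM UNIV (\<lambda>_::'n. lborel :: real measure))"
    using vec_lambda_borel_measurable by (simp cong: measurable_cong_sets sets_PiM_cong)
  have A: "A *v x = (\<chi> i. if i = m then x $ m + x $ n else x $ i)" for x
  proof -
    have "(\<Sum>j\<in>UNIV. of_bool (i = m \<and> j = n \<or> i = j) * x $ j)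
        = (\<Sum>j\<in>UNIV. (if i = j then x $ j else 0) + (if j = n then if i = m then x $ j else 0 else 0))" for i
      using mn by (intro sum.cong) auto
    moreover have "(A *v x) $ i = (\<Sum>j\<in>UNIV. of_bool (i = m \<and> j = n \<or> i = j) * x $ j)" for i
      unfolding A_def matrix_vector_mult_def vec_lambda_beta ..
    ultimately show ?thesis by (simp only: vec_eq_iff) (simp add: sum.distrib)
  qed
  have split: "(\<integral>\<^sup>+x. g x \<partial>lborel) =
      (\<integral>\<^sup>+x. \<integral>\<^sup>+y. g (\<chi> u. (x(m := y)) u) \<partial>lborel \<partial>PiM (UNIV - {m}) (\<lambda>_. lborel))"
    if [measurable]: "g \<in> borel_measurable borel" for g :: "real ^ 'n \<Rightarrow> ennreal"
  proof -
    have "(\<integral>\<^sup>+x. g x \<partial>lborel) = (\<integral>\<^sup>+z. g (\<chi> u. z u) \<partial>PiM (insert m (UNIV - {m})) (\<lambda>_. lborel))"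
      by (subst lborel_vec, subst nn_integral_distr) (auto simp: insert_absorb)
    also have "\<dots> = (\<integral>\<^sup>+x. \<integral>\<^sup>+y. g (\<chi> u. (x(m := y)) u) \<partial>lborel \<partial>PiM (UNIV - {m}) (\<lambda>_. lborel))"
      by (rule product_nn_integral_insert) (auto simp: insert_absorb)
    finally show ?thesis .
  qed
  have "distr lborel borel ((*v) A) = lborel"
  proof (rule measure_eqI)
    fix X assume "X \<in> sets (distr lborel borel ((*v) A))"
    then have [measurable]: "X \<in> sets borel" by simp
    have meas: "(\<lambda>x. indicator X (A *v x) :: ennreal) \<in> borel_measurable borel"
      by measurable
    \<comment> \<open>The factor \<open>1 *\<close> gives the integrand the shape expected by
      \<open>nn_integral_real_affine\<close>.\<close>
    have shear: "A *v (\<chi> u. (x(m := y)) u) = (\<chi> u. (x(m := x n + 1 * y)) u)" for x y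
      using mn by (auto simp: A vec_eq_iff)
    have "emeasure (distr lborel borel ((*v) A)) X = (\<integral>\<^sup>+x. indicator X (A *v x) \<partial>lborel)"
      by (simp flip: nn_integral_indicator add: nn_integral_distr)
    also have "\<dots> = (\<integral>\<^sup>+x. \<integral>\<^sup>+y. indicator X (\<chi> u. (x(m := x n + 1 * y)) u) \<partial>lborel \<partial>PiM (UNIV - {m}) (\<lambda>_. lborel))"
      using split[OF meas] by (simp only: shear)
    also have "\<dots> = (\<integral>\<^sup>+x. \<integral>\<^sup>+y. indicator X (\<chi> u. (x(m := y)) u) \<partial>lborel \<partial>PiM (UNIV - {m}) (\<lambda>_. lborel))"
    proof (rule nn_integral_cong)
      fix x :: "'n \<Rightarrow> real"
      define \<phi> :: "real \<Rightarrow> real ^ 'n" where "\<phi> y = (\<chi> u. (x(m := y)) u)" for y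
      have [measurable]: "\<phi> \<in> borel_measurable borel"
        by (rule borel_measurable_euclidean_space[THEN iffD2])
          (auto simp: \<phi>_def Basis_vec_def inner_axis fun_upd_def)
      have "(\<integral>\<^sup>+y. indicator X (\<phi> (x n + 1 * y)) \<partial>lborel) = (\<integral>\<^sup>+y. indicator X (\<phi> y) \<partial>lborel)"
        using nn_integral_real_affine[of "\<lambda>y. indicator X (\<phi> y)" 1 "x n"] by simp
      then show "(\<integral>\<^sup>+y. indicator X (\<chi> u. (x(m := x n + 1 * y)) u) \<partial>lborel)
          = (\<integral>\<^sup>+y. indicator X (\<chi> u. (x(m := y)) u) \<partial>lborel)"
        unfolding \<phi>_def .
    qed
    also have "\<dots> = (\<integral>\<^sup>+x. indicator X x \<partial>lborel)"
      by (rule split[symmetric]) simp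
    finally show "emeasure (distr lborel borel ((*v) A)) X = emeasure lborel X" by simp
  qed simp
  then show ?thesis by (simp only: A_def)
qed

lemma lborel_permute_coordinates:
  fixes p :: "'n::finite \<Rightarrow> 'n"
  assumes p: "bij p"
  shows "(lborel :: (real ^ 'n) measure) = distr lborel borel (\<lambda>x. \<chi> i. x $ p i)"
proof (rule lborel_eqI)
  fix l u :: "real ^ 'n"
  assume le: "\<And>b. b \<in> Basis \<Longrightarrow> l \<bullet> b \<le> u \<bullet> b"
  have le': "l $ i \<le> u $ i" for i
    using le[of "axis i 1"] by (simp add: inner_axis axis_in_Basis_iff)
  have [measurable]: "(\<lambda>x. \<chi> i. x $ p i) \<in> borel_measurable (borel :: (real ^ 'n) measure)"
    by (rule borel_measurable_euclidean_space[THEN iffD2]) (auto simp: Basis_vec_def inner_axis)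
  define q where "q = inv p"
  have pq: "p (q i) = i" "q (p i) = i" for i
    using p by (auto simp: q_def bij_def surj_f_inv_f)
  have q: "bij q" using p by (simp add: q_def bij_imp_bij_inv)
  have "emeasure (distr lborel borel (\<lambda>x. \<chi> i. x $ p i)) (box l u)
      = emeasure lborel (box (\<chi> i. l $ q i) (\<chi> i. u $ q i))"
    by (subst emeasure_distr)
      (auto simp: mem_box_cart intro!: arg_cong[where f="emeasure _"], (metis pq)+)
  also have "\<dots> = ennreal (\<Prod>i\<in>UNIV. u $ q i - l $ q i)"
  proof -
    have "\<forall>b\<in>Basis. (\<chi> i. l $ q i) \<bullet> b \<le> (\<chi> i. u $ q i) \<bullet> b"
      by (auto simp: Basis_vec_def inner_axis le')
    then show ?thesis by (simp add: emeasure_lborel_box_eq prod_Basis_vec inner_axis)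
  qed
  also have "(\<Prod>i\<in>UNIV. u $ q i - l $ q i) = (\<Prod>i\<in>UNIV. u $ i - l $ i)"
    by (rule prod.reindex_bij_betw[OF q])
  finally show "emeasure (distr lborel borel (\<lambda>x. \<chi> i. x $ p i)) (box l u) = ennreal (\<Prod>b\<in>Basis. (u - l) \<bullet> b)"
    by (simp add: prod_Basis_vec inner_axis)
qed simp

text \<open>The change of variables formula of the library needs a well-ordered index type; elementary matrices
  give the linear case for every finite index type.\<close>

lemma lborel_linear:
  fixes P :: "real ^ 'n ^ 'n"
  shows "det P \<noteq> 0 \<longrightarrow> lborel = density (distr lborel borel ((*v) P)) (\<lambda>_. ennreal \<bar>det P\<bar>)"
proof (induction P rule: induct_matrix_elementary_alt)
  case (1 A B)
  show ?case
  proof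
    assume "det (A ** B) \<noteq> 0"
    then have nz: "det A \<noteq> 0" "det B \<noteq> 0" by (auto simp: det_mul)
    have "density (distr lborel borel ((*v) (A ** B))) (\<lambda>_. ennreal \<bar>det (A ** B)\<bar>)
        = density (distr (distr lborel borel ((*v) B)) borel ((*v) A)) (\<lambda>_. ennreal \<bar>det B\<bar> * ennreal \<bar>det A\<bar>)"
      by (subst distr_distr) (auto simp: o_def matrix_vector_mul_assoc det_mul abs_mult mult.commute
        simp flip: ennreal_mult')
    also have "\<dots> = density (distr (density (distr lborel borel ((*v) B)) (\<lambda>_. ennreal \<bar>det B\<bar>)) borel ((*v) A))
        (\<lambda>_. ennreal \<bar>det A\<bar>)"
      by (subst distr_density_const) (auto simp: density_density_eq)
    also have "\<dots> = lborel"
      using 1 nz by simp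
    finally show "lborel = density (distr lborel borel ((*v) (A ** B))) (\<lambda>_. ennreal \<bar>det (A ** B)\<bar>)" ..
  qed
next
  \<comment> \<open>The induction passes through singular matrices, which is why
    \<open>det P \<noteq> 0\<close> is a premise inside the statement.\<close>
  case (2 A i)
  then show ?case by (simp add: det_zero_row)
next
  case (3 A)
  show ?case
  proof
    assume nz: "det A \<noteq> 0"
    have det: "det A = (\<Prod>i\<in>UNIV. A $ i $ i)"
      using 3 by (rule det_diagonal)
    have eq: "(\<Sum>j\<in>Basis. ((A *v j) \<bullet> j * (x \<bullet> j)) *\<^sub>R j) = A *v x" for x
    proof -
      have "(A *v x) $ i = A $ i $ i * x $ i" for i
        unfolding matrix_vector_component using 3[of i]
        by (subst sum.remove[of _ i]) (auto intro!: sum.neutral)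
      moreover have "(\<Sum>j\<in>Basis. ((A *v j) \<bullet> j * (x \<bullet> j)) *\<^sub>R j) $ i = A $ i $ i * x $ i" for i
      proof -
        have "(\<Sum>j\<in>Basis. ((A *v j) \<bullet> j * (x \<bullet> j)) *\<^sub>R j) $ i
            = (\<Sum>k\<in>UNIV. (A $ k $ k * x $ k) * axis k 1 $ i)"
          by (simp add: sum_Basis_vec inner_axis matrix_vector_mul_component)
        also have "\<dots> = (\<Sum>k\<in>UNIV. if k = i then A $ k $ k * x $ k else 0)"
          by (intro sum.cong) (auto simp: axis_def)
        finally show ?thesis by simp
      qed
      ultimately show ?thesis by (simp add: vec_eq_iff)
    qed
    have c: "(A *v j) \<bullet> j \<noteq> 0" if "j \<in> Basis" for j
      using that nz by (auto simp: Basis_vec_def det inner_axis matrix_vector_mul_component)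
    have p: "(\<Prod>j\<in>Basis. \<bar>(A *v j) \<bullet> j\<bar>) = \<bar>det A\<bar>"
      by (simp add: prod_Basis_vec inner_axis matrix_vector_mul_component det abs_prod)
    show "lborel = density (distr lborel borel ((*v) A)) (\<lambda>_. ennreal \<bar>det A\<bar>)"
      using lborel_affine_euclidean[of "\<lambda>j. (A *v j) \<bullet> j" 0] c by (simp add: eq p)
  qed
next
  case (4 m n)
  let ?A = "(\<chi> i j. mat 1 $ i $ Transposition.transpose m n j) :: real ^ 'n ^ 'n"
  let ?p = "Transposition.transpose m n"
  have "\<bar>det ?A\<bar> = 1"
    by (subst det_permute_columns) (auto simp: permutes_swap_id sign_def)
  moreover have "?A *v x = (\<chi> i. x $ ?p i)" for x :: "real ^ 'n"
  proof -
    have "(\<Sum>j\<in>UNIV. mat 1 $ i $ ?p j * x $ j) = (\<Sum>j\<in>UNIV. if j = ?p i then x $ j else 0)" for i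
      by (intro sum.cong) (auto simp: mat_def)
    then show ?thesis by (simp add: vec_eq_iff matrix_vector_mult_def)
  qed
  ultimately show ?case
    using lborel_permute_coordinates[of ?p] by (simp add: density_1 flip: one_ennreal_def)
next
  case (5 m n)
  have "((\<chi> i j. of_bool (i = m \<and> j = n \<or> i = j)) :: real ^ 'n ^ 'n) =
      (\<chi> k. if k = m then row m (mat 1) + 1 *s row n (mat 1) else row k (mat 1))"
    using 5 by (auto simp: vec_eq_iff row_def mat_def)
  then have "det ((\<chi> i j. of_bool (i = m \<and> j = n \<or> i = j)) :: real ^ 'n ^ 'n) = 1"
    using det_row_operation[OF 5, of "mat 1 :: real ^ 'n ^ 'n" 1] by simp
  then show ?case
    using lborel_shear[OF 5] by (simp add: density_1 flip: one_ennreal_def)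
qed

text \<open>The Jacobian \<open>\<bar>det P\<bar>\<close> cancels the square root of the determinant
  in the normalising constant, and the quadratic form pulls back to
  \<open>x \<bullet> x\<close>.\<close>

lemma centered_normal_linear_mat_1:
  fixes P :: "real ^ 'n ^ 'n"
  assumes P: "det P \<noteq> 0"
  shows "distr (centered_normal (mat 1)) borel ((*v) P) = centered_normal (P ** transpose P)"
proof -
  let ?S = "P ** transpose P"
  obtain R where R: "transpose P ** R = mat 1"
    using P by (metis invertible_det_nz invertible_def det_transpose)
  have "invertible ?S" using P by (simp add: invertible_det_nz det_mul)
  then have inv: "matrix_inv ?S ** ?S = mat 1"
    unfolding invertible_def matrix_inv_def by (rule someI2_ex) simp
  have quad: "(P *v x) \<bullet> (matrix_inv ?S *v (P *v x)) = x \<bullet> x" for x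
  proof -
    define z where "z = R *v x"
    have x: "x = transpose P *v z" by (simp add: z_def matrix_vector_mul_assoc R)
    have "matrix_inv ?S *v (P *v x) = (matrix_inv ?S ** ?S) *v z"
      by (simp only: x matrix_vector_mul_assoc matrix_mul_assoc)
    then have "matrix_inv ?S *v (P *v x) = z" by (simp add: inv)
    then show ?thesis
      by (metis dot_lmul_matrix transpose_matrix_vector transpose_transpose x)
  qed
  define c where "c = ennreal \<bar>det P\<bar>"
  define g where "g y = ennreal (exp (- (y \<bullet> (matrix_inv ?S *v y)) / 2) / sqrt ((2 * pi) ^ CARD('n) * det ?S))"
    for y
  have [measurable]: "g \<in> borel_measurable borel" unfolding g_def by measurable
  have dens: "c * g (P *v x) = ennreal (exp (- (x \<bullet> x) / 2) / sqrt ((2 * pi) ^ CARD('n)))" for x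
  proof -
    let ?e = "exp (- (x \<bullet> x) / 2)" and ?r = "sqrt ((2 * pi) ^ CARD('n))"
    have sqrt_det: "sqrt ((2 * pi) ^ CARD('n) * det ?S) = ?r * \<bar>det P\<bar>"
      by (simp add: det_mul real_sqrt_mult real_sqrt_abs2)
    have "c * g (P *v x) = ennreal (\<bar>det P\<bar> * (?e / (?r * \<bar>det P\<bar>)))"
      unfolding c_def g_def quad sqrt_det by (rule ennreal_mult'[symmetric]) simp
    also have "\<bar>det P\<bar> * (?e / (?r * \<bar>det P\<bar>)) = ?e / ?r"
      using P by simp
    finally show ?thesis .
  qed
  have "centered_normal ?S = density lborel g"
    unfolding centered_normal_def g_def ..
  also have "\<dots> = density (density (distr lborel borel ((*v) P)) (\<lambda>_. c)) g"
    using lborel_linear[of P] P unfolding c_def by (intro arg_cong[where f="\<lambda>M. density M g"]) blast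
  also have "\<dots> = density (distr lborel borel ((*v) P)) (\<lambda>y. c * g y)"
    by (rule density_density_eq) auto
  also have "\<dots> = distr (density lborel (\<lambda>x. c * g (P *v x))) borel ((*v) P)"
    by (rule density_distr) auto
  also have "\<dots> = distr (centered_normal (mat 1)) borel ((*v) P)"
    by (simp only: dens centered_normal_def matrix_inv_mat_1 matrix_vector_mul_lid det_I mult_1_right)
  finally show ?thesis by simp
qed

lemma sets_centered_normal [simp, measurable_cong]: "sets (centered_normal S) = sets borel"
  and space_centered_normal [simp]: "space (centered_normal S) = UNIV"
  by (simp_all add: centered_normal_def)

lemma centered_normal_linear:
  fixes S T :: "real ^ 'n ^ 'n"
  assumes S: "S \<in> PD" and T: "det T \<noteq> 0"
  shows "distr (centered_normal S) borel ((*v) T) = centered_normal (T ** S ** transpose T)"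
proof -
  obtain P where P: "S = P ** transpose P" "det P \<noteq> 0"
    using PD_factorization[OF S, of "{}" "{}"] by auto
  have "distr (centered_normal S) borel ((*v) T) = distr (centered_normal (mat 1)) borel ((*v) (T ** P))"
    unfolding P(1) centered_normal_linear_mat_1[OF P(2), symmetric]
    by (subst distr_distr) (auto simp: o_def matrix_vector_mul_assoc)
  also have "\<dots> = centered_normal (T ** S ** transpose T)"
    by (subst centered_normal_linear_mat_1)
      (auto simp: det_mul T P matrix_transpose_mul matrix_mul_assoc)
  finally show ?thesis .
qed

lemma centered_normal_std_normal:
  fixes S :: "real ^ 'n ^ 'n"
  assumes "S = P ** transpose P" "det P \<noteq> 0"
  shows "centered_normal S = distr (PiM UNIV (\<lambda>_::'n. std_normal)) borel (\<lambda>z. P *v (\<chi> u. z u))"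
proof -
  have [measurable]: "(\<lambda>z. \<chi> u. z u) \<in> borel_measurable (PiM UNIV (\<lambda>_::'n. std_normal))"
    using vec_lambda_borel_measurable by (simp cong: measurable_cong_sets sets_PiM_cong)
  show ?thesis
    unfolding assms(1) centered_normal_linear_mat_1[OF assms(2), symmetric] centered_normal_mat_1
    by (subst distr_distr) (auto simp: o_def)
qed

lemma prob_space_std_normal: "prob_space std_normal"
  by (rule prob_space_normal_density) simp

lemma prob_space_std_normal_PiM: "prob_space (PiM UNIV (\<lambda>_::'n::finite. std_normal))"
  by (intro prob_space_PiM prob_space_std_normal)

lemma prob_space_centered_normal:
  fixes S :: "real ^ 'n ^ 'n"
  assumes S: "S \<in> PD"
  shows "prob_space (centered_normal S)"
proof -
  obtain P where P: "S = P ** transpose P" "det P \<noteq> 0"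
    using PD_factorization[OF S, of "{}" "{}"] by auto
  have [measurable]: "(\<lambda>z. \<chi> u. z u) \<in> borel_measurable (PiM UNIV (\<lambda>_::'n. std_normal))"
    using vec_lambda_borel_measurable by (simp cong: measurable_cong_sets sets_PiM_cong)
  show ?thesis
    unfolding centered_normal_std_normal[OF P]
    by (rule prob_space.prob_space_distr[OF prob_space_std_normal_PiM]) simp
qed

section \<open>Square integrability of linear functionals\<close>

lemma integrable_mult_of_square:
  fixes f g :: "'a \<Rightarrow> real"
  assumes [measurable]: "f \<in> borel_measurable M" "g \<in> borel_measurable M"
    and "integrable M (\<lambda>x. (f x)\<^sup>2)" "integrable M (\<lambda>x. (g x)\<^sup>2)"
  shows "integrable M (\<lambda>x. f x * g x)"
proof (rule Bochner_Integration.integrable_bound)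
  show "integrable M (\<lambda>x. (f x)\<^sup>2 + (g x)\<^sup>2)" using assms by simp
  have "\<bar>f x * g x\<bar> \<le> (f x)\<^sup>2 + (g x)\<^sup>2" for x
  proof -
    have "2 * (\<bar>f x\<bar> * \<bar>g x\<bar>) \<le> (f x)\<^sup>2 + (g x)\<^sup>2"
      using sum_squares_bound[of "\<bar>f x\<bar>" "\<bar>g x\<bar>"] by simp
    moreover have "0 \<le> \<bar>f x\<bar> * \<bar>g x\<bar>" by simp
    ultimately show ?thesis unfolding abs_mult by linarith
  qed
  then show "AE x in M. norm (f x * g x) \<le> norm ((f x)\<^sup>2 + (g x)\<^sup>2)"
    by (simp add: abs_of_nonneg[OF add_nonneg_nonneg])
qed simp

lemma integrable_square_add:
  fixes f g :: "'a \<Rightarrow> real"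
  assumes [measurable]: "f \<in> borel_measurable M" "g \<in> borel_measurable M"
    and "integrable M (\<lambda>x. (f x)\<^sup>2)" "integrable M (\<lambda>x. (g x)\<^sup>2)"
  shows "integrable M (\<lambda>x. (f x + g x)\<^sup>2)"
  using assms integrable_mult_of_square[OF assms] by (simp add: power2_sum mult.assoc)

lemma centered_normal_square_integrable:
  fixes S :: "real ^ 'n ^ 'n"
  assumes S: "S \<in> PD"
  shows "integrable (centered_normal S) (\<lambda>z. (y \<bullet> z)\<^sup>2)"
proof -
  obtain P where P: "S = P ** transpose P" "det P \<noteq> 0"
    using PD_factorization[OF S, of "{}" "{}"] by auto
  let ?M = "PiM UNIV (\<lambda>_::'n. std_normal)"
  have [measurable]: "(\<lambda>z. \<chi> u. z u) \<in> borel_measurable ?M"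
    using vec_lambda_borel_measurable by (simp cong: measurable_cong_sets sets_PiM_cong)
  have comp [measurable]: "(\<lambda>z. z u) \<in> borel_measurable ?M" for u
    using measurable_component_singleton[of u UNIV "\<lambda>_. std_normal"] by simp
  have "integrable lborel (\<lambda>x. std_normal_density x * x\<^sup>2)"
    using normal_moment_even[where \<mu>=0 and \<sigma>=1 and k=1] by (auto simp: has_bochner_integral_iff)
  then have "integrable std_normal (\<lambda>x. x\<^sup>2)"
    by (subst integrable_density) (auto simp: normal_density_nonneg)
  then have sq: "integrable ?M (\<lambda>z. (z u)\<^sup>2)" for u
  proof -
    have "distr ?M std_normal (\<lambda>z. z u) = std_normal"
      by (rule distr_PiM_component) (auto intro: prob_space_std_normal)
    with \<open>integrable std_normal (\<lambda>x. x\<^sup>2)\<close> have "integrable (distr ?M std_normal (\<lambda>z. z u)) (\<lambda>x. x\<^sup>2)"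
      by simp
    then show ?thesis by (subst (asm) integrable_distr_eq) auto
  qed
  have *: "integrable ?M (\<lambda>z. (\<Sum>u\<in>I. c u * z u)\<^sup>2)" if "finite I" for c :: "'n \<Rightarrow> real" and I
    using that
  proof (induction I)
    case (insert u I)
    have "integrable ?M (\<lambda>z. (c u * z u + (\<Sum>u\<in>I. c u * z u))\<^sup>2)"
      using insert sq[of u] by (intro integrable_square_add) (auto simp: power_mult_distrib)
    then show ?case using insert by simp
  qed simp
  have "y \<bullet> (P *v (\<chi> u. z u)) = (\<Sum>u\<in>UNIV. (y v* P) $ u * z u)" for z
    unfolding dot_lmul_matrix[symmetric] by (simp add: inner_vec_def)
  then have "integrable ?M (\<lambda>z. (y \<bullet> (P *v (\<chi> u. z u)))\<^sup>2)"
    using *[of UNIV "\<lambda>u. (y v* P) $ u"] by simp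
  then show ?thesis
    unfolding centered_normal_std_normal[OF P]
    by (subst integrable_distr_eq) auto
qed

lemma centered_normal_integrable_mult:
  fixes S :: "real ^ 'n ^ 'n"
  assumes "S \<in> PD"
  shows "integrable (centered_normal S) (\<lambda>z. (x \<bullet> z) * (y \<bullet> z))"
  using centered_normal_square_integrable[OF assms]
  by (intro integrable_mult_of_square) auto

lemma centered_normal_integrable:
  fixes S :: "real ^ 'n ^ 'n"
  assumes S: "S \<in> PD"
  shows "integrable (centered_normal S) (\<lambda>z. x \<bullet> z)"
proof -
  interpret prob_space "centered_normal S" by (rule prob_space_centered_normal[OF S])
  show ?thesis
    using integrable_mult_of_square[of "\<lambda>z. x \<bullet> z" "centered_normal S" "\<lambda>_. 1"]
      centered_normal_square_integrable[OF S, of x] by simp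
qed

text \<open>The reflection along \<open>x\<close> in the geometry of \<open>S\<close> preserves the Gaussian law, changes the sign of
  \<open>x \<bullet> z\<close>, and fixes every coordinate that is uncorrelated with \<open>x \<bullet> z\<close>. This replaces moment computations.\<close>

definition reflection :: "real ^ 'n ^ 'n \<Rightarrow> real ^ 'n::finite \<Rightarrow> real ^ 'n \<Rightarrow> real ^ 'n" where
  "reflection S x z = z - (2 * (x \<bullet> z) / (x \<bullet> (S *v x))) *\<^sub>R (S *v x)"

lemma inner_reflection:
  assumes "x \<bullet> (S *v x) \<noteq> 0"
  shows "x \<bullet> reflection S x z = - (x \<bullet> z)"
  using assms by (simp add: reflection_def inner_diff_right)

text \<open>The reflection has a matrix \<open>T\<close> with
  \<open>T ** S ** transpose T = S\<close>; being an involution, it has nonzero determinant.\<close>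

lemma centered_normal_reflection:
  fixes S :: "real ^ 'n ^ 'n"
  assumes S: "S \<in> PD" and x: "x \<noteq> 0"
  shows "distr (centered_normal S) borel (reflection S x) = centered_normal S"
proof -
  let ?q = "x \<bullet> (S *v x)" and ?w = "S *v x"
  have q: "?q > 0" by (rule PD_pos[OF S x])
  have lin: "linear (reflection S x)"
    unfolding reflection_def
    by (rule linearI) (auto simp: inner_add_right algebra_simps add_divide_distrib)
  define T where "T = matrix (reflection S x)"
  have T: "T *v z = reflection S x z" for z
    by (simp add: T_def lin)
  have "T *v (T *v z) = z" for z
  proof -
    have "x \<bullet> reflection S x z = - (x \<bullet> z)" using q by (intro inner_reflection) simp
    then show ?thesis
      unfolding T reflection_def[of S x "reflection S x z"] by (simp add: reflection_def)
  qed
  then have "T ** T = mat 1"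
    by (simp add: matrix_eq flip: matrix_vector_mul_assoc)
  then have detT: "det T \<noteq> 0"
    by (metis det_I det_mul mult_zero_left zero_neq_one)
  have tT: "transpose T *v y = y - (2 * (?w \<bullet> y) / ?q) *\<^sub>R x" for y
  proof (rule vector_eq_ldot[THEN iffD1], intro allI)
    fix z
    have "z \<bullet> (transpose T *v y) = (T *v z) \<bullet> y"
      by (metis dot_lmul_matrix transpose_matrix_vector transpose_transpose)
    then show "z \<bullet> (transpose T *v y) = z \<bullet> (y - (2 * (?w \<bullet> y) / ?q) *\<^sub>R x)"
      by (simp add: T reflection_def inner_diff_left inner_diff_right inner_commute[of x z])
  qed
  have "T ** S ** transpose T = S"
  proof (rule matrix_eq[THEN iffD2], intro allI)
    fix y
    have "(T ** S ** transpose T) *v y = T *v (S *v (transpose T *v y))"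
      by (simp only: matrix_vector_mul_assoc matrix_mul_assoc)
    also have "\<dots> = S *v y"
    proof -
      define c where "c = 2 * (?w \<bullet> y) / ?q"
      have 1: "S *v (transpose T *v y) = S *v y - c *\<^sub>R ?w"
        unfolding tT by (simp add: matrix_vector_mult_diff_distrib matrix_vector_mult_scaleR c_def)
      have 2: "x \<bullet> (S *v y - c *\<^sub>R ?w) = - (?w \<bullet> y)"
        using q symmetric_matrix_inner[OF PD_symmetric[OF S], of x y]
        by (simp add: inner_diff_right c_def)
      show ?thesis
        unfolding 1 T reflection_def 2 by (simp add: c_def)
    qed
    finally show "(T ** S ** transpose T) *v y = S *v y" .
  qed
  moreover have "(*v) T = reflection S x" using T by auto
  ultimately show ?thesis
    using centered_normal_linear[OF S detT] by simp
qed

lemma reflection_measurable [measurable]: "reflection S x \<in> borel_measurable borel"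
  unfolding reflection_def by measurable

text \<open>The substitution is valid for the Bochner integral of any measurable \<open>h\<close>;
  its default value 0 covers those that are not integrable.\<close>

lemma centered_normal_odd_integral:
  fixes h :: "real ^ 'n \<Rightarrow> real"
  assumes S: "S \<in> PD" and x: "x \<noteq> 0" and [measurable]: "h \<in> borel_measurable borel"
    and odd: "\<And>z. h (reflection S x z) = - h z"
  shows "(\<integral>z. h z \<partial>centered_normal S) = 0"
proof -
  have "(\<integral>z. h z \<partial>centered_normal S) = (\<integral>z. h z \<partial>distr (centered_normal S) borel (reflection S x))"
    using centered_normal_reflection[OF S x] by simp
  also have "\<dots> = (\<integral>z. - h z \<partial>centered_normal S)"
    by (subst integral_distr) (auto simp: odd)
  finally show ?thesis by simp
qed

lemma reflection_component_fixed: "(S *v x) $ k = 0 \<Longrightarrow> reflection S x z $ k = z $ k"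
  by (simp add: reflection_def)

text \<open>Subtracting the multiple \<open>b * (x \<bullet> z)\<close> from
  \<open>y \<bullet> z\<close> leaves a functional that the reflection fixes, so its product with
  \<open>x \<bullet> z\<close> is odd and integrates to 0. Hence the mixed moment is
  \<open>b\<close> times the second moment of \<open>x \<bullet> z\<close>, which is positive
  because a hyperplane is a null set.\<close>

lemma centered_normal_covariance:
  fixes S :: "real ^ 'n ^ 'n"
  assumes S: "S \<in> PD" and x: "x \<noteq> 0"
    and zero: "(\<integral>z. (x \<bullet> z) * (y \<bullet> z) \<partial>centered_normal S) = 0"
  shows "y \<bullet> (S *v x) = 0"
proof -
  interpret prob_space "centered_normal S" by (rule prob_space_centered_normal[OF S])
  let ?q = "x \<bullet> (S *v x)"
  have q: "?q > 0" by (rule PD_pos[OF S x])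
  define b where "b = y \<bullet> (S *v x) / ?q"
  have "(\<integral>z. (x \<bullet> z) * (y \<bullet> z - b * (x \<bullet> z)) \<partial>centered_normal S) = 0"
  proof (rule centered_normal_odd_integral[OF S x])
    fix z
    have "y \<bullet> reflection S x z - b * (x \<bullet> reflection S x z) = y \<bullet> z - b * (x \<bullet> z)"
      using q by (simp add: inner_reflection) (simp add: b_def reflection_def inner_diff_right field_simps)
    then show "(x \<bullet> reflection S x z) * (y \<bullet> reflection S x z - b * (x \<bullet> reflection S x z))
      = - ((x \<bullet> z) * (y \<bullet> z - b * (x \<bullet> z)))"
      using q by (simp add: inner_reflection)
  qed simp
  moreover have "(\<integral>z. (x \<bullet> z) * (y \<bullet> z - b * (x \<bullet> z)) \<partial>centered_normal S)
      = (\<integral>z. (x \<bullet> z) * (y \<bullet> z) \<partial>centered_normal S) - b * (\<integral>z. (x \<bullet> z) * (x \<bullet> z) \<partial>centered_normal S)"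
    using centered_normal_integrable_mult[OF S, of x y] centered_normal_integrable_mult[OF S, of x x]
    by (simp add: right_diff_distrib mult.left_commute)
  ultimately have b0: "b * (\<integral>z. (x \<bullet> z) * (x \<bullet> z) \<partial>centered_normal S) = 0"
    using zero by simp
  have "(\<integral>z. (x \<bullet> z) * (x \<bullet> z) \<partial>centered_normal S) \<noteq> 0"
  proof
    assume "(\<integral>z. (x \<bullet> z) * (x \<bullet> z) \<partial>centered_normal S) = 0"
    then have "AE z in centered_normal S. (x \<bullet> z) * (x \<bullet> z) = 0"
      using centered_normal_integrable_mult[OF S, of x x]
      by (subst (asm) integral_nonneg_eq_0_iff_AE) auto
    moreover have "AE z in centered_normal S. x \<bullet> z \<noteq> 0"
    proof -
      have "negligible {z. x \<bullet> z = 0}" using x by (intro negligible_hyperplane) auto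
      then have "{z. x \<bullet> z = 0} \<in> null_sets lebesgue" by (simp add: negligible_iff_null_sets)
      moreover have "{z. x \<bullet> z = 0} \<in> sets borel" by measurable
      ultimately have "{z. x \<bullet> z = 0} \<in> null_sets lborel"
        by (simp add: null_sets_def)
      then have "AE z in lborel. x \<bullet> z \<noteq> 0" by (subst AE_iff_null) auto
      then show ?thesis unfolding centered_normal_def by (subst AE_density) auto
    qed
    ultimately have "AE z in centered_normal S. False" by eventually_elim simp
    then show False by simp
  qed
  with b0 q show ?thesis by (simp add: b_def)
qed

section \<open>Conditional independence and regression\<close>

lemma subalgebra_vimage_algebra:
  "Z \<in> M \<rightarrow>\<^sub>M N \<Longrightarrow> subalgebra M (vimage_algebra (space M) Z N)"
  using sets_image_in_sets[of M "space M" Z N] by (auto simp: subalgebra_def)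

text \<open>Orthogonality to the events of \<open>Z\<close> means that the conditional expectation
  of \<open>h\<close> given \<open>Z\<close> is 0; any factor measurable with respect to
  \<open>Z\<close> can then be pulled out.\<close>

lemma (in finite_measure) integral_mult_vimage_algebra_eq_0:
  fixes h :: "'a \<Rightarrow> real"
  assumes Z: "Z \<in> M \<rightarrow>\<^sub>M N" and h: "integrable M h"
    and zero: "\<And>B. B \<in> sets N \<Longrightarrow> (\<integral>z. indicator B (Z z) * h z \<partial>M) = 0"
    and f: "f \<in> borel_measurable (vimage_algebra (space M) Z N)" and fh: "integrable M (\<lambda>z. f z * h z)"
  shows "(\<integral>z. f z * h z \<partial>M) = 0"
proof -
  let ?F = "vimage_algebra (space M) Z N"
  interpret F: finite_measure_subalgebra M ?F
    by unfold_locales (rule subalgebra_vimage_algebra[OF Z])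
  have Zs: "Z \<in> space M \<rightarrow> space N" using Z by (auto simp: measurable_space)
  have [measurable]: "h \<in> borel_measurable M" using h by simp
  have "AE z in M. real_cond_exp M ?F h z = 0"
  proof (rule F.real_cond_exp_charact[OF _ h])
    fix A assume "A \<in> sets ?F"
    then obtain B where B: "B \<in> sets N" "A = Z -` B \<inter> space M"
      unfolding sets_vimage_algebra2[OF Zs] by blast
    have "(\<integral>z\<in>A. h z \<partial>M) = (\<integral>z. indicator B (Z z) * h z \<partial>M)"
      unfolding set_lebesgue_integral_def B(2) by (intro Bochner_Integration.integral_cong) (auto simp: indicator_def)
    then show "(\<integral>z\<in>A. h z \<partial>M) = (\<integral>z\<in>A. 0 \<partial>M)"
      using zero[OF B(1)] by (simp add: set_lebesgue_integral_def)
  qed auto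
  then have AE: "AE z in M. f z * real_cond_exp M ?F h z = 0"
    by eventually_elim simp
  have [measurable]: "f \<in> borel_measurable M"
    by (rule measurable_from_subalg[OF F.subalg f])
  have "(\<integral>z. f z * real_cond_exp M ?F h z \<partial>M) = 0"
    using AE by (rule integral_eq_zero_AE)
  then show ?thesis
    using F.real_cond_exp_intg(2)[OF fh f] by simp
qed

lemma measurable_restrict_components [measurable]:
  "(\<lambda>z. \<lambda>k\<in>K. z $ k) \<in> (borel :: (real ^ 'n) measure) \<rightarrow>\<^sub>M PiM K (\<lambda>_. borel)"
  by (intro measurable_restrict) auto

text \<open>The reflection along \<open>y\<close> fixes the coordinates in \<open>K\<close> and
  flips the residual, so the residual times the indicator of an event of those coordinates is
  odd.\<close>

lemma regression_residual_orthogonal: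
  fixes S :: "real ^ 'n ^ 'n"
  assumes S: "S \<in> PD" and y: "y \<noteq> 0" "\<And>k. k \<in> K \<Longrightarrow> (S *v y) $ k = 0"
    and f: "f \<in> borel_measurable (vimage_algebra UNIV (\<lambda>z. \<lambda>k\<in>K. z $ k) (PiM K (\<lambda>_. borel)))"
    and int: "integrable (centered_normal S) (\<lambda>z. f z * (y \<bullet> z))"
  shows "(\<integral>z. f z * (y \<bullet> z) \<partial>centered_normal S) = 0"
proof -
  interpret prob_space "centered_normal S" by (rule prob_space_centered_normal[OF S])
  show ?thesis
  proof (rule integral_mult_vimage_algebra_eq_0)
    show "(\<lambda>z. \<lambda>k\<in>K. z $ k) \<in> centered_normal S \<rightarrow>\<^sub>M PiM K (\<lambda>_. borel)" by measurable
    show "integrable (centered_normal S) (\<lambda>z. y \<bullet> z)" by (rule centered_normal_integrable[OF S])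
    fix B assume [measurable]: "B \<in> sets (PiM K (\<lambda>_. borel :: real measure))"
    show "(\<integral>z. indicator B (\<lambda>k\<in>K. z $ k) * (y \<bullet> z) \<partial>centered_normal S) = 0"
    proof (rule centered_normal_odd_integral[OF S y(1)])
      fix z
      have "(\<lambda>k\<in>K. reflection S y z $ k) = (\<lambda>k\<in>K. z $ k)"
        using y(2) by (auto simp: reflection_component_fixed fun_eq_iff)
      moreover have "y \<bullet> reflection S y z = - (y \<bullet> z)"
        using PD_pos[OF S y(1)] by (intro inner_reflection) simp
      ultimately show "indicator B (\<lambda>k\<in>K. reflection S y z $ k) * (y \<bullet> reflection S y z)
          = - (indicator B (\<lambda>k\<in>K. z $ k) * (y \<bullet> z))"
        by simp
    qed measurable
  qed (use f int in simp_all)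
qed

text \<open>Let \<open>y \<bullet> z\<close> be the residual of the regression of \<open>z $ j\<close> on the coordinates in \<open>K\<close>. Conditional
  independence makes it orthogonal to every event of \<open>z $ i\<close>, hence to \<open>z $ i\<close> and to \<open>x \<bullet> z\<close>.\<close>

lemma gaussian_ci_regression:
  fixes S :: "real ^ 'n ^ 'n"
  assumes S: "S \<in> PD" and ci: "gaussian_ci S i j K" and jK: "j \<notin> K"
    and x: "x $ i = 1" "\<And>u. u \<notin> insert i K \<Longrightarrow> x $ u = 0" "\<And>k. k \<in> K \<Longrightarrow> (S *v x) $ k = 0"
  shows "(S *v x) $ j = 0"
proof -
  let ?N = "centered_normal S"
  let ?Z = "\<lambda>z :: real ^ 'n. \<lambda>k\<in>K. z $ k"
  let ?F = "vimage_algebra UNIV ?Z (PiM K (\<lambda>_. borel))"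
  interpret N: prob_space ?N by (rule prob_space_centered_normal[OF S])
  have Z: "?Z \<in> ?N \<rightarrow>\<^sub>M PiM K (\<lambda>_. borel)" by measurable
  interpret F: finite_measure_subalgebra ?N ?F
    using subalgebra_vimage_algebra[OF Z] by unfold_locales simp
  have ZF: "?Z \<in> ?F \<rightarrow>\<^sub>M PiM K (\<lambda>_. borel)"
    by (rule measurable_vimage_algebra1) (auto simp: space_PiM)
  have compF: "(\<lambda>z. z $ k) \<in> borel_measurable ?F" if "k \<in> K" for k
    using measurable_compose[OF ZF measurable_component_singleton[OF that]] that by simp
  have linF: "(\<lambda>z. c \<bullet> z) \<in> borel_measurable ?F" if "\<And>u. u \<notin> K \<Longrightarrow> c $ u = 0" for c :: "real ^ 'n"
  proof -
    have "c \<bullet> z = (\<Sum>k\<in>K. c $ k * z $ k)" for z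
      unfolding inner_vec_def using that by (intro sum.mono_neutral_cong_right) auto
    then show ?thesis using compF by simp
  qed
  have comp: "z $ u = axis u 1 \<bullet> z" for z :: "real ^ 'n" and u
    by (simp add: inner_axis')
  have int_comp: "integrable ?N (\<lambda>z. z $ u)" for u
    unfolding comp by (rule centered_normal_integrable[OF S])
  obtain y where y: "y $ j = 1" "\<And>u. u \<notin> insert j K \<Longrightarrow> y $ u = 0" "\<And>k. k \<in> K \<Longrightarrow> (S *v y) $ k = 0"
    using PD_regression[OF S jK] by blast
  have y0: "y \<noteq> 0" using y(1) by auto
  have x0: "x \<noteq> 0" using x(1) by auto
  have int_y: "integrable ?N (\<lambda>z. y \<bullet> z)" by (rule centered_normal_integrable[OF S])
  have orth_indicator: "(\<integral>z. indicator A (z $ i) * (y \<bullet> z) \<partial>?N) = 0" if [measurable]: "A \<in> sets borel" for A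
  proof -
    define a where "a = cond_prob_given ?N (PiM K (\<lambda>_. borel)) ?Z ((\<lambda>z. z $ i) -` A \<inter> space ?N)"
    have ind: "integrable ?N (indicator ((\<lambda>z. z $ u) -` B \<inter> space ?N) :: _ \<Rightarrow> real)"
      if "B \<in> sets borel" for u and B :: "real set"
    proof (rule integrable_real_indicator)
      show "(\<lambda>z. z $ u) -` B \<inter> space ?N \<in> sets ?N"
        by (rule measurable_sets[OF _ that]) measurable
    qed (simp add: N.emeasure_eq_measure)
    have a_F [measurable]: "a \<in> borel_measurable ?F" and a_int: "integrable ?N a"
      unfolding a_def cond_prob_given_def using ind[OF that] by (auto intro: F.real_cond_exp_int)
    have a_N [measurable]: "a \<in> borel_measurable ?N" using a_int by simp
    have a_bound: "AE z in ?N. 0 \<le> a z \<and> a z \<le> 1"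
    proof -
      have "AE z in ?N. a z \<ge> 0" unfolding a_def cond_prob_given_def
        using F.real_cond_exp_ge_c[OF ind[OF that], where c=0] by simp
      moreover have "AE z in ?N. a z \<le> 1" unfolding a_def cond_prob_given_def
        using F.real_cond_exp_le_c[OF ind[OF that], where c=1] by (simp add: indicator_le_1)
      ultimately show ?thesis by eventually_elim simp
    qed
    have bounded_int: "integrable ?N (\<lambda>z. g z * a z)" if g: "integrable ?N g" for g :: "real ^ 'n \<Rightarrow> real"
    proof (rule Bochner_Integration.integrable_bound[OF g])
      show "(\<lambda>z. g z * a z) \<in> borel_measurable ?N" using g by measurable
      show "AE z in ?N. norm (g z * a z) \<le> norm (g z)"
        using a_bound by eventually_elim (auto simp: abs_mult intro: mult_left_le)
    qed
    have int_A: "integrable ?N (\<lambda>z. g z * indicator A (z $ i))" if g: "integrable ?N g" for g :: "real ^ 'n \<Rightarrow> real"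
    proof (rule Bochner_Integration.integrable_bound[OF g])
      show "(\<lambda>z. g z * indicator A (z $ i)) \<in> borel_measurable ?N" using g by measurable
    qed (auto simp: indicator_def)
    \<comment> \<open>Integrated over events of \<open>z $ j\<close>, conditional independence makes
      \<open>indicator A (z $ i) - a z\<close> orthogonal to these events, hence to
      \<open>z $ j\<close> itself.\<close>
    have "(\<integral>z. z $ j * (indicator A (z $ i) - a z) \<partial>?N) = 0"
    proof (rule N.integral_mult_vimage_algebra_eq_0[where Z="\<lambda>z. z $ j" and N=borel])
      show "(\<lambda>z. z $ j) \<in> borel_measurable ?N" by measurable
      show "integrable ?N (\<lambda>z. indicator A (z $ i) - a z)"
        using int_A[of "\<lambda>_. 1"] a_int by simp
      show "(\<lambda>z. z $ j) \<in> borel_measurable (vimage_algebra (space ?N) (\<lambda>z. z $ j) borel)"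
        by (rule measurable_vimage_algebra1) simp
      show "integrable ?N (\<lambda>z. z $ j * (indicator A (z $ i) - a z))"
        using int_A[OF int_comp[of j]] bounded_int[OF int_comp[of j]] by (simp add: right_diff_distrib)
      fix B :: "real set" assume B [measurable]: "B \<in> sets borel"
      let ?A = "(\<lambda>z. z $ i) -` A \<inter> space ?N" and ?B = "(\<lambda>z. z $ j) -` B \<inter> space ?N"
      have AE: "AE z in ?N. real_cond_exp ?N ?F (indicator (?A \<inter> ?B)) z
          = a z * real_cond_exp ?N ?F (indicator ?B) z"
        using ci that B unfolding gaussian_ci_def cond_indep_var_def a_def cond_prob_given_def by simp
      have AB: "integrable ?N (indicator (?A \<inter> ?B) :: _ \<Rightarrow> real)"
        by (rule integrable_real_indicator) (auto simp: N.emeasure_eq_measure)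
      have aB: "integrable ?N (\<lambda>z. a z * indicator ?B z)"
        using bounded_int[OF ind[OF B]] by (simp add: mult.commute)
      have "(\<integral>z. indicator (?A \<inter> ?B) z \<partial>?N) = (\<integral>z. real_cond_exp ?N ?F (indicator (?A \<inter> ?B)) z \<partial>?N)"
        using F.real_cond_exp_int(2)[OF AB] by simp
      also have "\<dots> = (\<integral>z. a z * real_cond_exp ?N ?F (indicator ?B) z \<partial>?N)"
        using AE by (intro integral_cong_AE) auto
      also have "\<dots> = (\<integral>z. a z * indicator ?B z \<partial>?N)"
        by (rule F.real_cond_exp_intg(2)[OF aB a_F]) auto
      finally have eq: "(\<integral>z. indicator (?A \<inter> ?B) z \<partial>?N) = (\<integral>z. a z * indicator ?B z \<partial>?N)" .
      have "(\<integral>z. indicator B (z $ j) * (indicator A (z $ i) - a z) \<partial>?N)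
          = (\<integral>z. indicator (?A \<inter> ?B) z - a z * indicator ?B z \<partial>?N)"
        by (intro Bochner_Integration.integral_cong) (auto simp: indicator_def)
      then show "(\<integral>z. indicator B (z $ j) * (indicator A (z $ i) - a z) \<partial>?N) = 0"
        using eq AB aB by simp
    qed
    then have e1: "(\<integral>z. z $ j * indicator A (z $ i) \<partial>?N) = (\<integral>z. z $ j * a z \<partial>?N)"
      using int_A[OF int_comp[of j]] bounded_int[OF int_comp[of j]] by (simp add: right_diff_distrib)
    \<comment> \<open>\<open>b \<bullet> z\<close> is the fitted value of \<open>z $ j\<close>. It
      depends only on the coordinates in \<open>K\<close>, so against it the indicator may be
      exchanged for its conditional expectation \<open>a\<close>; the residual
      \<open>y \<bullet> z\<close> is orthogonal to \<open>a\<close>.\<close>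
    define b where "b = axis j 1 - y"
    have b_lin: "z $ j = b \<bullet> z + y \<bullet> z" for z by (simp add: b_def inner_diff_left inner_axis')
    have b_F: "(\<lambda>z. b \<bullet> z) \<in> borel_measurable ?F"
      by (rule linF) (use y(1,2) in \<open>auto simp: b_def axis_def\<close>)
    have int_b: "integrable ?N (\<lambda>z. b \<bullet> z)" by (rule centered_normal_integrable[OF S])
    have "(\<integral>z. (y \<bullet> z) * a z \<partial>?N) = 0"
      using regression_residual_orthogonal[OF S y0 y(3) a_F] bounded_int[OF int_y] by (simp add: mult.commute)
    then have e2: "(\<integral>z. z $ j * a z \<partial>?N) = (\<integral>z. (b \<bullet> z) * a z \<partial>?N)"
      unfolding b_lin using bounded_int[OF int_b] bounded_int[OF int_y] by (simp add: distrib_right)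
    have "(\<integral>z. (b \<bullet> z) * a z \<partial>?N) = (\<integral>z. (b \<bullet> z) * indicator ((\<lambda>z. z $ i) -` A \<inter> space ?N) z \<partial>?N)"
      unfolding a_def cond_prob_given_def space_centered_normal
      by (rule F.real_cond_exp_intg(2)) (use int_A[OF int_b] b_F in \<open>auto simp: indicator_vimage\<close>)
    also have "\<dots> = (\<integral>z. (b \<bullet> z) * indicator A (z $ i) \<partial>?N)"
      by (intro Bochner_Integration.integral_cong) (auto simp: indicator_def)
    finally have e3: "(\<integral>z. (b \<bullet> z) * a z \<partial>?N) = (\<integral>z. (b \<bullet> z) * indicator A (z $ i) \<partial>?N)" .
    have "(\<integral>z. z $ j * indicator A (z $ i) \<partial>?N)
        = (\<integral>z. (b \<bullet> z) * indicator A (z $ i) \<partial>?N) + (\<integral>z. (y \<bullet> z) * indicator A (z $ i) \<partial>?N)"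
      unfolding b_lin using int_A[OF int_b] int_A[OF int_y] by (simp add: distrib_right)
    with e1 e2 e3 show ?thesis by (simp add: mult.commute)
  qed
  have int_prod: "integrable ?N (\<lambda>z. (c \<bullet> z) * (y \<bullet> z))" for c
    by (rule centered_normal_integrable_mult[OF S])
  have e1: "(\<integral>z. z $ i * (y \<bullet> z) \<partial>?N) = 0"
  proof (rule N.integral_mult_vimage_algebra_eq_0[where Z="\<lambda>z. z $ i" and N=borel])
    show "(\<lambda>z. z $ i) \<in> borel_measurable (vimage_algebra (space ?N) (\<lambda>z. z $ i) borel)"
      by (rule measurable_vimage_algebra1) simp
    show "integrable ?N (\<lambda>z. z $ i * (y \<bullet> z))"
      unfolding comp by (rule int_prod)
  qed (use orth_indicator int_y in auto)
  define c where "c = x - axis i 1"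
  have "(\<integral>z. (c \<bullet> z) * (y \<bullet> z) \<partial>?N) = 0"
    by (rule regression_residual_orthogonal[OF S y0 y(3) linF int_prod])
      (use x(1,2) in \<open>auto simp: c_def axis_def\<close>)
  moreover have "x \<bullet> z = z $ i + c \<bullet> z" for z
    by (simp add: c_def inner_diff_left inner_axis')
  ultimately have "(\<integral>z. (x \<bullet> z) * (y \<bullet> z) \<partial>?N) = 0"
    using e1 int_prod[of c] int_prod[of "axis i 1"] by (simp add: distrib_right inner_axis')
  then have "y \<bullet> (S *v x) = 0"
    by (rule centered_normal_covariance[OF S x0])
  \<comment> \<open>Since \<open>S *v x\<close> vanishes on \<open>K\<close>, only the term at
    \<open>j\<close> survives, and there \<open>y\<close> equals 1.\<close>
  moreover have "y \<bullet> (S *v x) = (\<Sum>u\<in>insert j K. y $ u * (S *v x) $ u)"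
    unfolding inner_vec_def using y(2) by (intro sum.mono_neutral_cong_right) auto
  ultimately show ?thesis
    using jK x(3) y(1) by simp
qed

section \<open>Conditional independence from uncorrelated blocks\<close>

lemma indep_vars_std_normal:
  "prob_space.indep_vars (PiM UNIV (\<lambda>_::'n::finite. std_normal)) (\<lambda>_. borel) (\<lambda>u z. z u) UNIV"
proof -
  let ?M = "PiM UNIV (\<lambda>_::'n. std_normal)"
  interpret prob_space ?M by (rule prob_space_std_normal_PiM)
  have rv: "random_variable std_normal (\<lambda>z. z u)" for u :: 'n
    by (rule measurable_component_singleton) simp
  have "indep_vars (\<lambda>_. std_normal) (\<lambda>u z. z u) (UNIV :: 'n set)"
  proof (subst indep_vars_iff_distr_eq_PiM')
    have "distr ?M ?M (\<lambda>x. \<lambda>i\<in>UNIV. x i) = ?M"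
      by (simp add: distr_id[unfolded id_def] restrict_UNIV)
    moreover have "(\<Pi>\<^sub>M i\<in>UNIV. distr ?M std_normal (\<lambda>z. z i)) = ?M"
      by (intro PiM_cong distr_PiM_component) (auto intro: prob_space_std_normal)
    ultimately show "distr ?M ?M (\<lambda>x. \<lambda>i\<in>UNIV. x i) = (\<Pi>\<^sub>M i\<in>UNIV. distr ?M std_normal (\<lambda>z. z i))"
      by simp
  qed (use rv in auto)
  from indep_vars_compose2[OF this, of "\<lambda>_ x. x" "\<lambda>_. borel"] show ?thesis by simp
qed

lemma distr_centered_normal:
  fixes S :: "real ^ 'n ^ 'n"
  assumes P: "S = P ** transpose P" "det P \<noteq> 0" and f: "f \<in> borel \<rightarrow>\<^sub>M K"
  shows "distr (centered_normal S) K f = distr (PiM UNIV (\<lambda>_::'n. std_normal)) K (\<lambda>z. f (P *v (\<chi> u. z u)))"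
proof -
  have [measurable]: "(\<lambda>z. \<chi> u. z u) \<in> borel_measurable (PiM UNIV (\<lambda>_::'n. std_normal))"
    using vec_lambda_borel_measurable by (simp cong: measurable_cong_sets sets_PiM_cong)
  show ?thesis
    unfolding centered_normal_std_normal[OF P] using f by (subst distr_distr) (auto simp: o_def)
qed

text \<open>The block-respecting factor expresses the two coordinate vectors through disjoint sets
  of independent standard normals, by the maps \<open>G A\<close> and \<open>G B\<close>; the joint
  law is then transported to the Gaussian measure.\<close>

lemma centered_normal_block_indep:
  fixes S :: "real ^ 'n ^ 'n"
  assumes S: "S \<in> PD" and AB: "A \<inter> B = {}" "\<And>a b. a \<in> A \<Longrightarrow> b \<in> B \<Longrightarrow> S $ a $ b = 0"
  shows "prob_space.indep_var (centered_normal S)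
    (PiM A (\<lambda>_. borel)) (\<lambda>z. \<lambda>u\<in>A. z $ u) (PiM B (\<lambda>_. borel)) (\<lambda>z. \<lambda>u\<in>B. z $ u)"
proof -
  obtain P where P: "S = P ** transpose P" "det P \<noteq> 0"
    and PA: "\<And>a u. a \<in> A \<Longrightarrow> u \<notin> A \<Longrightarrow> P $ a $ u = 0" and PB: "\<And>b u. b \<in> B \<Longrightarrow> u \<notin> B \<Longrightarrow> P $ b $ u = 0"
    using PD_factorization[OF S AB] by blast
  let ?M = "PiM UNIV (\<lambda>_::'n. std_normal)" and ?N = "centered_normal S"
  let ?T = "\<lambda>z. P *v (\<chi> u. z u)"
  interpret M: prob_space ?M by (rule prob_space_std_normal_PiM)
  interpret N: prob_space ?N by (rule prob_space_centered_normal[OF S])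
  have [measurable]: "(\<lambda>z. \<chi> u. z u) \<in> borel_measurable ?M"
    using vec_lambda_borel_measurable by (simp cong: measurable_cong_sets sets_PiM_cong)
  have T [measurable]: "?T \<in> borel_measurable ?M" by measurable
  have N: "?N = distr ?M borel ?T" by (rule centered_normal_std_normal[OF P])
  define G where "G C = (\<lambda>y. \<lambda>a\<in>C. \<Sum>u\<in>C. P $ a $ u * y u)" for C
  have G_meas: "G C \<in> PiM C (\<lambda>_. borel) \<rightarrow>\<^sub>M PiM C (\<lambda>_. borel :: real measure)" for C
    unfolding G_def
    by (intro measurable_restrict borel_measurable_sum borel_measurable_times borel_measurable_const
        measurable_component_singleton)
  have G: "G C (restrict z C) = (\<lambda>a\<in>C. ?T z $ a)" if "\<And>a u. a \<in> C \<Longrightarrow> u \<notin> C \<Longrightarrow> P $ a $ u = 0" for C z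
  proof (rule ext)
    fix a
    have "(\<Sum>u\<in>C. P $ a $ u * z u) = (\<Sum>u\<in>UNIV. P $ a $ u * z u)" if "a \<in> C"
      using \<open>\<And>a u. a \<in> C \<Longrightarrow> u \<notin> C \<Longrightarrow> P $ a $ u = 0\<close> that
      by (intro sum.mono_neutral_left) auto
    then show "G C (restrict z C) a = (\<lambda>a\<in>C. ?T z $ a) a"
      by (auto simp: G_def matrix_vector_component)
  qed
  have "M.indep_var (PiM A (\<lambda>_. borel)) (G A \<circ> (\<lambda>z. restrict z A)) (PiM B (\<lambda>_. borel)) (G B \<circ> (\<lambda>z. restrict z B))"
    using M.indep_var_restrict[OF indep_vars_std_normal AB(1)] G_meas
    by (intro M.indep_var_compose) auto
  moreover have "G A \<circ> (\<lambda>z. restrict z A) = (\<lambda>z. \<lambda>a\<in>A. ?T z $ a)" "G B \<circ> (\<lambda>z. restrict z B) = (\<lambda>z. \<lambda>a\<in>B. ?T z $ a)"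
    using G[OF PA] G[OF PB] by (auto simp: fun_eq_iff)
  ultimately have ind: "M.indep_var (PiM A (\<lambda>_. borel)) (\<lambda>z. \<lambda>a\<in>A. ?T z $ a) (PiM B (\<lambda>_. borel)) (\<lambda>z. \<lambda>a\<in>B. ?T z $ a)"
    by simp
  have pair: "(\<lambda>z :: real ^ 'n. (\<lambda>u\<in>A. z $ u, \<lambda>u\<in>B. z $ u))
      \<in> borel \<rightarrow>\<^sub>M PiM A (\<lambda>_. borel) \<Otimes>\<^sub>M PiM B (\<lambda>_. borel)"
    by measurable
  show ?thesis
    unfolding N.indep_var_distribution_eq
  proof (intro conjI)
    show "distr ?N (PiM A (\<lambda>_. borel)) (\<lambda>z. \<lambda>u\<in>A. z $ u) \<Otimes>\<^sub>M distr ?N (PiM B (\<lambda>_. borel)) (\<lambda>z. \<lambda>u\<in>B. z $ u)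
        = distr ?N (PiM A (\<lambda>_. borel) \<Otimes>\<^sub>M PiM B (\<lambda>_. borel)) (\<lambda>z. (\<lambda>u\<in>A. z $ u, \<lambda>u\<in>B. z $ u))"
      using ind unfolding M.indep_var_distribution_eq
      by (simp only: distr_centered_normal[OF P measurable_restrict_components] distr_centered_normal[OF P pair])
  qed measurable
qed

lemma (in prob_space) indep_var_vimage_algebra:
  assumes ind: "indep_var MU U MV V"
    and f: "f \<in> vimage_algebra (space M) U MU \<rightarrow>\<^sub>M S" and g: "g \<in> vimage_algebra (space M) V MV \<rightarrow>\<^sub>M T"
  shows "indep_var S f T g"
proof -
  have U: "U \<in> M \<rightarrow>\<^sub>M MU" and V: "V \<in> M \<rightarrow>\<^sub>M MV" using indep_var_rv1[OF ind] indep_var_rv2[OF ind] by auto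
  have "f \<in> M \<rightarrow>\<^sub>M S" "g \<in> M \<rightarrow>\<^sub>M T"
    using f g U V measurable_from_subalg[OF subalgebra_vimage_algebra] by blast+
  moreover have "indep_set (sigma_sets (space M) {f -` A \<inter> space M |A. A \<in> sets S})
      (sigma_sets (space M) {g -` A \<inter> space M |A. A \<in> sets T})"
    unfolding indep_set_def
  proof (rule indep_sets_mono_sets)
    show "indep_sets (case_bool (sigma_sets (space M) {U -` A \<inter> space M |A. A \<in> sets MU})
        (sigma_sets (space M) {V -` A \<inter> space M |A. A \<in> sets MV})) UNIV"
      using ind unfolding indep_var_eq indep_set_def by simp
    have "sigma_sets (space M) {f -` A \<inter> space M |A. A \<in> sets S} \<subseteq> sets (vimage_algebra (space M) U MU)"
      using measurable_sets[OF f]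
        sets.sigma_sets_subset[of "{f -` A \<inter> space M |A. A \<in> sets S}" "vimage_algebra (space M) U MU"]
      by auto
    moreover have "sigma_sets (space M) {g -` A \<inter> space M |A. A \<in> sets T} \<subseteq> sets (vimage_algebra (space M) V MV)"
      using measurable_sets[OF g]
        sets.sigma_sets_subset[of "{g -` A \<inter> space M |A. A \<in> sets T}" "vimage_algebra (space M) V MV"]
      by auto
    ultimately show "(case i of True \<Rightarrow> sigma_sets (space M) {f -` A \<inter> space M |A. A \<in> sets S}
        | False \<Rightarrow> sigma_sets (space M) {g -` A \<inter> space M |A. A \<in> sets T})
      \<subseteq> (case i of True \<Rightarrow> sigma_sets (space M) {U -` A \<inter> space M |A. A \<in> sets MU}
        | False \<Rightarrow> sigma_sets (space M) {V -` A \<inter> space M |A. A \<in> sets MV})" for i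
      by (auto simp: sets_vimage_algebra split: bool.split)
  qed
  ultimately show ?thesis unfolding indep_var_eq by blast
qed

text \<open>The functions \<open>p\<close> and \<open>q\<close>, used as densities, push forward
  along the conditioning vector to finite measures on the product space. Boxes form an
  intersection-stable generator, so agreement on them gives agreement on every event of that
  vector.\<close>

lemma (in finite_measure) real_cond_exp_eqI_boxes:
  fixes X :: "'k \<Rightarrow> 'a \<Rightarrow> real" and p q :: "'a \<Rightarrow> real"
  assumes K: "finite K" and X: "\<And>k. k \<in> K \<Longrightarrow> X k \<in> borel_measurable M"
    and p [measurable]: "p \<in> borel_measurable M" and p01: "\<And>z. 0 \<le> p z" "\<And>z. p z \<le> 1"
    and q: "q \<in> borel_measurable (vimage_algebra (space M) (\<lambda>z. \<lambda>k\<in>K. X k z) (PiM K (\<lambda>_. borel)))"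
    and q01: "\<And>z. 0 \<le> q z" "\<And>z. q z \<le> 1"
    and boxes: "\<And>C. (\<And>k. k \<in> K \<Longrightarrow> C k \<in> sets borel) \<Longrightarrow>
      (\<integral>z. p z * (\<Prod>k\<in>K. indicator (C k) (X k z)) \<partial>M) = (\<integral>z. q z * (\<Prod>k\<in>K. indicator (C k) (X k z)) \<partial>M)"
  shows "AE z in M. real_cond_exp M (vimage_algebra (space M) (\<lambda>z. \<lambda>k\<in>K. X k z) (PiM K (\<lambda>_. borel))) p z = q z"
proof -
  let ?Z = "\<lambda>z. \<lambda>k\<in>K. X k z" and ?P = "PiM K (\<lambda>_. borel :: real measure)"
  let ?F = "vimage_algebra (space M) ?Z ?P"
  have Z [measurable]: "?Z \<in> M \<rightarrow>\<^sub>M ?P" using X by (rule measurable_restrict)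
  interpret F: finite_measure_subalgebra M ?F
    by unfold_locales (rule subalgebra_vimage_algebra[OF Z])
  have q_M [measurable]: "q \<in> borel_measurable M" by (rule measurable_from_subalg[OF F.subalg q])
  have bint: "integrable M h" if [measurable]: "h \<in> borel_measurable M" and "\<And>z. 0 \<le> h z" "\<And>z. h z \<le> 1"
    for h :: "'a \<Rightarrow> real"
    by (rule integrable_const_bound[of _ 1]) (use that in auto)
  have int: "integrable M p" "integrable M q"
    by (rule bint[OF p p01], rule bint[OF q_M q01])
  have em: "emeasure (distr (density M (\<lambda>z. ennreal (h z))) ?P ?Z) C = ennreal (\<integral>z. h z * indicator C (?Z z) \<partial>M)"
    if [measurable]: "h \<in> borel_measurable M" "C \<in> sets ?P" and h: "\<And>z. 0 \<le> h z" "\<And>z. h z \<le> 1" for h C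
  proof -
    have "emeasure (distr (density M (\<lambda>z. ennreal (h z))) ?P ?Z) C
        = (\<integral>\<^sup>+z. ennreal (h z) * indicator (?Z -` C \<inter> space M) z \<partial>M)"
      by (simp add: emeasure_distr emeasure_density)
    also have "\<dots> = (\<integral>\<^sup>+z. ennreal (h z * indicator C (?Z z)) \<partial>M)"
      by (intro nn_integral_cong) (auto simp: indicator_def)
    also have "\<dots> = ennreal (\<integral>z. h z * indicator C (?Z z) \<partial>M)"
      using h by (intro nn_integral_eq_integral bint) (auto simp: indicator_def)
    finally show ?thesis .
  qed
  have "distr (density M (\<lambda>z. ennreal (p z))) ?P ?Z = distr (density M (\<lambda>z. ennreal (q z))) ?P ?Z"
  proof (rule measure_eqI_PiM_finite[OF K])
    fix C :: "'k \<Rightarrow> real set" assume C: "\<And>k. k \<in> K \<Longrightarrow> C k \<in> sets borel"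
    then have CP: "Pi\<^sub>E K C \<in> sets ?P" using K by (intro sets_PiM_I_finite) auto
    have ind: "indicator (Pi\<^sub>E K C) (?Z z) = (\<Prod>k\<in>K. indicator (C k) (X k z) :: real)" for z
    proof (cases "?Z z \<in> Pi\<^sub>E K C")
      case True then show ?thesis by (auto simp: PiE_iff intro!: prod.neutral[symmetric])
    next
      case False
      then obtain k where "k \<in> K" "X k z \<notin> C k" by (auto simp: PiE_iff)
      then have "(\<Prod>k\<in>K. indicator (C k) (X k z) :: real) = 0" using K by (intro prod_zero) (auto intro!: bexI[of _ k])
      with False show ?thesis by simp
    qed
    show "emeasure (distr (density M (\<lambda>z. ennreal (p z))) ?P ?Z) (Pi\<^sub>E K C)
        = emeasure (distr (density M (\<lambda>z. ennreal (q z))) ?P ?Z) (Pi\<^sub>E K C)"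
      using boxes[OF C] by (simp add: em CP p01 q01 ind)
  next
    show "range (\<lambda>_::nat. Pi\<^sub>E K (\<lambda>_. UNIV)) \<subseteq> prod_algebra K (\<lambda>_. borel :: real measure)"
      using prod_algebraI_finite[OF K, of "\<lambda>_. UNIV" "\<lambda>_. borel"] by auto
    show "(\<Union>i::nat. Pi\<^sub>E K (\<lambda>_. UNIV)) = space ?P" by (simp add: space_PiM)
    have "Pi\<^sub>E K (\<lambda>_. UNIV) \<in> sets ?P" using K by (intro sets_PiM_I_finite) auto
    then show "emeasure (distr (density M (\<lambda>z. ennreal (p z))) ?P ?Z) (Pi\<^sub>E K (\<lambda>_. UNIV)) \<noteq> \<infinity>" for i :: nat
      by (simp add: em p01)
  qed simp_all
  then have eq: "(\<integral>z. p z * indicator C (?Z z) \<partial>M) = (\<integral>z. q z * indicator C (?Z z) \<partial>M)" if "C \<in> sets ?P" for C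
    using em[of p C] em[of q C] that p01 q01 by (simp add: integral_nonneg_AE)
  have Zs: "?Z \<in> space M \<rightarrow> space ?P" by (auto simp: space_PiM)
  show ?thesis
  proof (rule F.real_cond_exp_charact[OF _ int q])
    fix A assume "A \<in> sets ?F"
    then obtain B where B: "B \<in> sets ?P" "A = ?Z -` B \<inter> space M"
      unfolding sets_vimage_algebra2[OF Zs] by blast
    have "(\<integral>z\<in>A. h z \<partial>M) = (\<integral>z. h z * indicator B (?Z z) \<partial>M)" for h :: "'a \<Rightarrow> real"
      unfolding set_lebesgue_integral_def B(2) by (intro Bochner_Integration.integral_cong) (auto simp: indicator_def)
    then show "(\<integral>z\<in>A. p z \<partial>M) = (\<integral>z\<in>A. q z \<partial>M)"
      using eq[OF B(1)] by simp
  qed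
qed

section \<open>Conditional probabilities given sets of coordinates\<close>

abbreviation coordinate_algebra :: "'n set \<Rightarrow> (real ^ 'n::finite) measure" where
  "coordinate_algebra I \<equiv> vimage_algebra UNIV (\<lambda>z. \<lambda>k\<in>I. z $ k) (PiM I (\<lambda>_. borel))"

lemma component_coordinate_algebra:
  fixes I :: "'n::finite set"
  assumes "k \<in> I"
  shows "(\<lambda>z. z $ k) \<in> borel_measurable (coordinate_algebra I)"
proof -
  have "(\<lambda>z. \<lambda>k\<in>I. z $ k) \<in> coordinate_algebra I \<rightarrow>\<^sub>M PiM I (\<lambda>_. borel :: real measure)"
    by (rule measurable_vimage_algebra1) (auto simp: space_PiM)
  from measurable_compose[OF this measurable_component_singleton[OF assms]] assms show ?thesis by simp
qed

lemma coordinate_algebra_mono: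
  fixes I J :: "'n::finite set"
  assumes "I \<subseteq> J" "f \<in> borel_measurable (coordinate_algebra I)"
  shows "f \<in> borel_measurable (coordinate_algebra J)"
proof -
  have "(\<lambda>z. z) \<in> coordinate_algebra J \<rightarrow>\<^sub>M coordinate_algebra I"
    using component_coordinate_algebra assms(1)
    by (intro measurable_vimage_algebra2 measurable_restrict) auto
  from measurable_compose[OF this assms(2)] show ?thesis .
qed

lemma box_indicator_coordinate_algebra:
  fixes I :: "'n::finite set"
  assumes "\<And>k. k \<in> I \<Longrightarrow> C k \<in> sets borel"
  shows "(\<lambda>z. \<Prod>k\<in>I. indicator (C k) (z $ k) :: real) \<in> borel_measurable (coordinate_algebra I)"
  using assms component_coordinate_algebra
  by (intro borel_measurable_prod measurable_compose[OF component_coordinate_algebra] borel_measurable_indicator)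

lemma coordinate_algebra_subalgebra: "subalgebra (centered_normal S) (coordinate_algebra I)"
  using subalgebra_vimage_algebra[of "\<lambda>z. \<lambda>k\<in>I. z $ k" "centered_normal S"] by simp

text \<open>Clipping the conditional expectation to the unit interval makes the bounds hold at every
  point instead of almost everywhere, as the box criterion demands.\<close>

lemma conditional_probability_version:
  fixes S :: "real ^ 'n ^ 'n"
  assumes S: "S \<in> PD" and B: "B \<in> sets borel"
  obtains f :: "real ^ 'n \<Rightarrow> real" where "f \<in> borel_measurable (coordinate_algebra I)" "\<And>z. 0 \<le> f z" "\<And>z. f z \<le> 1"
    "\<And>C. (\<And>k. k \<in> I \<Longrightarrow> C k \<in> sets borel) \<Longrightarrow>
      (\<integral>z. f z * (\<Prod>k\<in>I. indicator (C k) (z $ k)) \<partial>centered_normal S)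
      = (\<integral>z. indicator B (z $ u) * (\<Prod>k\<in>I. indicator (C k) (z $ k)) \<partial>centered_normal S)"
proof -
  let ?N = "centered_normal S" and ?F = "coordinate_algebra I"
  interpret N: prob_space ?N by (rule prob_space_centered_normal[OF S])
  interpret F: finite_measure_subalgebra ?N ?F
    by unfold_locales (rule coordinate_algebra_subalgebra)
  define h where "h = real_cond_exp ?N ?F (\<lambda>z. indicator B (z $ u))"
  define f where "f z = max 0 (min 1 (h z))" for z
  have [measurable]: "(\<lambda>z. indicator B (z $ u) :: real) \<in> borel_measurable ?N"
    using B by measurable
  have int: "integrable ?N (\<lambda>z. indicator B (z $ u) :: real)"
    by (rule N.integrable_const_bound[of _ 1]) auto
  have h_F [measurable]: "h \<in> borel_measurable ?F" unfolding h_def by simp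
  have f_F: "f \<in> borel_measurable ?F" unfolding f_def by measurable
  have "AE z in ?N. h z \<ge> 0" "AE z in ?N. h z \<le> 1" unfolding h_def
    using F.real_cond_exp_ge_c[OF int, where c=0] F.real_cond_exp_le_c[OF int, where c=1]
    by (simp_all add: indicator_le_1)
  then have AE: "AE z in ?N. f z = h z" by eventually_elim (simp add: f_def)
  have "(\<integral>z. f z * (\<Prod>k\<in>I. indicator (C k) (z $ k)) \<partial>?N)
      = (\<integral>z. indicator B (z $ u) * (\<Prod>k\<in>I. indicator (C k) (z $ k)) \<partial>?N)"
    if C: "\<And>k. k \<in> I \<Longrightarrow> C k \<in> sets borel" for C
  proof -
    let ?\<phi> = "\<lambda>z :: real ^ 'n. \<Prod>k\<in>I. indicator (C k) (z $ k) :: real"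
    have \<phi>_F: "?\<phi> \<in> borel_measurable ?F" by (rule box_indicator_coordinate_algebra[OF C])
    have [measurable]: "?\<phi> \<in> borel_measurable ?N" by (rule measurable_from_subalg[OF F.subalg \<phi>_F])
    have [measurable]: "f \<in> borel_measurable ?N" "h \<in> borel_measurable ?N"
      by (rule measurable_from_subalg[OF F.subalg f_F], rule measurable_from_subalg[OF F.subalg h_F])
    have \<phi>01: "0 \<le> ?\<phi> z" "?\<phi> z \<le> 1" for z
      by (auto intro!: prod_nonneg prod_le_1 simp: indicator_def)
    have "integrable ?N (\<lambda>z. ?\<phi> z * indicator B (z $ u))"
    proof (rule N.integrable_const_bound[of _ 1])
      show "AE z in ?N. norm (?\<phi> z * indicator B (z $ u)) \<le> 1"
        using \<phi>01 by (auto simp: indicator_def)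
    qed measurable
    from F.real_cond_exp_intg(2)[OF this \<phi>_F]
    have "(\<integral>z. ?\<phi> z * h z \<partial>?N) = (\<integral>z. ?\<phi> z * indicator B (z $ u) \<partial>?N)"
      by (simp add: h_def)
    moreover have "(\<integral>z. f z * ?\<phi> z \<partial>?N) = (\<integral>z. ?\<phi> z * h z \<partial>?N)"
    proof (rule integral_cong_AE)
      show "AE z in ?N. f z * ?\<phi> z = ?\<phi> z * h z"
        using AE by eventually_elim simp
    qed measurable
    ultimately show ?thesis by (simp add: mult.commute)
  qed
  with f_F show ?thesis
    using that[of f] by (simp add: f_def)
qed

text \<open>On boxes, independence of the blocks shows that the product of the conditional probabilities given
  \<open>K \<inter> A\<close> and given \<open>K \<inter> B\<close> is a conditional probability given \<open>K\<close>.\<close>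

lemma gaussian_ci_block_diagonal:
  fixes S :: "real ^ 'n ^ 'n"
  assumes S: "S \<in> PD" and AB: "A \<inter> B = {}" "\<And>a b. a \<in> A \<Longrightarrow> b \<in> B \<Longrightarrow> S $ a $ b = 0"
    and ij: "i \<in> A" "j \<in> B" and K: "K \<subseteq> A \<union> B"
  shows "gaussian_ci S i j K"
proof -
  let ?N = "centered_normal S" and ?F = "coordinate_algebra K"
  interpret N: prob_space ?N by (rule prob_space_centered_normal[OF S])
  interpret F: finite_measure_subalgebra ?N ?F
    by unfold_locales (rule coordinate_algebra_subalgebra)
  let ?KA = "K \<inter> A" and ?KB = "K \<inter> B"
  let ?box = "\<lambda>I C (z :: real ^ 'n). \<Prod>k\<in>I. indicator (C k) (z $ k) :: real"
  have meas_N: "f \<in> borel_measurable ?N" if "f \<in> borel_measurable (coordinate_algebra I)" for f :: "real ^ 'n \<Rightarrow> real" and I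
    using measurable_from_subalg[OF coordinate_algebra_subalgebra that] .
  have product: "(\<integral>z. f z * g z \<partial>?N) = (\<integral>z. f z \<partial>?N) * (\<integral>z. g z \<partial>?N)"
    if f: "f \<in> borel_measurable (coordinate_algebra A)" "\<And>z. 0 \<le> f z" "\<And>z. f z \<le> 1"
    and g: "g \<in> borel_measurable (coordinate_algebra B)" "\<And>z. 0 \<le> g z" "\<And>z. g z \<le> 1" for f g :: "real ^ 'n \<Rightarrow> real"
  proof (rule N.indep_var_lebesgue_integral)
    show "N.indep_var borel f borel g"
      using N.indep_var_vimage_algebra[OF centered_normal_block_indep[OF S AB]] f(1) g(1) by simp
    show "integrable ?N f"
      by (rule N.integrable_const_bound[of _ 1]) (use f(2,3) meas_N[OF f(1)] in auto)
    show "integrable ?N g"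
      by (rule N.integrable_const_bound[of _ 1]) (use g(2,3) meas_N[OF g(1)] in auto)
  qed
  have mult01: "0 \<le> a * b" "a * b \<le> 1" if "0 \<le> a" "a \<le> 1" "0 \<le> b" "b \<le> (1::real)" for a b
    using that by (auto intro: mult_le_one)
  have box01: "0 \<le> ?box I C z" "?box I C z \<le> 1" for I C z
    by (auto intro!: prod_nonneg prod_le_1 simp: indicator_def)
  have ind01: "0 \<le> (indicator X y :: real)" "indicator X y \<le> (1::real)" for X :: "real set" and y
    by (auto simp: indicator_def)
  \<comment> \<open>Packing the four properties into one predicate lets \<open>bchoice\<close>
    select a version for every event simultaneously.\<close>
  define is_version where "is_version I u X f \<longleftrightarrow>
      f \<in> borel_measurable (coordinate_algebra I) \<and> (\<forall>z. 0 \<le> f z) \<and> (\<forall>z. f z \<le> 1) \<and>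
      (\<forall>C. (\<forall>k\<in>I. C k \<in> sets borel) \<longrightarrow> (\<integral>z. f z * ?box I C z \<partial>?N) = (\<integral>z. indicator X (z $ u) * ?box I C z \<partial>?N))"
    for I u X and f :: "real ^ 'n \<Rightarrow> real"
  have version: "\<exists>f. is_version I u X f" if X: "X \<in> sets borel" for I u X
  proof (rule conditional_probability_version[OF S X, of I u])
    fix f :: "real ^ 'n \<Rightarrow> real" assume "f \<in> borel_measurable (coordinate_algebra I)" "\<And>z. 0 \<le> f z" "\<And>z. f z \<le> 1"
      "\<And>C. (\<And>k. k \<in> I \<Longrightarrow> C k \<in> sets borel) \<Longrightarrow>
        (\<integral>z. f z * ?box I C z \<partial>?N) = (\<integral>z. indicator X (z $ u) * ?box I C z \<partial>?N)"
    then have "is_version I u X f" unfolding is_version_def by blast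
    then show ?thesis by (rule exI[of _ f])
  qed
  obtain f where f: "\<And>X. X \<in> sets borel \<Longrightarrow> f X \<in> borel_measurable (coordinate_algebra ?KA)"
      "\<And>X z. X \<in> sets borel \<Longrightarrow> 0 \<le> f X z" "\<And>X z. X \<in> sets borel \<Longrightarrow> f X z \<le> 1"
      "\<And>X C. X \<in> sets borel \<Longrightarrow> (\<And>k. k \<in> ?KA \<Longrightarrow> C k \<in> sets borel) \<Longrightarrow>
        (\<integral>z. f X z * ?box ?KA C z \<partial>?N) = (\<integral>z. indicator X (z $ i) * ?box ?KA C z \<partial>?N)"
  proof -
    have "\<forall>X\<in>sets borel. \<exists>f. is_version ?KA i X f" using version by blast
    from bchoice[OF this] obtain f where "\<forall>X\<in>sets borel. is_version ?KA i X (f X)" by blast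
    then show ?thesis using that[of f] unfolding is_version_def by blast
  qed
  obtain g where g: "\<And>X. X \<in> sets borel \<Longrightarrow> g X \<in> borel_measurable (coordinate_algebra ?KB)"
      "\<And>X z. X \<in> sets borel \<Longrightarrow> 0 \<le> g X z" "\<And>X z. X \<in> sets borel \<Longrightarrow> g X z \<le> 1"
      "\<And>X C. X \<in> sets borel \<Longrightarrow> (\<And>k. k \<in> ?KB \<Longrightarrow> C k \<in> sets borel) \<Longrightarrow>
        (\<integral>z. g X z * ?box ?KB C z \<partial>?N) = (\<integral>z. indicator X (z $ j) * ?box ?KB C z \<partial>?N)"
  proof -
    have "\<forall>X\<in>sets borel. \<exists>f. is_version ?KB j X f" using version by blast
    from bchoice[OF this] obtain g where "\<forall>X\<in>sets borel. is_version ?KB j X (g X)" by blast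
    then show ?thesis using that[of g] unfolding is_version_def by blast
  qed
  define p where "p X Y = (indicator (((\<lambda>z. z $ i) -` X \<inter> space ?N) \<inter> ((\<lambda>z. z $ j) -` Y \<inter> space ?N)) :: real ^ 'n \<Rightarrow> real)"
    for X Y
  have p: "p X Y z = indicator X (z $ i) * indicator Y (z $ j)" for X Y z
    by (auto simp: p_def indicator_def)
  have key: "AE z in ?N. real_cond_exp ?N ?F (p X Y) z = f X z * g Y z"
    if X [measurable]: "X \<in> sets borel" and Y [measurable]: "Y \<in> sets borel" for X Y
  proof -
    have "AE z in ?N. real_cond_exp ?N (vimage_algebra (space ?N) (\<lambda>z. \<lambda>k\<in>K. z $ k) (PiM K (\<lambda>_. borel))) (p X Y) z
        = f X z * g Y z"
    proof (rule N.real_cond_exp_eqI_boxes)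
      show "p X Y \<in> borel_measurable ?N" unfolding p[abs_def] by measurable
      show "0 \<le> p X Y z" "p X Y z \<le> 1" for z by (auto simp: p_def indicator_def)
      show "(\<lambda>z. f X z * g Y z) \<in> borel_measurable (vimage_algebra (space ?N) (\<lambda>z. \<lambda>k\<in>K. z $ k) (PiM K (\<lambda>_. borel)))"
        using coordinate_algebra_mono[OF _ f(1)[OF X], of K] coordinate_algebra_mono[OF _ g(1)[OF Y], of K]
        by simp
      show "0 \<le> f X z * g Y z" "f X z * g Y z \<le> 1" for z
        using mult01[of "f X z" "g Y z"] f(2,3)[OF X] g(2,3)[OF Y] by auto
      fix C assume C: "\<And>k. k \<in> K \<Longrightarrow> C k \<in> sets (borel :: real measure)"
      have split: "?box K C z = ?box ?KA C z * ?box ?KB C z" for z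
      proof -
        have "K = ?KA \<union> ?KB" "?KA \<inter> ?KB = {}" using K AB(1) by auto
        then show ?thesis by (metis (no_types, lifting) finite prod.union_disjoint)
      qed
      have box_A: "?box ?KA C \<in> borel_measurable (coordinate_algebra A)"
        by (rule coordinate_algebra_mono[OF _ box_indicator_coordinate_algebra]) (use C in auto)
      have box_B: "?box ?KB C \<in> borel_measurable (coordinate_algebra B)"
        by (rule coordinate_algebra_mono[OF _ box_indicator_coordinate_algebra]) (use C in auto)
      have f_A: "f X \<in> borel_measurable (coordinate_algebra A)" by (rule coordinate_algebra_mono[OF _ f(1)[OF X]]) auto
      have g_B: "g Y \<in> borel_measurable (coordinate_algebra B)" by (rule coordinate_algebra_mono[OF _ g(1)[OF Y]]) auto
      have X_A: "(\<lambda>z. indicator X (z $ i) :: real) \<in> borel_measurable (coordinate_algebra A)"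
        using measurable_compose[OF component_coordinate_algebra[OF ij(1)] borel_measurable_indicator[OF X]] .
      have Y_B: "(\<lambda>z. indicator Y (z $ j) :: real) \<in> borel_measurable (coordinate_algebra B)"
        using measurable_compose[OF component_coordinate_algebra[OF ij(2)] borel_measurable_indicator[OF Y]] .
      have "(\<integral>z. p X Y z * ?box K C z \<partial>?N)
          = (\<integral>z. (indicator X (z $ i) * ?box ?KA C z) * (indicator Y (z $ j) * ?box ?KB C z) \<partial>?N)"
        by (simp add: p split ac_simps)
      also have "\<dots> = (\<integral>z. indicator X (z $ i) * ?box ?KA C z \<partial>?N) * (\<integral>z. indicator Y (z $ j) * ?box ?KB C z \<partial>?N)"
        by (intro product borel_measurable_times X_A Y_B box_A box_B mult01 box01 ind01)
      also have "\<dots> = (\<integral>z. f X z * ?box ?KA C z \<partial>?N) * (\<integral>z. g Y z * ?box ?KB C z \<partial>?N)"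
        using f(4)[OF X, of C] g(4)[OF Y, of C] C by simp
      also have "\<dots> = (\<integral>z. (f X z * ?box ?KA C z) * (g Y z * ?box ?KB C z) \<partial>?N)"
        by (intro product[symmetric] borel_measurable_times f_A g_B box_A box_B mult01 box01 f(2,3)[OF X] g(2,3)[OF Y])
      also have "\<dots> = (\<integral>z. (f X z * g Y z) * ?box K C z \<partial>?N)"
        by (simp add: split ac_simps)
      finally show "(\<integral>z. p X Y z * ?box K C z \<partial>?N) = (\<integral>z. (f X z * g Y z) * ?box K C z \<partial>?N)" .
    qed simp_all
    then show ?thesis by simp
  qed
  \<comment> \<open>The marginal probabilities are the cases \<open>Y = UNIV\<close> and
    \<open>X = UNIV\<close> of \<open>key\<close>, with surplus factors \<open>g UNIV\<close> and
    \<open>f UNIV\<close>. These have product 1 almost everywhere and neither exceeds 1, so both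
    equal 1.\<close>
  have "p UNIV UNIV = (\<lambda>_. 1)" by (auto simp: p_def)
  then have "AE z in ?N. real_cond_exp ?N ?F (p UNIV UNIV) z = 1"
    using F.real_cond_exp_F_meas[of "\<lambda>_. 1"] by simp
  moreover have U: "(UNIV :: real set) \<in> sets borel" by simp
  note key[OF U U]
  ultimately have one: "AE z in ?N. f UNIV z = 1 \<and> g UNIV z = 1"
  proof eventually_elim
    case (elim z)
    have "f UNIV z \<le> 1" "g UNIV z \<le> 1" "0 \<le> f UNIV z" "0 \<le> g UNIV z"
      using f(2,3)[of UNIV] g(2,3)[of UNIV] by auto
    then have le: "f UNIV z * g UNIV z \<le> f UNIV z" "f UNIV z * g UNIV z \<le> g UNIV z"
      by (auto intro: mult_left_le mult_left_le_one_le)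
    with elim \<open>f UNIV z \<le> 1\<close> \<open>g UNIV z \<le> 1\<close> le show ?case by auto
  qed
  show ?thesis
    unfolding gaussian_ci_def cond_indep_var_def cond_prob_given_def
  proof (intro ballI)
    fix X Y :: "real set" assume X: "X \<in> sets borel" and Y: "Y \<in> sets borel"
    have pX: "indicator ((\<lambda>z. z $ i) -` X \<inter> space ?N) = p X UNIV"
      and pY: "indicator ((\<lambda>z. z $ j) -` Y \<inter> space ?N) = p UNIV Y"
      by (auto simp: p_def)
    have "AE z in ?N. real_cond_exp ?N ?F (p X Y) z = real_cond_exp ?N ?F (p X UNIV) z * real_cond_exp ?N ?F (p UNIV Y) z"
      using key[OF X Y] key[OF X U] key[OF U Y] one
      by eventually_elim simp
    then show "AE z in ?N. real_cond_exp ?N (vimage_algebra (space ?N) (\<lambda>z. \<lambda>k\<in>K. z $ k) (PiM K (\<lambda>_. borel)))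
          (indicator (((\<lambda>z. z $ i) -` X \<inter> space ?N) \<inter> ((\<lambda>z. z $ j) -` Y \<inter> space ?N))) z
        = real_cond_exp ?N (vimage_algebra (space ?N) (\<lambda>z. \<lambda>k\<in>K. z $ k) (PiM K (\<lambda>_. borel)))
            (indicator ((\<lambda>z. z $ i) -` X \<inter> space ?N)) z
          * real_cond_exp ?N (vimage_algebra (space ?N) (\<lambda>z. \<lambda>k\<in>K. z $ k) (PiM K (\<lambda>_. borel)))
            (indicator ((\<lambda>z. z $ j) -` Y \<inter> space ?N)) z"
      unfolding pX pY p_def[symmetric] by simp
  qed
qed

section \<open>Zeros of the covariance matrix\<close>

text \<open>If \<open>w = Y *v z\<close> were nonzero, moving from the maximiser \<open>z\<close> a
  small step \<open>t\<close> along \<open>w\<close> would make the form positive: its linear term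
  is \<open>2 * t * (w \<bullet> w)\<close>, and \<open>t\<close> is so small that the quadratic
  term cannot cancel it.\<close>

lemma nonpositive_form_kernel:
  fixes Y :: "real ^ 'n ^ 'n"
  assumes sym: "transpose Y = Y" and np: "\<And>z. z \<bullet> (Y *v z) \<le> 0" and z: "z \<bullet> (Y *v z) = 0"
  shows "Y *v z = 0"
proof (rule ccontr)
  define w where "w = Y *v z"
  assume "Y *v z \<noteq> 0"
  then have c: "w \<bullet> w > 0" by (simp add: w_def)
  define b where "b = w \<bullet> (Y *v w)"
  define t where "t = w \<bullet> w / (\<bar>b\<bar> + 1)"
  have t: "t > 0" using c by (simp add: t_def divide_pos_pos)
  have "z \<bullet> (Y *v w) = w \<bullet> w"
    by (simp add: symmetric_matrix_inner[OF sym] w_def)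
  then have "(z + t *\<^sub>R w) \<bullet> (Y *v (z + t *\<^sub>R w)) = t * (2 * (w \<bullet> w) + t * b)"
    using z by (simp add: matrix_vector_right_distrib matrix_vector_mult_scaleR inner_add_left inner_add_right
        b_def algebra_simps flip: w_def)
  moreover have "t * \<bar>b\<bar> \<le> w \<bullet> w"
    using c by (simp add: t_def field_simps mult_left_le)
  then have "- (t * b) \<le> w \<bullet> w"
    using t abs_le_D2[of "t * b" "w \<bullet> w"] by (simp add: abs_mult)
  then have "2 * (w \<bullet> w) + t * b > 0"
    using c by linarith
  ultimately have "(z + t *\<^sub>R w) \<bullet> (Y *v (z + t *\<^sub>R w)) > 0" using t by simp
  with np[of "z + t *\<^sub>R w"] show False by simp
qed

text \<open>A maximiser \<open>z\<close> of the generalised Rayleigh quotient of \<open>X\<close> relative to \<open>S\<close>, with maximum \<open>c\<close>, lies in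
  the kernel of \<open>X - c S\<close>; testing the two Lyapunov equations against \<open>z\<close> then gives \<open>c = 0\<close>.\<close>

lemma lyapunov_kernel_nonpositive:
  fixes S M X :: "real ^ 'n ^ 'n"
  assumes S: "S \<in> PD" and lyap: "M ** S + S ** transpose M + 2 *\<^sub>R mat 1 = 0"
    and sym: "transpose X = X" and X: "M ** X + X ** transpose M = 0"
  shows "y \<bullet> (X *v y) \<le> 0"
proof -
  define f where "f z = (z \<bullet> (X *v z)) / (z \<bullet> (S *v z))" for z
  have pos: "z \<bullet> (S *v z) > 0" if "z \<noteq> 0" for z by (rule PD_pos[OF S that])
  have nz: "\<forall>z\<in>sphere 0 1. z \<bullet> (S *v z) \<noteq> 0"
  proof
    fix z :: "real ^ 'n" assume "z \<in> sphere 0 1"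
    then have "z \<noteq> 0" by auto
    with pos[of z] show "z \<bullet> (S *v z) \<noteq> 0" by simp
  qed
  have "continuous_on (sphere 0 1) f"
    unfolding f_def
    by (intro continuous_intros linear_continuous_on_compose[OF continuous_on_id matrix_vector_mul_linear] nz)
  moreover have "(sphere 0 1 :: (real ^ 'n) set) \<noteq> {}" by simp
  ultimately obtain z where z: "z \<in> sphere 0 1" and max: "\<And>y. y \<in> sphere 0 1 \<Longrightarrow> f y \<le> f z"
    using continuous_attains_sup[OF compact_sphere] by blast
  define c where "c = f z"
  have z0: "z \<noteq> 0" using z by auto
  define Y where "Y = X - c *\<^sub>R S"
  have Yv: "Y *v y = X *v y - c *\<^sub>R (S *v y)" for y
    by (simp add: Y_def matrix_vector_mult_diff_rdistrib scaleR_matrix_vector_assoc)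
  have le: "y \<bullet> (X *v y) \<le> c * (y \<bullet> (S *v y))" for y
  proof (cases "y = 0")
    case False
    have "f y = f (y /\<^sub>R norm y)"
      using False by (simp add: f_def matrix_vector_mult_scaleR)
    also have "\<dots> \<le> c" unfolding c_def using False by (intro max) simp
    finally show ?thesis using pos[OF False] by (simp add: f_def divide_le_eq)
  qed simp
  have "transpose Y = Y"
    using sym PD_symmetric[OF S] by (auto simp: Y_def transpose_def vec_eq_iff)
  moreover have "y \<bullet> (Y *v y) \<le> 0" for y
    using le[of y] by (simp add: Yv inner_diff_right)
  moreover have "z \<bullet> (Y *v z) = 0"
    using pos[OF z0] by (simp add: Yv inner_diff_right c_def f_def)
  ultimately have Yz: "Y *v z = 0"
    by (rule nonpositive_form_kernel)
  have inner: "z \<bullet> ((M ** W + W ** transpose M) *v z) = 2 * ((transpose M *v z) \<bullet> (W *v z))"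
    if "transpose W = W" for W :: "real ^ 'n ^ 'n"
  proof -
    have "z \<bullet> (M *v (W *v z)) = (transpose M *v z) \<bullet> (W *v z)"
      by (metis dot_lmul_matrix transpose_matrix_vector)
    moreover have "z \<bullet> (W *v (transpose M *v z)) = (transpose M *v z) \<bullet> (W *v z)"
      using symmetric_matrix_inner[OF that, of z "transpose M *v z"] by (simp only: inner_commute)
    ultimately show ?thesis
      by (simp only: matrix_vector_mult_add_rdistrib inner_add_right matrix_vector_mul_assoc[symmetric])
  qed
  have "z \<bullet> ((M ** S + S ** transpose M) *v z) = - 2"
  proof -
    have "M ** S + S ** transpose M = - 2 *\<^sub>R mat 1" using lyap by (simp add: eq_neg_iff_add_eq_0)
    then have "(M ** S + S ** transpose M) *v z = - 2 *\<^sub>R z"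
      by (simp only: scaleR_matrix_vector_assoc[symmetric] matrix_vector_mul_lid)
    then show ?thesis using z by (simp add: dot_square_norm)
  qed
  then have "(transpose M *v z) \<bullet> (S *v z) = - 1" using inner[OF PD_symmetric[OF S]] by simp
  moreover have "(transpose M *v z) \<bullet> (X *v z) = 0" using inner[OF sym] X by simp
  moreover have "(transpose M *v z) \<bullet> (X *v z) = c * ((transpose M *v z) \<bullet> (S *v z))"
    using Yz by (simp add: Yv)
  ultimately have "c = 0" by simp
  with le[of y] show ?thesis by simp
qed

text \<open>The sign bound applies to \<open>X\<close> and to \<open>- X\<close>, so the quadratic
  form vanishes identically.\<close>

lemma lyapunov_kernel_trivial:
  fixes S M X :: "real ^ 'n ^ 'n"
  assumes S: "S \<in> PD" and lyap: "M ** S + S ** transpose M + 2 *\<^sub>R mat 1 = 0"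
    and sym: "transpose X = X" and X: "M ** X + X ** transpose M = 0"
  shows "X = 0"
proof -
  have neg: "(- X) *v y = - (X *v y)" for y by (simp add: matrix_vector_mult_def vec_eq_iff sum_negf)
  have "transpose (- X) = - X" using sym by (auto simp: transpose_def vec_eq_iff)
  moreover have "M ** (- X) + (- X) ** transpose M = - (M ** X + X ** transpose M)"
    by (simp add: matrix_matrix_mult_def vec_eq_iff sum_negf)
  ultimately have "y \<bullet> (- X *v y) \<le> 0" for y
    using X by (intro lyapunov_kernel_nonpositive[OF S lyap]) simp_all
  then have form: "y \<bullet> (X *v y) = 0" for y
    using lyapunov_kernel_nonpositive[OF S lyap sym X, of y] by (simp add: neg antisym)
  then have "X *v y = 0" for y
    using nonpositive_form_kernel[OF sym, of y] by simp
  then show ?thesis by (simp add: matrix_eq)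
qed

lemma trek_graph_sym: "(u, v) \<in> trek_graph E \<Longrightarrow> (v, u) \<in> trek_graph E"
  and trek_graph_refl: "(u, u) \<in> trek_graph E"
  by (auto simp: trek_graph_def is_ancestor_def)

lemma trek_graph_extend: "(p, v) \<in> trek_graph E \<Longrightarrow> (p, u) \<in> E \<Longrightarrow> (u, v) \<in> trek_graph E"
  by (auto simp: trek_graph_def is_ancestor_def intro: rtrancl_into_rtrancl)

lemma lyapunov_model_zero:
  fixes E :: "('n::finite \<times> 'n) set"
  assumes S: "S \<in> lyapunov_model E" and uv: "(u, v) \<notin> trek_graph E"
  shows "S $ u $ v = 0"
proof -
  obtain M where SPD: "S \<in> PD" and M: "M \<in> supported_matrices E"
    and lyap: "M ** S + S ** transpose M + 2 *\<^sub>R mat 1 = 0"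
    using S by (auto simp: lyapunov_model_def)
  define L where "L X = M ** X + X ** transpose M" for X :: "real ^ 'n ^ 'n"
  have L: "linear L"
    by (rule linearI) (auto simp: L_def matrix_matrix_mult_def vec_eq_iff algebra_simps sum.distrib sum_distrib_left)
  define T where "T = {X :: real ^ 'n ^ 'n. transpose X = X \<and> (\<forall>u v. (u, v) \<notin> trek_graph E \<longrightarrow> X $ u $ v = 0)}"
  have T: "subspace T"
    by (auto simp: T_def subspace_def transpose_def vec_eq_iff)
  have LT: "L ` T \<subseteq> T"
  proof
    fix Y assume "Y \<in> L ` T"
    then obtain X where X: "X \<in> T" "Y = L X" by auto
    then have sym: "transpose X = X" by (simp add: T_def)
    have "transpose Y = Y"
      using sym by (simp add: X(2) L_def transpose_def vec_eq_iff matrix_matrix_mult_def mult.commute add.commute)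
    moreover have "Y $ u $ v = 0" if "(u, v) \<notin> trek_graph E" for u v
    proof -
      \<comment> \<open>A nonzero product would give an edge from \<open>p\<close> to
        \<open>u\<close> and a trek between \<open>p\<close> and \<open>v\<close>, which extends to
        a trek between \<open>u\<close> and \<open>v\<close>.\<close>
      have 1: "M $ u $ p * X $ p $ v = 0" for p
        using M X(1) that trek_graph_extend[of p v E u] by (auto simp: supported_matrices_def T_def)
      have 2: "X $ u $ p * M $ v $ p = 0" for p
        using M X(1) that trek_graph_extend[of p u E v] trek_graph_sym[of v u E] trek_graph_sym[of u p E]
        by (auto simp: supported_matrices_def T_def)
      have "Y $ u $ v = (\<Sum>p\<in>UNIV. M $ u $ p * X $ p $ v) + (\<Sum>p\<in>UNIV. X $ u $ p * M $ v $ p)"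
        by (simp add: X(2) L_def matrix_matrix_mult_def transpose_def)
      also have "\<dots> = 0" unfolding 1 2 by simp
      finally show ?thesis .
    qed
    ultimately show "Y \<in> T" by (simp add: T_def)
  qed
  have inj: "inj_on L T"
  proof (rule inj_onI)
    fix X Y assume XY: "X \<in> T" "Y \<in> T" "L X = L Y"
    have "X - Y \<in> T" using XY(1,2) T by (simp add: subspace_diff)
    moreover have "L (X - Y) = 0" using XY(3) by (simp add: linear_diff[OF L])
    ultimately have "X - Y = 0"
      using lyapunov_kernel_trivial[OF SPD lyap, of "X - Y"] unfolding T_def L_def by blast
    then show "X = Y" by simp
  qed
  have spanT: "span T = T" using T by (simp add: span_eq_iff)
  have "dim (L ` T) = dim T"
    by (rule dim_image_eq[OF L]) (simp add: spanT inj)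
  then have "L ` T = T"
    using subspace_dim_equal[OF linear_subspace_image[OF L T] T LT] by simp
  moreover have "- 2 *\<^sub>R mat 1 \<in> T"
    using trek_graph_refl[of _ E] by (auto simp: T_def transpose_def vec_eq_iff mat_def)
  ultimately obtain S' where S': "S' \<in> T" "L S' = - 2 *\<^sub>R mat 1" by (metis imageE)
  have "L S = - 2 *\<^sub>R mat 1" using lyap by (simp add: L_def eq_neg_iff_add_eq_0)
  with S'(2) have "L (S - S') = 0" by (simp add: linear_diff[OF L])
  moreover have "transpose (S - S') = S - S'"
    using S'(1) PD_symmetric[OF SPD] by (auto simp: T_def transpose_def vec_eq_iff)
  ultimately have "S - S' = 0"
    using lyapunov_kernel_trivial[OF SPD lyap, of "S - S'"] unfolding L_def by blast
  with S'(1) uv show ?thesis by (simp add: T_def)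
qed

section \<open>Weakly coupled drifts with prescribed rates\<close>

lemma sum_weighted_bound:
  fixes f :: "'n::finite \<Rightarrow> real"
  assumes "\<And>p. 0 \<le> b p" "\<And>p. b p \<le> 1" "\<And>p. \<bar>f p\<bar> \<le> m"
  shows "\<bar>\<Sum>p\<in>UNIV. b p * f p\<bar> \<le> real CARD('n) * m"
proof -
  have "\<bar>\<Sum>p\<in>UNIV. b p * f p\<bar> \<le> (\<Sum>p\<in>UNIV. \<bar>b p * f p\<bar>)" by (rule sum_abs)
  also have "\<dots> \<le> (\<Sum>p\<in>(UNIV :: 'n set). m)"
  proof (rule sum_mono)
    fix p
    have "\<bar>b p * f p\<bar> \<le> 1 * \<bar>f p\<bar>"
      unfolding abs_mult using assms(1,2)[of p] by (intro mult_right_mono) auto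
    with assms(3)[of p] show "\<bar>b p * f p\<bar> \<le> m" by simp
  qed
  finally show ?thesis by simp
qed

text \<open>Supplies the extremal index for the maximum principle arguments below.\<close>

lemma argmax_pair:
  fixes f :: "'n::finite \<Rightarrow> 'n \<Rightarrow> real"
  obtains u v where "\<And>p q. f p q \<le> f u v"
proof -
  obtain z where "Max (case_prod f ` UNIV) = case_prod f z"
    using obtains_MAX[of "UNIV :: ('n \<times> 'n) set" "case_prod f"] by auto
  then have "case_prod f y \<le> case_prod f z" for y
    using Max_ge[of "case_prod f ` UNIV" "case_prod f y"] by simp
  from this[of "(_, _)"] show ?thesis
    using that[of "fst z" "snd z"] by (simp add: case_prod_beta)
qed

text \<open>Column \<open>p\<close> of the drift matrix \<open>\<epsilon> B - I\<close> is multiplied by the rate \<open>d p\<close>, where \<open>B\<close> is the transposed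
  adjacency matrix. All bounds are uniform in the rates, which later go to infinity outside of a path.\<close>

definition drift :: "('n::finite \<times> 'n) set \<Rightarrow> ('n \<Rightarrow> real) \<Rightarrow> real \<Rightarrow> real ^ 'n ^ 'n" where
  "drift E d \<epsilon> = (\<chi> u p. (\<epsilon> * of_bool ((p, u) \<in> E) - of_bool (u = p)) * d p)"

lemma drift_lyapunov_component:
  fixes X :: "real ^ 'n ^ 'n"
  shows "(drift E d \<epsilon> ** X + X ** transpose (drift E d \<epsilon>)) $ u $ v
    = \<epsilon> * ((\<Sum>p\<in>UNIV. of_bool ((p, u) \<in> E) * (d p * X $ p $ v)) + (\<Sum>p\<in>UNIV. of_bool ((p, v) \<in> E) * (d p * X $ u $ p)))
      - (d u + d v) * X $ u $ v"
proof -
  have row: "(\<Sum>p\<in>UNIV. drift E d \<epsilon> $ w $ p * f p)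
      = \<epsilon> * (\<Sum>p\<in>UNIV. of_bool ((p, w) \<in> E) * (d p * f p)) - d w * f w" for w and f :: "'n \<Rightarrow> real"
  proof -
    have "(\<Sum>p\<in>UNIV. drift E d \<epsilon> $ w $ p * f p)
        = (\<Sum>p\<in>UNIV. \<epsilon> * (of_bool ((p, w) \<in> E) * (d p * f p)) - (if p = w then d p * f p else 0))"
      by (intro sum.cong) (auto simp: drift_def algebra_simps)
    then show ?thesis
      by (simp only: sum_subtractf sum_distrib_left[symmetric] sum.delta finite UNIV_I if_True)
  qed
  have "(drift E d \<epsilon> ** X + X ** transpose (drift E d \<epsilon>)) $ u $ v
      = (\<Sum>p\<in>UNIV. drift E d \<epsilon> $ u $ p * X $ p $ v) + (\<Sum>p\<in>UNIV. drift E d \<epsilon> $ v $ p * X $ u $ p)"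
    by (simp add: matrix_matrix_mult_def transpose_def mult.commute)
  then show ?thesis unfolding row by (simp add: algebra_simps)
qed

text \<open>The choice of \<open>\<epsilon>\<close> serves two purposes. From
  \<open>\<epsilon> * n \<le> 1 / 16\<close>, the inflow contributes at most an eighth of the
  largest scaled entry, which drives the maximum principles. From
  \<open>8 * \<epsilon> * n = 1 / (2 * n)\<close>, the off-diagonal part of the covariance matrix is
  small enough for diagonal dominance.\<close>

locale scaled_drift =
  fixes E :: "('n::finite \<times> 'n) set" and d :: "'n \<Rightarrow> real" and n \<epsilon> :: real
  assumes loops: "\<And>i. (i, i) \<in> E" and d_pos: "\<And>u. d u > 0"
    and n_def: "n = real CARD('n)" and eps: "\<epsilon> = 1 / (16 * n\<^sup>2)"
begin

abbreviation M :: "real ^ 'n ^ 'n" where "M \<equiv> drift E d \<epsilon>"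

definition L :: "real ^ 'n ^ 'n \<Rightarrow> real ^ 'n ^ 'n" where "L X = M ** X + X ** transpose M"

text \<open>Separates production along edges, loops included, from the decay at rate
  \<open>d u + d v\<close>.\<close>

definition inflow :: "real ^ 'n ^ 'n \<Rightarrow> 'n \<Rightarrow> 'n \<Rightarrow> real" where
  "inflow X u v = (\<Sum>p\<in>UNIV. of_bool ((p, u) \<in> E) * (d p * X $ p $ v)) + (\<Sum>p\<in>UNIV. of_bool ((p, v) \<in> E) * (d p * X $ u $ p))"

lemma L_component: "L X $ u $ v = \<epsilon> * inflow X u v - (d u + d v) * X $ u $ v"
  unfolding L_def inflow_def by (rule drift_lyapunov_component)

lemma n_ge_1: "n \<ge> 1"
  using zero_less_card_finite[where 'a='n] unfolding n_def by linarith

lemma eps_pos: "\<epsilon> > 0"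
  using n_ge_1 by (simp add: eps)

lemma eps_n2: "\<epsilon> * n\<^sup>2 = 1 / 16"
  using n_ge_1 by (simp add: eps)

lemma eps_n: "\<epsilon> * n \<le> 1 / 16"
proof -
  have "\<epsilon> * n \<le> \<epsilon> * n\<^sup>2"
    using n_ge_1 eps_pos by (simp add: power2_eq_square mult_le_cancel_left1)
  then show ?thesis by (simp only: eps_n2)
qed

lemma eps_le_1: "\<epsilon> \<le> 1"
proof -
  have "\<epsilon> * 1 \<le> \<epsilon> * n" using n_ge_1 eps_pos by (intro mult_left_mono) auto
  then show ?thesis using eps_n by linarith
qed

lemma d_le_max: "d p * \<bar>y\<bar> \<le> max (d p) (d q) * \<bar>y\<bar>" "d q * \<bar>y\<bar> \<le> max (d p) (d q) * \<bar>y\<bar>"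
  by (auto intro!: mult_right_mono)

lemma inflow_bound:
  assumes "\<And>p q. max (d p) (d q) * \<bar>X $ p $ q\<bar> \<le> m"
  shows "\<bar>inflow X u v\<bar> \<le> 2 * n * m"
proof -
  have "\<bar>d p * X $ p $ q\<bar> \<le> m" "\<bar>d q * X $ p $ q\<bar> \<le> m" for p q
    using assms[of p q] d_le_max(1)[of p "X $ p $ q" q] d_le_max(2)[of q "X $ p $ q" p] d_pos[of p] d_pos[of q] by (simp_all add: abs_mult)
  then have "\<bar>\<Sum>p\<in>UNIV. of_bool ((p, u) \<in> E) * (d p * X $ p $ v)\<bar> \<le> n * m"
    "\<bar>\<Sum>p\<in>UNIV. of_bool ((p, v) \<in> E) * (d p * X $ u $ p)\<bar> \<le> n * m"
    unfolding n_def by (intro sum_weighted_bound; simp)+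
  then show ?thesis unfolding inflow_def by linarith
qed

lemma eps_inflow_bound:
  assumes "\<And>p q. max (d p) (d q) * \<bar>X $ p $ q\<bar> \<le> m"
  shows "\<bar>\<epsilon> * inflow X u v\<bar> \<le> 2 * (\<epsilon> * n) * m"
proof -
  have "\<bar>\<epsilon> * inflow X u v\<bar> \<le> \<epsilon> * (2 * n * m)"
    using inflow_bound[OF assms, of u v] eps_pos by (simp add: abs_mult mult_left_mono)
  then show ?thesis by (simp add: ac_simps)
qed

lemma max_le_sum: "max (d u) (d v) \<le> d u + d v"
  using d_pos[of u] d_pos[of v] by auto

text \<open>At the largest scaled entry, of absolute value \<open>m\<close>, decay takes away at
  least \<open>m\<close> while the inflow restores at most \<open>m / 8\<close>.\<close>

lemma L_kernel:
  assumes "L X = 0"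
  shows "X = 0"
proof -
  obtain u v where uv: "\<And>p q. max (d p) (d q) * \<bar>X $ p $ q\<bar> \<le> max (d u) (d v) * \<bar>X $ u $ v\<bar>"
    using argmax_pair[of "\<lambda>p q. max (d p) (d q) * \<bar>X $ p $ q\<bar>"] by blast
  define m where "m = max (d u) (d v) * \<bar>X $ u $ v\<bar>"
  have m0: "m \<ge> 0" using d_pos[of u] by (simp add: m_def)
  have "(d u + d v) * X $ u $ v = \<epsilon> * inflow X u v"
    using L_component[of X u v] assms by simp
  then have "(d u + d v) * \<bar>X $ u $ v\<bar> = \<bar>\<epsilon> * inflow X u v\<bar>"
    using d_pos[of u] d_pos[of v] by (metis abs_mult abs_of_pos add_pos_pos)
  moreover have "m \<le> (d u + d v) * \<bar>X $ u $ v\<bar>"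
    unfolding m_def by (intro mult_right_mono max_le_sum) simp
  moreover have "\<bar>\<epsilon> * inflow X u v\<bar> \<le> 2 * (\<epsilon> * n) * m"
    using uv by (intro eps_inflow_bound) (simp add: m_def)
  moreover have "2 * (\<epsilon> * n) * m \<le> 1 / 8 * m"
    using eps_n m0 by (intro mult_right_mono) auto
  ultimately have "m \<le> 0" using m0 by linarith
  then have "max (d p) (d q) * \<bar>X $ p $ q\<bar> \<le> 0" for p q
    using uv[of p q] by (simp add: m_def)
  moreover have "max (d p) (d q) > 0" for p q using d_pos[of p] by (simp add: less_max_iff_disj)
  ultimately have "X $ p $ q = 0" for p q
    by (metis abs_le_zero_iff mult_le_0_iff not_less)
  then show ?thesis by (simp add: vec_eq_iff)
qed

lemma linear_L: "linear L"
  by (rule linearI) (auto simp: L_def matrix_matrix_mult_def vec_eq_iff algebra_simps sum.distrib sum_distrib_left)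

section \<open>The covariance matrix of the scaled drift\<close>

definition \<Sigma> :: "real ^ 'n ^ 'n" where "\<Sigma> = (SOME X. L X = - 2 *\<^sub>R mat 1)"

lemma L_\<Sigma>: "L \<Sigma> = - 2 *\<^sub>R mat 1"
proof -
  have "inj L" using L_kernel linear_injective_0[OF linear_L] by blast
  then have "surj L" using linear_L by (simp add: linear_injective_imp_surjective)
  then have "\<exists>X. L X = - 2 *\<^sub>R mat 1" by (metis surjD)
  then show ?thesis unfolding \<Sigma>_def by (rule someI_ex)
qed

lemma \<Sigma>_equation: "(d u + d v) * \<Sigma> $ u $ v = 2 * of_bool (u = v) + \<epsilon> * inflow \<Sigma> u v"
  using L_component[of \<Sigma> u v] by (simp add: L_\<Sigma> mat_def split: if_splits)

lemma \<Sigma>_symmetric: "transpose \<Sigma> = \<Sigma>"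
proof -
  have "L (transpose \<Sigma>) = transpose (L \<Sigma>)"
    by (simp add: L_def transpose_def vec_eq_iff matrix_matrix_mult_def mult.commute add.commute)
  also have "\<dots> = L \<Sigma>" by (auto simp: L_\<Sigma> transpose_def vec_eq_iff mat_def)
  finally have "L (transpose \<Sigma> - \<Sigma>) = 0" by (simp add: linear_diff[OF linear_L])
  then show ?thesis using L_kernel[of "transpose \<Sigma> - \<Sigma>"] by simp
qed

text \<open>Minimum principle: at the smallest scaled entry \<open>m\<close>, if negative, the decay
  side is at most \<open>m\<close>, but the inflow is at least \<open>m / 8\<close> and the source
  term is nonnegative.\<close>

lemma \<Sigma>_nonneg: "0 \<le> \<Sigma> $ u $ v"
proof -
  obtain a b where ab: "\<And>p q. - (max (d p) (d q) * \<Sigma> $ p $ q) \<le> - (max (d a) (d b) * \<Sigma> $ a $ b)"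
    using argmax_pair[of "\<lambda>p q. - (max (d p) (d q) * \<Sigma> $ p $ q)"] by blast
  have dmax: "max (d p) (d q) > 0" for p q using d_pos[of p] by (simp add: less_max_iff_disj)
  have "\<Sigma> $ a $ b \<ge> 0"
  proof (rule ccontr)
    assume "\<not> \<Sigma> $ a $ b \<ge> 0"
    then have neg: "\<Sigma> $ a $ b < 0" by simp
    define m where "m = max (d a) (d b) * \<Sigma> $ a $ b"
    have m: "m < 0" using dmax[of a b] neg by (simp add: m_def mult_pos_neg)
    have lower: "d p * \<Sigma> $ p $ q \<ge> m" "d q * \<Sigma> $ p $ q \<ge> m" for p q
    proof -
      have "c * \<Sigma> $ p $ q \<ge> m" if "0 \<le> c" "c \<le> max (d p) (d q)" for c
      proof (cases "\<Sigma> $ p $ q \<ge> 0")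
        case True
        with that(1) have "0 \<le> c * \<Sigma> $ p $ q" by simp
        with m show ?thesis by linarith
      next
        case False
        then have "max (d p) (d q) * \<Sigma> $ p $ q \<le> c * \<Sigma> $ p $ q"
          using that(2) by (intro mult_right_mono_neg) auto
        with ab[of p q] show ?thesis by (simp add: m_def)
      qed
      then show "d p * \<Sigma> $ p $ q \<ge> m" "d q * \<Sigma> $ p $ q \<ge> m"
        using d_pos[of p] d_pos[of q] by (auto simp: less_imp_le)
    qed
    have weighted: "of_bool c * y \<ge> m" if "y \<ge> m" for c and y :: real
      using that m by (cases c) auto
    have "(\<Sum>p\<in>UNIV. of_bool ((p, a) \<in> E) * (d p * \<Sigma> $ p $ b)) \<ge> (\<Sum>p\<in>(UNIV :: 'n set). m)"
      "(\<Sum>p\<in>UNIV. of_bool ((p, b) \<in> E) * (d p * \<Sigma> $ a $ p)) \<ge> (\<Sum>p\<in>(UNIV :: 'n set). m)"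
      by (intro sum_mono weighted lower)+
    then have "inflow \<Sigma> a b \<ge> 2 * n * m" by (simp add: inflow_def n_def)
    then have "\<epsilon> * inflow \<Sigma> a b \<ge> \<epsilon> * (2 * n * m)"
      using eps_pos by simp
    moreover have "\<epsilon> * (2 * n * m) = 2 * (\<epsilon> * n) * m" by simp
    moreover have "2 * (\<epsilon> * n) * m \<ge> 1 / 8 * m"
      using eps_n m by (intro mult_right_mono_neg) auto
    moreover have "(d a + d b) * \<Sigma> $ a $ b \<le> m"
      unfolding m_def using neg by (intro mult_right_mono_neg max_le_sum) auto
    moreover have "0 \<le> 2 * (of_bool (a = b) :: real)" by simp
    ultimately show False using \<Sigma>_equation[of a b] m by linarith
  qed
  then have "0 \<le> max (d p) (d q) * \<Sigma> $ p $ q" for p q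
    using ab[of p q] dmax[of a b] by (smt (verit) mult_nonneg_nonneg)
  then show ?thesis using dmax[of u v] by (metis not_less zero_le_mult_iff)
qed

text \<open>The source is at most 2, so the largest scaled entry satisfies
  \<open>m \<le> 2 + m / 8\<close>; the constant 4 is a convenient rounding.\<close>

lemma \<Sigma>_bound: "max (d u) (d v) * \<Sigma> $ u $ v \<le> 4"
proof -
  obtain a b where ab: "\<And>p q. max (d p) (d q) * \<Sigma> $ p $ q \<le> max (d a) (d b) * \<Sigma> $ a $ b"
    using argmax_pair[of "\<lambda>p q. max (d p) (d q) * \<Sigma> $ p $ q"] by blast
  define m where "m = max (d a) (d b) * \<Sigma> $ a $ b"
  have m0: "m \<ge> 0" using d_pos[of a] \<Sigma>_nonneg[of a b] by (simp add: m_def le_max_iff_disj)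
  have "m \<le> (d a + d b) * \<Sigma> $ a $ b"
    unfolding m_def by (intro mult_right_mono max_le_sum \<Sigma>_nonneg)
  moreover have "\<bar>\<epsilon> * inflow \<Sigma> a b\<bar> \<le> 2 * (\<epsilon> * n) * m"
    using ab by (intro eps_inflow_bound) (simp add: m_def \<Sigma>_nonneg)
  moreover have "2 * (\<epsilon> * n) * m \<le> 1 / 8 * m"
    using eps_n m0 by (intro mult_right_mono) auto
  moreover have "2 * (of_bool (a = b) :: real) \<le> 2" by simp
  ultimately have "m \<le> 4" using \<Sigma>_equation[of a b] m0 by linarith
  then show ?thesis using ab[of u v] by (simp add: m_def)
qed

text \<open>Off the diagonal there is no source, so inserting the bound 4 into the inflow once more
  gains the factor \<open>2 * (\<epsilon> * n)\<close>.\<close>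

lemma \<Sigma>_offdiagonal:
  assumes "u \<noteq> v"
  shows "max (d u) (d v) * \<Sigma> $ u $ v \<le> 1 / (2 * n)"
proof -
  have "max (d u) (d v) * \<Sigma> $ u $ v \<le> (d u + d v) * \<Sigma> $ u $ v"
    by (intro mult_right_mono max_le_sum \<Sigma>_nonneg)
  moreover have "\<bar>\<epsilon> * inflow \<Sigma> u v\<bar> \<le> 2 * (\<epsilon> * n) * 4"
    using \<Sigma>_bound by (intro eps_inflow_bound) (simp add: \<Sigma>_nonneg)
  moreover have "2 * (\<epsilon> * n) * 4 = 1 / (2 * n)"
    using n_ge_1 by (simp add: eps power2_eq_square)
  ultimately show ?thesis using \<Sigma>_equation[of u v] assms by simp
qed

lemma inflow_\<Sigma>_nonneg: "0 \<le> inflow \<Sigma> u v"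
  unfolding inflow_def using d_pos \<Sigma>_nonneg
  by (intro add_nonneg_nonneg sum_nonneg mult_nonneg_nonneg) (auto simp: less_imp_le)

lemma \<Sigma>_diagonal: "1 \<le> d u * \<Sigma> $ u $ u"
proof -
  have "0 \<le> \<epsilon> * inflow \<Sigma> u u" using inflow_\<Sigma>_nonneg eps_pos by simp
  then show ?thesis using \<Sigma>_equation[of u u] by simp
qed

text \<open>Diagonal dominance in the weights \<open>q u = (x $ u)\<^sup>2 / d u\<close>: the
  diagonal contributes at least the sum of the weights, and the off-diagonal terms consume at most
  half of it.\<close>

lemma \<Sigma>_PD: "\<Sigma> \<in> PD"
proof -
  have "x \<bullet> (\<Sigma> *v x) > 0" if "x \<noteq> 0" for x
  proof -
    define q where "q u = (x $ u)\<^sup>2 / d u" for u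
    have q0: "q u \<ge> 0" for u using d_pos[of u] by (simp add: q_def)
    have entry: "\<Sigma> $ u $ v * (x $ u * x $ v) \<ge> of_bool (u = v) * q u - (q u + q v) / (4 * n)" for u v
    proof (cases "u = v")
      case True
      have "q v \<le> \<Sigma> $ v $ v * (x $ v)\<^sup>2"
        using \<Sigma>_diagonal[of v] d_pos[of v] mult_right_mono[of 1 "d v * \<Sigma> $ v $ v" "(x $ v)\<^sup>2"]
        by (simp add: q_def divide_le_eq ac_simps)
      moreover have "0 \<le> (q v + q v) / (4 * n)" using q0[of v] n_ge_1 by simp
      ultimately show ?thesis using True by (simp add: power2_eq_square)
    next
      case False
      let ?m = "max (d u) (d v)"
      have m: "?m > 0" using d_pos[of u] by (simp add: less_max_iff_disj)
      have "\<Sigma> $ u $ v * \<bar>x $ u * x $ v\<bar> \<le> (1 / (2 * n) / ?m) * \<bar>x $ u * x $ v\<bar>"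
      proof (rule mult_right_mono)
        show "\<Sigma> $ u $ v \<le> 1 / (2 * n) / ?m"
          using \<Sigma>_offdiagonal[OF False] by (simp only: pos_le_divide_eq[OF m] mult.commute)
      qed simp
      also have "\<dots> = (1 / (4 * n)) * (2 * \<bar>x $ u * x $ v\<bar> / ?m)" by simp
      also have "\<dots> \<le> (1 / (4 * n)) * (q u + q v)"
      proof (rule mult_left_mono)
        have "2 * \<bar>x $ u * x $ v\<bar> / ?m \<le> ((x $ u)\<^sup>2 + (x $ v)\<^sup>2) / ?m"
          using sum_squares_bound[of "\<bar>x $ u\<bar>" "\<bar>x $ v\<bar>"] m
          by (intro divide_right_mono) (auto simp: abs_mult)
        also have "\<dots> \<le> q u + q v"
          unfolding q_def add_divide_distrib using d_pos[of u] d_pos[of v]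
          by (intro add_mono divide_left_mono) auto
        finally show "2 * \<bar>x $ u * x $ v\<bar> / ?m \<le> q u + q v" .
      qed (use n_ge_1 in simp)
      finally have "\<bar>\<Sigma> $ u $ v * (x $ u * x $ v)\<bar> \<le> (q u + q v) / (4 * n)"
        by (simp add: abs_mult \<Sigma>_nonneg)
      with False show ?thesis by simp
    qed
    have "x \<bullet> (\<Sigma> *v x) = (\<Sum>u\<in>UNIV. \<Sum>v\<in>UNIV. \<Sigma> $ u $ v * (x $ u * x $ v))"
      by (simp add: inner_vec_def matrix_vector_component sum_distrib_left ac_simps)
    also have "\<dots> \<ge> (\<Sum>u\<in>UNIV. \<Sum>v\<in>UNIV. of_bool (u = v) * q u - (q u + q v) / (4 * n))"
      by (intro sum_mono entry)
    also have "(\<Sum>u\<in>UNIV. \<Sum>v\<in>UNIV. of_bool (u = v) * q u - (q u + q v) / (4 * n)) = (\<Sum>u\<in>UNIV. q u) / 2"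
    proof -
      have "(\<Sum>v\<in>UNIV. of_bool (u = v) * q u - (q u + q v) / (4 * n))
          = q u - q u / 4 - (\<Sum>v\<in>UNIV. q v) / (4 * n)" for u
      proof -
        have "(\<Sum>v\<in>UNIV. of_bool (u = v) * q u) = (\<Sum>v\<in>UNIV. if v = u then q v else 0)"
          by (intro sum.cong) auto
        moreover have "(\<Sum>v\<in>UNIV. (q u + q v) / (4 * n)) = q u / 4 + (\<Sum>v\<in>UNIV. q v) / (4 * n)"
          using n_ge_1 by (simp add: sum.distrib add_divide_distrib n_def flip: sum_divide_distrib)
        ultimately show ?thesis by (simp add: sum_subtractf)
      qed
      moreover have "(\<Sum>u\<in>UNIV. q u - q u / 4 - sum q UNIV / (4 * n))
          = sum q UNIV - sum q UNIV / 4 - n * (sum q UNIV / (4 * n))"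
        by (simp only: sum_subtractf sum_divide_distrib[symmetric] sum_constant n_def times_divide_eq_right)
      ultimately show ?thesis using n_ge_1 by simp
    qed
    finally have "(\<Sum>u\<in>UNIV. q u) / 2 \<le> x \<bullet> (\<Sigma> *v x)" .
    moreover obtain w where "x $ w \<noteq> 0" using \<open>x \<noteq> 0\<close> by (auto simp: vec_eq_iff)
    then have "q w > 0" using d_pos[of w] by (simp add: q_def)
    then have "(\<Sum>u\<in>UNIV. q u) > 0" using q0 by (intro sum_pos2[of _ w]) auto
    ultimately show ?thesis by simp
  qed
  then show ?thesis using \<Sigma>_symmetric by (simp add: PD_def)
qed

text \<open>A Gershgorin argument for the eigenvector rescaled by the rates: at its largest
  component \<open>u\<close>, the number \<open>z / d u\<close> lies within \<open>1 / 16\<close> of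
  \<open>- 1\<close>.\<close>

lemma stable_drift: "stable M"
  unfolding stable_def
proof (intro allI impI)
  fix z assume "eigenvalue (map_matrix complex_of_real M) z"
  then obtain v where v: "v \<noteq> 0" "map_matrix complex_of_real M *v v = z *s v"
    by (auto simp: eigenvalue_def)
  define w where "w p = of_real (d p) * v $ p" for p
  define B where "B u = (\<Sum>p\<in>UNIV. of_bool ((p, u) \<in> E) * w p)" for u
  have eq: "of_real \<epsilon> * B u - w u = z * v $ u" for u
  proof -
    have "z * v $ u = (\<Sum>p\<in>UNIV. of_real (M $ u $ p) * v $ p)"
      using v(2) by (simp add: vec_eq_iff matrix_vector_mult_def map_matrix_def)
    also have "\<dots> = (\<Sum>p\<in>UNIV. of_real \<epsilon> * (of_bool ((p, u) \<in> E) * w p) - (if p = u then w p else 0))"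
      by (intro sum.cong) (auto simp: drift_def w_def algebra_simps)
    finally show ?thesis
      by (simp only: sum_subtractf sum_distrib_left[symmetric] sum.delta finite UNIV_I if_True B_def)
  qed
  obtain u where u: "\<And>p. norm (w p) \<le> norm (w u)"
    using argmax_pair[of "\<lambda>p _. norm (w p)"] by metis
  have "w u \<noteq> 0"
  proof
    assume "w u = 0"
    then have w0: "w p = 0" for p using u[of p] by simp
    have "v $ p = 0" for p using w0[of p] d_pos[of p] by (simp add: w_def)
    then show False using v(1) by (simp add: vec_eq_iff)
  qed
  have "norm (B u) \<le> (\<Sum>p\<in>(UNIV :: 'n set). norm (w u))"
    unfolding B_def by (rule order_trans[OF norm_sum]) (intro sum_mono, use u in \<open>auto simp: norm_mult\<close>)
  then have B: "norm (B u) \<le> n * norm (w u)" by (simp add: n_def)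
  have "(z / of_real (d u) + 1) * w u = of_real \<epsilon> * B u"
    using eq[of u] d_pos[of u] by (simp add: w_def field_simps)
  then have "norm (z / of_real (d u) + 1) * norm (w u) = \<epsilon> * norm (B u)"
    using eps_pos by (metis abs_of_pos norm_mult norm_of_real)
  also have "\<dots> \<le> \<epsilon> * (n * norm (w u))" using B eps_pos by simp
  also have "\<dots> \<le> (1 / 16) * norm (w u)"
    using mult_right_mono[OF eps_n, of "norm (w u)"] by (simp add: mult.assoc)
  finally have "norm (z / of_real (d u) + 1) \<le> 1 / 16" using \<open>w u \<noteq> 0\<close> by simp
  then have "Re (z / of_real (d u) + 1) \<le> 1 / 16" using complex_Re_le_cmod order_trans by blast
  then have "Re z / d u + 1 \<le> 1 / 16"
    by (simp only: plus_complex.sel one_complex.sel Re_divide_of_real)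
  then have "Re z / d u < 0" by linarith
  then show "Re z < 0" using d_pos[of u] by (simp add: divide_less_0_iff)
qed

lemma \<Sigma>_in_model: "\<Sigma> \<in> lyapunov_model E"
proof -
  have "M \<in> supported_matrices E"
    using loops by (auto simp: supported_matrices_def drift_def)
  moreover have "M ** \<Sigma> + \<Sigma> ** transpose M + 2 *\<^sub>R mat 1 = 0"
    using L_\<Sigma> by (simp add: L_def)
  ultimately show ?thesis
    using \<Sigma>_PD stable_drift unfolding lyapunov_model_def by blast
qed

text \<open>All terms of the inflow are nonnegative, so the one from \<open>x\<close> alone gives a
  lower bound. It carries the factor \<open>d x\<close>, which equals the maximum on the right
  because \<open>d s \<le> d x\<close>; the halving comes from
  \<open>d y + d s \<le> 2 * max (d y) (d s)\<close>.\<close>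

lemma \<Sigma>_edge:
  assumes xy: "(x, y) \<in> E" and ds: "d s \<le> d x"
  shows "max (d y) (d s) * \<Sigma> $ y $ s \<ge> \<epsilon> / 2 * (max (d x) (d s) * \<Sigma> $ x $ s)"
proof -
  have nonneg: "0 \<le> of_bool b * (d p * \<Sigma> $ r $ t)" for b p r t
    using d_pos[of p] \<Sigma>_nonneg[of r t] by simp
  have "d x * \<Sigma> $ x $ s = of_bool ((x, y) \<in> E) * (d x * \<Sigma> $ x $ s)" using xy by simp
  also have "\<dots> \<le> (\<Sum>p\<in>UNIV. of_bool ((p, y) \<in> E) * (d p * \<Sigma> $ p $ s))"
    by (rule member_le_sum) (auto simp: nonneg)
  also have "\<dots> \<le> inflow \<Sigma> y s"
    unfolding inflow_def by (simp only: le_add_same_cancel1) (intro sum_nonneg nonneg)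
  finally have "\<epsilon> * (d x * \<Sigma> $ x $ s) \<le> \<epsilon> * inflow \<Sigma> y s" using eps_pos by simp
  also have "\<dots> \<le> (d y + d s) * \<Sigma> $ y $ s" using \<Sigma>_equation[of y s] by simp
  also have "\<dots> \<le> (2 * max (d y) (d s)) * \<Sigma> $ y $ s"
    by (intro mult_right_mono \<Sigma>_nonneg) auto
  finally show ?thesis using ds by (simp add: max_absorb1)
qed

text \<open>The edge bound needs the moving endpoint to have the larger rate, so the induction walks down the two sides
  of a trek always moving the endpoint of larger rate.\<close>

lemma \<Sigma>_trek_bound:
  assumes min: "\<And>w. d u \<le> d w" "\<And>w. d v \<le> d w"
    and "(x, u) \<in> E ^^ p" "(y, v) \<in> E ^^ q"
  shows "max (d u) (d v) * \<Sigma> $ u $ v \<ge> (\<epsilon> / 2) ^ (p + q) * (max (d x) (d y) * \<Sigma> $ x $ y)"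
  using assms(3,4)
proof (induction "p + q" arbitrary: p q x y)
  case 0
  then show ?case by simp
next
  case (Suc k)
  have sym: "\<Sigma> $ a $ b = \<Sigma> $ b $ a" for a b
    using symmetric_component[OF \<Sigma>_symmetric] .
  \<comment> \<open>An endpoint of larger rate can always be moved: one that has arrived at
    \<open>u\<close> or \<open>v\<close> has minimal rate, so it can only tie with the other, which
    may then move instead.\<close>
  consider "d y \<le> d x" "p \<noteq> 0" | "d x \<le> d y" "q \<noteq> 0"
  proof (cases "d y \<le> d x")
    case True
    show thesis
    proof (cases "p = 0")
      case True
      then have "x = u" using Suc.prems(1) by simp
      then have "d x \<le> d y" using min(1) by simp
      moreover have "q \<noteq> 0" using Suc.hyps(2) True by simp
      ultimately show thesis using that(2) by blast
    qed (use that(1) True in blast)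
  next
    case False
    have "q \<noteq> 0"
    proof
      assume "q = 0"
      then have "y = v" using Suc.prems(2) by simp
      with False min(2)[of x] show False by simp
    qed
    then show thesis using that(2) False by simp
  qed
  then show ?case
  proof cases
    case 1
    then obtain p' where p': "p = Suc p'" by (cases p) auto
    obtain x' where x': "(x, x') \<in> E" "(x', u) \<in> E ^^ p'"
      using relpow_Suc_D2[OF Suc.prems(1)[unfolded p']] by blast
    have "max (d u) (d v) * \<Sigma> $ u $ v \<ge> (\<epsilon> / 2) ^ (p' + q) * (max (d x') (d y) * \<Sigma> $ x' $ y)"
      using Suc.hyps(1)[of p' q x' y] Suc.hyps(2) x'(2) Suc.prems(2) by (simp add: p')
    moreover have "(\<epsilon> / 2) ^ (p' + q) * (max (d x') (d y) * \<Sigma> $ x' $ y)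
        \<ge> (\<epsilon> / 2) ^ (p' + q) * (\<epsilon> / 2 * (max (d x) (d y) * \<Sigma> $ x $ y))"
      using eps_pos by (intro mult_left_mono \<Sigma>_edge[OF x'(1) 1(1)]) auto
    ultimately show ?thesis by (simp add: p' ac_simps)
  next
    case 2
    then obtain q' where q': "q = Suc q'" by (cases q) auto
    obtain y' where y': "(y, y') \<in> E" "(y', v) \<in> E ^^ q'"
      using relpow_Suc_D2[OF Suc.prems(2)[unfolded q']] by blast
    have "max (d u) (d v) * \<Sigma> $ u $ v \<ge> (\<epsilon> / 2) ^ (p + q') * (max (d x) (d y') * \<Sigma> $ x $ y')"
      using Suc.hyps(1)[of p q' x y'] Suc.hyps(2) y'(2) Suc.prems(1) by (simp add: q')
    moreover have "max (d y') (d x) * \<Sigma> $ y' $ x \<ge> \<epsilon> / 2 * (max (d y) (d x) * \<Sigma> $ y $ x)"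
      by (rule \<Sigma>_edge[OF y'(1) 2(1)])
    then have "max (d x) (d y') * \<Sigma> $ x $ y' \<ge> \<epsilon> / 2 * (max (d x) (d y) * \<Sigma> $ x $ y)"
      by (simp add: sym[of x] max.commute)
    then have "(\<epsilon> / 2) ^ (p + q') * (max (d x) (d y') * \<Sigma> $ x $ y')
        \<ge> (\<epsilon> / 2) ^ (p + q') * (\<epsilon> / 2 * (max (d x) (d y) * \<Sigma> $ x $ y))"
      using eps_pos by (intro mult_left_mono) auto
    ultimately show ?thesis by (simp add: q' ac_simps)
  qed
qed

end

section \<open>Chordless walks and back substitution\<close>

text \<open>Indexing by numbers and permitting repetitions turns shortcuts into reindexings; minimal
  length takes over the role of distinctness.\<close>

definition walk :: "('n \<times> 'n) set \<Rightarrow> 'n set \<Rightarrow> 'n \<Rightarrow> 'n \<Rightarrow> nat \<Rightarrow> (nat \<Rightarrow> 'n) \<Rightarrow> bool" where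
  "walk H W i j m v \<longleftrightarrow> v 0 = i \<and> v m = j \<and> (\<forall>t<m. (v t, v (Suc t)) \<in> H) \<and> (\<forall>t\<le>m. v t \<in> W)"

lemma walk_of_path:
  assumes p: "is_path H i p j" and W: "set p \<subseteq> W"
  shows "walk H W i j (length p - 1) (\<lambda>t. p ! t)"
  using assms
  by (auto simp: walk_def is_path_def hd_conv_nth last_conv_nth successively_conv_nth subset_iff)
    (metis Suc_pred length_greater_0_conv less_Suc_eq_le nth_mem)

lemma minimal_walk:
  assumes "walk H W i j m v"
  obtains m v where "walk H W i j m v" "\<And>m' v'. walk H W i j m' v' \<Longrightarrow> m \<le> m'"
proof -
  define m0 where "m0 = (LEAST m. \<exists>v. walk H W i j m v)"
  have "\<exists>v. walk H W i j m0 v"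
    unfolding m0_def by (rule LeastI_ex) (use assms in blast)
  moreover have "m0 \<le> m'" if "walk H W i j m' v'" for m' v'
    unfolding m0_def by (rule Least_le) (use that in blast)
  ultimately show ?thesis using that by blast
qed

lemma minimal_walk_chordless:
  assumes w: "walk H W i j m v" and min: "\<And>m' v'. walk H W i j m' v' \<Longrightarrow> m \<le> m'"
    and st: "s < t" "t \<le> m" and e: "(v s, v t) \<in> H"
  shows "t = Suc s"
proof -
  define k where "k = t - s - 1"
  have t: "t = s + k + 1" using st(1) by (simp add: k_def)
  define v' where "v' r = (if r \<le> s then v r else v (r + k))" for r
  have "walk H W i j (m - k) v'"
    unfolding walk_def
  proof (intro conjI allI impI)
    show "v' 0 = i" using w by (simp add: v'_def walk_def)
    show "v' (m - k) = j" using w st(2) t by (auto simp: v'_def walk_def)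
    show "v' r \<in> W" if "r \<le> m - k" for r
      using w st(2) t that by (auto simp: v'_def walk_def)
    fix r assume r: "r < m - k"
    consider "r < s" | "r = s" | "r > s" by linarith
    then show "(v' r, v' (Suc r)) \<in> H"
    proof cases
      case 1 then show ?thesis using w st t by (simp add: v'_def walk_def)
    next
      case 2 then show ?thesis using e t by (simp add: v'_def)
    next
      case 3 then show ?thesis using w r by (simp add: v'_def walk_def)
    qed
  qed
  from min[OF this] st(2) t have "k = 0" by simp
  then show ?thesis using t by simp
qed

text \<open>The trek graph is reflexive, so the absence of chords does not exclude a repetition in
  consecutive positions; it has to be cut out separately.\<close>

lemma minimal_walk_Suc_distinct:
  assumes w: "walk H W i j m v" and min: "\<And>m' v'. walk H W i j m' v' \<Longrightarrow> m \<le> m'" and s: "s < m"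
  shows "v s \<noteq> v (Suc s)"
proof
  assume eq: "v s = v (Suc s)"
  define v' where "v' r = (if r \<le> s then v r else v (Suc r))" for r
  have "walk H W i j (m - 1) v'"
    unfolding walk_def
  proof (intro conjI allI impI)
    show "v' 0 = i" using w by (simp add: v'_def walk_def)
    show "v' (m - 1) = j"
      using w s eq by (cases "s = m - 1") (auto simp: v'_def walk_def)
    show "v' r \<in> W" if "r \<le> m - 1" for r
      using w s that by (auto simp: v'_def walk_def)
    fix r assume r: "r < m - 1"
    consider "r < s" | "r = s" | "r > s" by linarith
    then show "(v' r, v' (Suc r)) \<in> H"
    proof cases
      case 1 then show ?thesis using w s by (simp add: v'_def walk_def)
    next
      case 2
      have "(v (Suc s), v (Suc (Suc s))) \<in> H" using w r 2 by (simp add: walk_def)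
      then show ?thesis using 2 eq by (simp add: v'_def)
    next
      case 3 then show ?thesis using w r by (simp add: v'_def walk_def)
    qed
  qed
  from min[OF this] s show False by simp
qed

lemma trek_relpow:
  assumes "(u, v) \<in> trek_graph E"
  obtains a p q where "(a, u) \<in> E ^^ p" "(a, v) \<in> E ^^ q"
  using assms by (auto simp: trek_graph_def is_ancestor_def dest!: rtrancl_imp_relpow)

text \<open>The bound depends on the graph alone, so it can be fixed before the rates: the threshold
  for \<open>R\<close> involves \<open>N\<close>.\<close>

lemma trek_length_bound:
  fixes E :: "('n::finite \<times> 'n) set"
  obtains N where "\<And>u v. (u, v) \<in> trek_graph E \<Longrightarrow> \<exists>a p q. (a, u) \<in> E ^^ p \<and> (a, v) \<in> E ^^ q \<and> p + q \<le> N"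
proof -
  define P where "P u v k \<longleftrightarrow> (\<exists>a p q. (a, u) \<in> E ^^ p \<and> (a, v) \<in> E ^^ q \<and> p + q = k)" for u v k
  define f where "f z = (SOME k. P (fst z) (snd z) k)" for z
  have "\<exists>a p q. (a, u) \<in> E ^^ p \<and> (a, v) \<in> E ^^ q \<and> p + q \<le> Max (range f)" if uv: "(u, v) \<in> trek_graph E" for u v
  proof -
    have "\<exists>k. P u v k" using trek_relpow[OF uv] unfolding P_def by metis
    then have "P u v (f (u, v))" unfolding f_def fst_conv snd_conv by (rule someI_ex)
    moreover have "f (u, v) \<le> Max (range f)" by simp
    ultimately show ?thesis unfolding P_def by fastforce
  qed
  then show ?thesis using that by blast
qed

context scaled_drift
begin

text \<open>The trek may pass through fast nodes. It starts from the scaled variance of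
  \<open>a\<close>, which is at least 1 whatever the rate, so the bound is independent of the
  rates.\<close>

lemma \<Sigma>_adjacent_bound:
  assumes d_ge: "\<And>w. 1 \<le> d w" and uv: "d u = 1" "d v = 1"
    and trek: "(a, u) \<in> E ^^ p" "(a, v) \<in> E ^^ q" "p + q \<le> N"
  shows "(\<epsilon> / 2) ^ N \<le> \<Sigma> $ u $ v"
proof -
  have "(\<epsilon> / 2) ^ N \<le> (\<epsilon> / 2) ^ (p + q) * 1"
    using trek(3) eps_pos eps_le_1 by (simp add: power_decreasing)
  also have "\<dots> \<le> (\<epsilon> / 2) ^ (p + q) * (max (d a) (d a) * \<Sigma> $ a $ a)"
    using \<Sigma>_diagonal[of a] eps_pos by (intro mult_left_mono) auto
  also have "\<dots> \<le> max (d u) (d v) * \<Sigma> $ u $ v"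
    by (rule \<Sigma>_trek_bound[OF _ _ trek(1,2)]) (use d_ge uv in auto)
  finally show ?thesis using uv by simp
qed

text \<open>The rates are \<open>R\<close> on \<open>K\<close> outside of the walk and \<open>1\<close> elsewhere. For large \<open>R\<close> the fast coordinates
  decouple from the walk, on which \<open>\<Sigma>\<close> is tridiagonal because the walk has no chords. Back substitution
  along the walk therefore shows that a vector in the kernel is small on the whole walk.\<close>

lemma kernel_vector_vanishes:
  assumes walk: "walk (trek_graph E) (insert i (insert j K)) i j m v"
    and min: "\<And>m' v'. walk (trek_graph E) (insert i (insert j K)) i j m' v' \<Longrightarrow> m \<le> m'"
    and K: "i \<noteq> j" "j \<notin> K"
    and d: "\<And>w. d w = (if w \<in> K - v ` {..m} then R else 1)" and R: "1 \<le> R"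
    and N: "\<And>u v. (u, v) \<in> trek_graph E \<Longrightarrow> \<exists>a p q. (a, u) \<in> E ^^ p \<and> (a, v) \<in> E ^^ q \<and> p + q \<le> N"
    and R_large: "32 * n\<^sup>2 * (9 / (\<epsilon> / 2) ^ N) ^ m < R"
    and x_supp: "\<And>u. u \<notin> insert i K \<Longrightarrow> x $ u = 0"
    and x_ker: "\<And>k. k \<in> insert j K \<Longrightarrow> (\<Sigma> *v x) $ k = 0"
  shows "x $ i = 0"
proof (rule ccontr)
  assume xi: "x $ i \<noteq> 0"
  define F where "F = K - v ` {..m}"
  define c where "c = (\<epsilon> / 2) ^ N"
  have c0: "c > 0" using eps_pos by (simp add: c_def)
  have c1: "c \<le> 1" unfolding c_def using eps_pos eps_le_1 by (intro power_le_one) auto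
  have dF: "d w = R" if "w \<in> F" for w using that d by (simp add: F_def)
  have d1: "d w = 1" if "w \<notin> F" for w using that d by (auto simp: F_def)
  have d_ge: "1 \<le> d w" for w using d[of w] R by auto
  have vF: "v t \<notin> F" if "t \<le> m" for t using that by (auto simp: F_def)
  have sym: "\<Sigma> $ a $ b = \<Sigma> $ b $ a" for a b using symmetric_component[OF \<Sigma>_symmetric] .
  have v0: "v 0 = i" and vm: "v m = j" using walk by (auto simp: walk_def)
  have adj: "c \<le> \<Sigma> $ v t $ v (Suc t)" if "t < m" for t
  proof -
    have "(v t, v (Suc t)) \<in> trek_graph E" using walk that by (simp add: walk_def)
    with N obtain a p q where "(a, v t) \<in> E ^^ p" "(a, v (Suc t)) \<in> E ^^ q" "p + q \<le> N" by blast
    then show ?thesis unfolding c_def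
      using that vF[of t] vF[of "Suc t"] by (intro \<Sigma>_adjacent_bound[OF d_ge] d1) auto
  qed
  have chord: "\<Sigma> $ v s $ v t = 0" if "s \<le> m" "t \<le> m" "s \<noteq> t" "Suc s \<noteq> t" "Suc t \<noteq> s" for s t
  proof (rule ccontr)
    assume "\<Sigma> $ v s $ v t \<noteq> 0"
    then have edge: "(v s, v t) \<in> trek_graph E" using lyapunov_model_zero[OF \<Sigma>_in_model] by blast
    then have e: "(v t, v s) \<in> trek_graph E" by (rule trek_graph_sym)
    show False
    proof (cases "s < t")
      case True
      from minimal_walk_chordless[OF walk min True that(2) edge] that(4) show False by simp
    next
      case False
      with that(3) have "t < s" by simp
      from minimal_walk_chordless[OF walk min this that(1) e] that(5) show False by simp
    qed
  qed
  have x_zero: "x $ w = 0" if "w \<notin> F" "w \<notin> v ` {..<m}" for w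
  proof (cases "w = j")
    case True then show ?thesis using K by (intro x_supp) auto
  next
    case False
    have "w \<notin> v ` {..m}" using that(2) vm False by (auto simp: le_less)
    then show ?thesis using that(1) v0 by (intro x_supp) (auto simp: F_def)
  qed
  \<comment> \<open>The contradiction will be \<open>A < A\<close>: every entry of \<open>x\<close>
    on the walk is bounded by a small multiple of the largest one.\<close>
  define A where "A = Max ((\<lambda>t. \<bar>x $ v t\<bar>) ` {..m})"
  have A: "\<bar>x $ v t\<bar> \<le> A" if "t \<le> m" for t unfolding A_def using that by (intro Max_ge) auto
  have A0: "A > 0" using A[of 0] v0 xi by simp
  have bound4: "\<Sigma> $ u $ w \<le> 4" for u w
  proof -
    have "\<Sigma> $ u $ w \<le> max (d u) (d w) * \<Sigma> $ u $ w"
      using mult_right_mono[of 1 "max (d u) (d w)" "\<Sigma> $ u $ w"] d_ge[of u] \<Sigma>_nonneg[of u w] by simp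
    with \<Sigma>_bound[of u w] show ?thesis by simp
  qed
  have boundF: "R * \<Sigma> $ u $ k \<le> 4" if "k \<in> F" for u k
    using \<Sigma>_bound[of u k] d[of u] R that by (auto simp: dF max_def split: if_splits)
  \<comment> \<open>Take the kernel equation at the fast node \<open>l\<close> with the largest
    entry \<open>B\<close>, multiplied by \<open>R\<close>. The diagonal coefficient is at least 1,
    the other fast nodes contribute at most \<open>B / 2\<close> in total and the walk at most
    \<open>4 * n * A\<close>.\<close>
  have xF: "\<bar>x $ k\<bar> \<le> 8 * n * A" if "k \<in> F" for k
  proof -
    define B where "B = Max ((\<lambda>k. \<bar>x $ k\<bar>) ` F)"
    have B: "\<bar>x $ k\<bar> \<le> B" if "k \<in> F" for k unfolding B_def using that by (intro Max_ge) auto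
    obtain l where l: "l \<in> F" "B = \<bar>x $ l\<bar>"
      using obtains_MAX[of F "\<lambda>k. \<bar>x $ k\<bar>"] \<open>k \<in> F\<close> unfolding B_def by (metis empty_iff finite)
    have "(\<Sigma> *v x) $ l = 0" using l(1) by (intro x_ker) (simp add: F_def)
    then have "\<Sigma> $ l $ l * x $ l = - (\<Sum>w\<in>UNIV - {l}. \<Sigma> $ l $ w * x $ w)"
      unfolding matrix_vector_component by (subst (asm) sum.remove[of _ l]) auto
    then have "\<bar>\<Sigma> $ l $ l * x $ l\<bar> = \<bar>\<Sum>w\<in>UNIV - {l}. \<Sigma> $ l $ w * x $ w\<bar>"
      by (simp only: abs_minus_cancel)
    then have "(R * \<Sigma> $ l $ l) * \<bar>x $ l\<bar> = R * \<bar>\<Sum>w\<in>UNIV - {l}. \<Sigma> $ l $ w * x $ w\<bar>"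
      by (simp only: abs_mult abs_of_nonneg[OF \<Sigma>_nonneg] mult.assoc)
    also have "\<dots> \<le> R * (\<Sum>w\<in>UNIV - {l}. \<bar>\<Sigma> $ l $ w * x $ w\<bar>)"
      using R by (intro mult_left_mono sum_abs) auto
    also have "\<dots> = (\<Sum>w\<in>UNIV - {l}. (R * \<Sigma> $ l $ w) * \<bar>x $ w\<bar>)"
      by (simp add: sum_distrib_left abs_mult \<Sigma>_nonneg mult.assoc)
    also have "\<dots> \<le> (\<Sum>w\<in>UNIV - {l}. B / (2 * n) + 4 * A)"
    proof (rule sum_mono)
      fix w assume w: "w \<in> UNIV - {l}"
      consider "w \<in> F" | t where "w = v t" "t < m" "w \<notin> F" | "x $ w = 0" using x_zero[of w] by auto
      then show "(R * \<Sigma> $ l $ w) * \<bar>x $ w\<bar> \<le> B / (2 * n) + 4 * A"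
      proof cases
        case 1
        have "R * \<Sigma> $ l $ w \<le> 1 / (2 * n)"
          using \<Sigma>_offdiagonal[of l w] w dF[OF l(1)] dF[OF 1] by auto
        then have "(R * \<Sigma> $ l $ w) * \<bar>x $ w\<bar> \<le> 1 / (2 * n) * B"
          using B[OF 1] n_ge_1 by (intro mult_mono) auto
        then show ?thesis using A0 by simp
      next
        case 2
        have "(R * \<Sigma> $ l $ w) * \<bar>x $ w\<bar> \<le> 4 * A"
          using boundF[OF l(1), of w] A[of t] 2 by (intro mult_mono) (auto simp: sym[of l])
        moreover have "0 \<le> B / (2 * n)" using l(2) n_ge_1 by simp
        ultimately show ?thesis by simp
      next
        case 3
        then show ?thesis using l(2) n_ge_1 A0 by simp
      qed
    qed
    also have "\<dots> \<le> (\<Sum>w\<in>(UNIV :: 'n set). B / (2 * n) + 4 * A)"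
      using l(2) n_ge_1 A0 by (intro sum_mono2) auto
    also have "\<dots> = B / 2 + 4 * n * A"
      using n_ge_1 by (simp add: n_def[symmetric] field_simps)
    finally have "(R * \<Sigma> $ l $ l) * B \<le> B / 2 + 4 * n * A" using l(2) by simp
    moreover have "1 * B \<le> (R * \<Sigma> $ l $ l) * B"
      using \<Sigma>_diagonal[of l] dF[OF l(1)] l(2) by (intro mult_right_mono) auto
    ultimately have "B \<le> 8 * n * A" by simp
    with B[OF that] show ?thesis by simp
  qed
  \<comment> \<open>Bounds the total fast contribution to a row of the walk: at most
    \<open>n\<close> entries of size \<open>8 * n * A\<close>, with coefficients at most
    \<open>4 / R\<close>.\<close>
  define D where "D = 32 * n\<^sup>2 * A / R"
  have D0: "D > 0" using A0 n_ge_1 R by (simp add: D_def)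
  \<comment> \<open>Here \<open>r\<close> counts steps back from \<open>j\<close>, where
    \<open>x\<close> vanishes. On the walk, row \<open>v t\<close> involves only
    \<open>v (t - 1)\<close>, \<open>v t\<close> and \<open>v (Suc t)\<close>; it is solved for the
    first of these, whose coefficient is at least \<open>c\<close>. With the two later entries
    bounded by \<open>H\<close>, this gives \<open>(D + 8 * H) / c \<le> 9 / c * H\<close>.\<close>
  have bound_back: "\<forall>t\<le>m. m - t \<le> r \<longrightarrow> \<bar>x $ v t\<bar> \<le> (9 / c) ^ r * D" if "r \<le> m" for r
    using that
  proof (induction r)
    case 0
    have "x $ v m = 0" unfolding vm using K by (intro x_supp) auto
    then show ?case using D0 by simp
  next
    case (Suc r)
    define H where "H = (9 / c) ^ r * D"
    have "1 \<le> (9 / c) ^ r" using c0 c1 by (intro one_le_power) (simp add: field_simps)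
    then have DH: "D \<le> H" using mult_right_mono[of 1 "(9 / c) ^ r" D] D0 by (simp add: H_def)
    have late: "\<bar>x $ v s\<bar> \<le> H" if "s \<le> m" "m - s \<le> r" for s
      using Suc that by (simp add: H_def)
    define t where "t = m - r"
    have t: "0 < t" "t \<le> m" "m - t = r" using Suc.prems by (auto simp: t_def)
    define q where "q = v (t - 1)"
    have q_ne: "q \<noteq> v t" using minimal_walk_Suc_distinct[OF walk min, where s = "t - 1"] t by (simp add: q_def)
    \<comment> \<open>The kernel equation is available at every node except \<open>i\<close>, and a
      minimal walk does not return to \<open>i\<close>.\<close>
    have "v t \<in> insert j K"
    proof -
      have "v t \<noteq> i"
      proof (cases "t = 1")
        case True then show ?thesis using q_ne v0 by (simp add: q_def)
      next
        case False
        show ?thesis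
        proof
          assume "v t = i"
          then have "(v 0, v t) \<in> trek_graph E" using v0 trek_graph_refl[of i E] by simp
          from minimal_walk_chordless[OF walk min t(1,2) this] False show False by simp
        qed
      qed
      moreover have "v t \<in> insert i (insert j K)" using walk t by (simp add: walk_def)
      ultimately show ?thesis by simp
    qed
    then have "(\<Sigma> *v x) $ v t = 0" by (rule x_ker)
    then have "\<Sigma> $ v t $ q * x $ q = - (\<Sum>w\<in>UNIV - {q}. \<Sigma> $ v t $ w * x $ w)"
      unfolding matrix_vector_component by (subst (asm) sum.remove[of _ q]) auto
    then have "\<bar>\<Sigma> $ v t $ q * x $ q\<bar> = \<bar>\<Sum>w\<in>UNIV - {q}. \<Sigma> $ v t $ w * x $ w\<bar>"
      by (simp only: abs_minus_cancel)
    then have "\<Sigma> $ v t $ q * \<bar>x $ q\<bar> = \<bar>\<Sum>w\<in>UNIV - {q}. \<Sigma> $ v t $ w * x $ w\<bar>"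
      by (simp only: abs_mult abs_of_nonneg[OF \<Sigma>_nonneg])
    also have "\<dots> \<le> (\<Sum>w\<in>UNIV - {q}. \<bar>\<Sigma> $ v t $ w * x $ w\<bar>)" by (rule sum_abs)
    \<comment> \<open>For \<open>t = m\<close> the index \<open>Suc t\<close> lies beyond the walk;
      its term then merely enlarges the bound.\<close>
    also have "\<dots> \<le> (\<Sum>w\<in>UNIV - {q}. D / n + (if w = v t then 4 * H else 0) + (if w = v (Suc t) then 4 * H else 0))"
    proof (rule sum_mono)
      fix w assume w: "w \<in> UNIV - {q}"
      have base: "0 \<le> D / n" "0 \<le> 4 * H" using D0 DH n_ge_1 by auto
      consider "w \<in> F" | s where "w = v s" "s < m" | "x $ w = 0" using x_zero[of w] by auto
      then show "\<bar>\<Sigma> $ v t $ w * x $ w\<bar> \<le> D / n + (if w = v t then 4 * H else 0) + (if w = v (Suc t) then 4 * H else 0)"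
      proof cases
        case 1
        have "\<Sigma> $ v t $ w \<le> 4 / R" using boundF[OF 1, of "v t"] R by (simp add: field_simps)
        then have "\<Sigma> $ v t $ w * \<bar>x $ w\<bar> \<le> 4 / R * (8 * n * A)"
          using xF[OF 1] R by (intro mult_mono) auto
        also have "\<dots> = D / n" using n_ge_1 by (simp add: D_def power2_eq_square)
        finally have "\<bar>\<Sigma> $ v t $ w * x $ w\<bar> \<le> D / n" by (simp add: abs_mult \<Sigma>_nonneg)
        then show ?thesis by (rule order_trans) (use base in auto)
      next
        case 2
        show ?thesis
        proof (cases "s = t \<or> s = Suc t")
          case True
          then have "\<bar>x $ w\<bar> \<le> H" using late[of s] 2 t by auto
          then have "\<Sigma> $ v t $ w * \<bar>x $ w\<bar> \<le> 4 * H" using bound4[of "v t" w] by (intro mult_mono) auto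
          moreover have "w = v t \<or> w = v (Suc t)" using True 2 by auto
          ultimately show ?thesis using base by (auto simp: abs_mult \<Sigma>_nonneg)
        next
          case False
          have "Suc s \<noteq> t" using w 2 by (auto simp: q_def)
          then have "\<Sigma> $ v t $ w = 0" unfolding 2(1) using False 2 t by (intro chord) auto
          then show ?thesis using base by simp
        qed
      next
        case 3
        then show ?thesis using base by simp
      qed
    qed
    also have "\<dots> \<le> (\<Sum>w\<in>UNIV. D / n + (if w = v t then 4 * H else 0) + (if w = v (Suc t) then 4 * H else 0))"
      using D0 DH n_ge_1 by (intro sum_mono2) auto
    also have "\<dots> = D + 8 * H"
      using n_ge_1 by (simp add: sum.distrib n_def[symmetric])
    finally have "\<Sigma> $ v t $ q * \<bar>x $ q\<bar> \<le> 9 * H" using DH by simp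
    moreover have "c * \<bar>x $ q\<bar> \<le> \<Sigma> $ v t $ q * \<bar>x $ q\<bar>"
      using adj[of "t - 1"] t by (intro mult_right_mono) (auto simp: q_def sym[of "v t"])
    ultimately have "\<bar>x $ q\<bar> \<le> 9 / c * H" using c0 by (simp add: field_simps)
    then have new: "\<bar>x $ q\<bar> \<le> (9 / c) ^ Suc r * D" by (simp add: H_def mult.assoc)
    have "H \<le> (9 / c) ^ Suc r * D"
      unfolding H_def using c0 c1 D0 by (intro mult_right_mono power_increasing) (auto simp: field_simps)
    then have old: "\<bar>x $ v s\<bar> \<le> (9 / c) ^ Suc r * D" if "s \<le> m" "m - s \<le> r" for s
      using late[OF that] by simp
    show ?case
    proof (intro allI impI)
      fix s assume s: "s \<le> m" "m - s \<le> Suc r"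
      show "\<bar>x $ v s\<bar> \<le> (9 / c) ^ Suc r * D"
      proof (cases "m - s \<le> r")
        case False
        then have "s = t - 1" using s t by linarith
        then show ?thesis using new by (simp add: q_def)
      qed (use old s in blast)
    qed
  qed
  have "A \<in> (\<lambda>t. \<bar>x $ v t\<bar>) ` {..m}" unfolding A_def by (intro Max_in) auto
  then obtain t where "t \<le> m" "A = \<bar>x $ v t\<bar>" by auto
  then have "A \<le> (9 / c) ^ m * D" using bound_back[of m] by auto
  also have "\<dots> = (32 * n\<^sup>2 * (9 / c) ^ m) / R * A" by (simp add: D_def)
  also have "\<dots> < 1 * A"
  proof (rule mult_strict_right_mono[OF _ A0])
    show "32 * n\<^sup>2 * (9 / c) ^ m / R < 1"
      unfolding c_def using R_large R by (subst divide_less_eq_1_pos) auto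
  qed
  finally show False by simp
qed

end

section \<open>The two directions of the equivalence\<close>

lemma not_separated_dependent:
  fixes E :: "('n::finite \<times> 'n) set"
  assumes loops: "\<And>i. (i, i) \<in> E" and K: "i \<noteq> j" "K \<subseteq> UNIV - {i, j}"
    and not_sep: "\<not> separates (trek_graph E) (UNIV - ({i, j} \<union> K)) i j"
  shows "\<exists>S\<in>lyapunov_model E. \<not> gaussian_ci S i j K"
proof -
  let ?W = "insert i (insert j K)"
  obtain p where p: "is_path (trek_graph E) i p j" "set p \<inter> (UNIV - ({i, j} \<union> K)) = {}"
    using not_sep by (auto simp: separates_def)
  then have "walk (trek_graph E) ?W i j (length p - 1) (\<lambda>t. p ! t)"
    by (intro walk_of_path) auto
  then obtain m v where walk: "walk (trek_graph E) ?W i j m v"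
    and min: "\<And>m' v'. walk (trek_graph E) ?W i j m' v' \<Longrightarrow> m \<le> m'"
    by (rule minimal_walk) blast
  obtain N where N: "\<And>u v. (u, v) \<in> trek_graph E \<Longrightarrow> \<exists>a p q. (a, u) \<in> E ^^ p \<and> (a, v) \<in> E ^^ q \<and> p + q \<le> N"
    using trek_length_bound[of E] by blast
  define n where "n = real CARD('n)"
  define \<epsilon> where "\<epsilon> = 1 / (16 * n\<^sup>2)"
  define R where "R = max 1 (32 * n\<^sup>2 * (9 / (\<epsilon> / 2) ^ N) ^ m + 1)"
  define d where "d w = (if w \<in> K - v ` {..m} then R else 1)" for w
  have R: "1 \<le> R" "32 * n\<^sup>2 * (9 / (\<epsilon> / 2) ^ N) ^ m < R" by (auto simp: R_def)
  interpret scaled_drift E d n \<epsilon>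
    by unfold_locales (use loops R in \<open>auto simp: d_def n_def \<epsilon>_def\<close>)
  have "\<not> gaussian_ci \<Sigma> i j K"
  proof
    assume ci: "gaussian_ci \<Sigma> i j K"
    have "i \<notin> K" "j \<notin> K" using K by auto
    obtain x where x: "x $ i = 1" "\<And>u. u \<notin> insert i K \<Longrightarrow> x $ u = 0" "\<And>u. u \<in> K \<Longrightarrow> (\<Sigma> *v x) $ u = 0"
      using PD_regression[OF \<Sigma>_PD \<open>i \<notin> K\<close>] by blast
    have "(\<Sigma> *v x) $ j = 0"
      by (rule gaussian_ci_regression[OF \<Sigma>_PD ci \<open>j \<notin> K\<close> x])
    with x(3) have "(\<Sigma> *v x) $ k = 0" if "k \<in> insert j K" for k using that by blast
    with x(2) have "x $ i = 0"
      by (intro kernel_vector_vanishes[OF walk min K(1) \<open>j \<notin> K\<close> d_def R(1) N R(2)]) blast+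
    with x(1) show False by simp
  qed
  then show ?thesis using \<Sigma>_in_model by blast
qed

lemma separated_independent:
  fixes E :: "('n::finite \<times> 'n) set"
  assumes K: "i \<noteq> j" "K \<subseteq> UNIV - {i, j}"
    and sep: "separates (trek_graph E) (UNIV - ({i, j} \<union> K)) i j" and S: "S \<in> lyapunov_model E"
  shows "gaussian_ci S i j K"
proof -
  let ?W = "{i, j} \<union> K"
  define A where "A = {u \<in> ?W. \<exists>p. is_path (trek_graph E) i p u \<and> set p \<subseteq> ?W}"
  have "is_path (trek_graph E) i [i] i" by (simp add: is_path_def)
  then have i: "i \<in> A" unfolding A_def by fastforce
  have j: "j \<notin> A" using sep by (auto simp: A_def separates_def)
  have "S $ a $ b = 0" if ab: "a \<in> A" "b \<in> ?W - A" for a b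
  proof (rule ccontr)
    assume "S $ a $ b \<noteq> 0"
    then have edge: "(a, b) \<in> trek_graph E" using lyapunov_model_zero[OF S] by blast
    obtain p where p: "is_path (trek_graph E) i p a" "set p \<subseteq> ?W" using ab(1) by (auto simp: A_def)
    \<comment> \<open>Paths are distinct lists, so \<open>b\<close> may be appended only if it is
      new; otherwise the initial segment of \<open>p\<close> ending in \<open>b\<close> already puts
      \<open>b\<close> into \<open>A\<close>.\<close>
    have "b \<notin> set p"
    proof
      assume "b \<in> set p"
      then obtain q r where qr: "p = q @ b # r" by (meson split_list)
      then have qr': "p = (q @ [b]) @ r" by simp
      then have "is_path (trek_graph E) i (q @ [b]) b"
        using p(1) unfolding qr' is_path_def
        by (simp add: hd_append successively_append_iff del: append_assoc split: if_splits)
      moreover have "set (q @ [b]) \<subseteq> ?W" using p(2) qr by auto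
      ultimately show False using ab(2) unfolding A_def by blast
    qed
    then have "is_path (trek_graph E) i (p @ [b]) b"
      using p(1) edge by (auto simp: is_path_def successively_append_iff)
    moreover have "set (p @ [b]) \<subseteq> ?W" using p(2) ab(2) by auto
    ultimately show False using ab(2) unfolding A_def by blast
  qed
  moreover have "S \<in> PD" using S by (simp add: lyapunov_model_def)
  ultimately show ?thesis
    using i j by (intro gaussian_ci_block_diagonal[of S A "?W - A"]) (auto simp: A_def)
qed

theorem theorem4p1:
  fixes E :: "('n::finite \<times> 'n) set"
  assumes "\<And>i. (i, i) \<in> E"
  shows "markov_perfect (lyapunov_model E) (trek_graph E)"
  unfolding markov_perfect_def
proof (intro allI impI iffI ballI)
  fix i j :: 'n and K :: "'n set"
  assume K: "i \<noteq> j" "K \<subseteq> UNIV - {i, j}"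
  show "separates (trek_graph E) (UNIV - ({i, j} \<union> K)) i j"
    if "\<forall>S\<in>lyapunov_model E. gaussian_ci S i j K"
    using not_separated_dependent[OF assms K] that by blast
  show "gaussian_ci S i j K"
    if "separates (trek_graph E) (UNIV - ({i, j} \<union> K)) i j" "S \<in> lyapunov_model E" for S
    by (rule separated_independent[OF K that])
qed

end
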